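(* Let $\mathfrak g$ be a simple simply-laced Lie algebra of rank $r$. For every $p\in\mathcal A_+$, $$\langle0,\dots,0|\,p=\langle0,\dots,0|\,\varphi(p).$$
   Context: $\mathbb Z_+=\{0,1,2,\dots\}$, $I_r=\{1,\dots,r\}$; $C$ is the Cartan matrix of $\mathfrak g$, $\delta=\det C$, $\lambda=\delta C^{-1}$, $A_{i,j}=\min(i,j)$, $q=t^{-\delta}$ ($t$ an indeterminate), $\mathbb Z_t=\mathbb Z[t,t^{-1}]$. Quantum $Q$-system: $\widehat Q_{\alpha,0},\widehat Q_{\alpha,1}$ ($\alpha\in I_r$) are invertible variables with $\widehat Q_{\alpha,n}\widehat Q_{\beta,m}=t^{\lambda_{\alpha,\beta}(m-n)}\widehat Q_{\beta,m}\widehat Q_{\alpha,n}$ for $m,n\in\{0,1\}$, and $\widehat Q_{\alpha,n}$, $n\in\mathbb Z$, are defined by $t^{\lambda_{\alpha,\alpha}}\widehat Q_{\alpha,n+1}\widehat Q_{\alpha,n-1}=\widehat Q_{\alpha,n}^2-\prod_{\beta\ne\alpha}\widehat Q_{\beta,n}^{-C_{\alpha,\beta}}$; they lie in the quantum torus over $\mathbb Z_t$ generated by the $\widehat Q_{\alpha,0}^{\pm1},\widehat Q_{\alpha,1}^{\pm1}$. $\mathcal A_+$ is the $\mathbb Z_t$-algebra generated by all $\widehat Q_{\alpha,0}^{\pm1}$ and $\widehat Q_{\alpha,m}$, $m\ge1$, viewed inside this quantum torus. Products of non-commuting factors are ordered with indices increasing from left to right (in $\prod_i\prod_\alpha$,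 first by $i$, then by $\alpha$). Definition of $\varphi$: every $p\in\mathcal A_+$ can be written uniquely as a finite sum $$p=\sum_{\mathbf m\in\mathbb Z^r}c_{\mathbf m}\,\prod_{\alpha:\,m_\alpha<0}\widehat Q_{\alpha,-1}^{-m_\alpha}\prod_{\beta:\,m_\beta>0}\widehat Q_{\beta,1}^{m_\beta}$$ with $c_{\mathbf m}$ Laurent polynomials in $\{\widehat Q_{\alpha,0}\}_{\alpha\in I_r}$ over $\mathbb Z_t$; then $$\varphi(p)=\sum_{\mathbf m\in\mathbb Z_+^r}c_{\mathbf m}\Big|_{\widehat Q_{\alpha,0}=t^{-\sum_\beta\lambda_{\alpha,\beta}}}\ \prod_{\beta=1}^r\widehat Q_{\beta,1}^{m_\beta}\ \in\ \mathbb Z_t[\{\widehat Q_{\beta,1}\}_{\beta\in I_r}].$$ Graded multiplicities: for $a\in\mathbb Z_+$, $b\in\mathbb Z$, $\left[\begin{matrix}a+b\\ a\end{matrix}\right]_q$ is the coefficient of $x^a$ in $\prod_{i=0}^{b}(1-q^ix)^{-1}$ if $b\ge0$, and in $\prod_{i=0}^{-b-1}(1-q^{i+b+1}x)$ if $b<0$. For $K\ge1$, with indices $\alpha\in I_r$, $1\le i\le K$, put $\mathbf p=(I\otimes A)\mathbf n-(C\otimes A)\mathbf m$, $q_{\alpha,0}=\ell_\alpha-p_{\alpha,K}$, $Q(\mathbf m,\mathbf n)=-\frac12\mathbf m\cdot(\mathbf p+(I\otimes A)\mathbf n)$ and $M^{(K)}_{\boldsymbol\ell;\mathbf n}(q^{-1})=\sum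 q^{Q(\mathbf m,\mathbf n)}\prod_{\alpha,i}\left[\begin{matrix}m_{\alpha,i}+p_{\alpha,i}\\ m_{\alpha,i}\end{matrix}\right]_q$, the sum being over all $m_{\alpha,i}\in\mathbb Z_+$ with all $q_{\alpha,0}=0$ and all $p_{\alpha,i}\ge0$; $M_{\boldsymbol\ell;\mathbf n}(q^{-1})$ is its value for $K$ sufficiently large with respect to $\mathbf n$. Definition of the representation: a cyclic representation of $\mathcal A_+$ (acting from the right) with cyclic vector $\langle0,\dots,0|$ such that $\langle0,\dots,0|\widehat Q_{\alpha,0}=t^{-\sum_\beta\lambda_{\alpha,\beta}}\langle0,\dots,0|$ for all $\alpha$, and with $\mathbb Z_t$-basis $\langle p_1,\dots,p_r|$, $\mathbf p\in\mathbb Z_+^r$, determined by the following equations, one for each $(m_1,\dots,m_r)\in\mathbb Z_+^r$, with $n_{\alpha,i}=\delta_{i,m_\alpha}$ ($i\ge1$): $$\langle0,\dots,0|\prod_{i\ge1}\prod_{\alpha=1}^r\widehat Q_{\alpha,i}^{\,n_{\alpha,i}}=\sum_{\mathbf p\in\mathbb Z_+^r}t^{-\sum_{\alpha,\beta,i}n_{\alpha,i}\lambda_{\alpha,\beta}-\frac12\left(\sum_\alpha p_\alpha\lambda_{\alpha,\alpha}+\sum_{\alpha,\beta}\min(m_\alpha,m_\beta)\lambda_{\alpha,\beta}\right)}M_{\mathbf p;\mathbf n}(q^{-1})\,\langle p_1,\dots,p_r|.$$ *)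

theory Defs
  imports
    "HOL-Analysis.Analysis"
    "HOL-Computational_Algebra.Formal_Power_Series"
    "HOL-Library.Poly_Mapping"
    "HOL-Library.Groups_Big_Fun"
begin

unbundle no fps_syntax

section \<open>Cartan data\<close>

text \<open>
  The index set \<open>I_r\<close> is a type \<open>'n :: {finite, linorder}\<close> of cardinality \<open>r\<close>.  The Cartan matrices of
  simple simply-laced Lie algebras are exactly the indecomposable symmetric Cartan matrices of
  finite type (types A, D, E, with an arbitrary numbering of the nodes).
\<close>

type_synonym 'n intvec = "(int, 'n) vec"
type_synonym 'n intmat = "((int, 'n) vec, 'n) vec"

definition simply_laced_finite_cartan :: "'n::finite intmat \<Rightarrow> bool" where
  "simply_laced_finite_cartan C \<longleftrightarrow>
     (\<forall>\<alpha>. C $ \<alpha> $ \<alpha> = 2) \<and>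
     (\<forall>\<alpha> \<beta>. \<alpha> \<noteq> \<beta> \<longrightarrow> C $ \<alpha> $ \<beta> = 0 \<or> C $ \<alpha> $ \<beta> = -1) \<and>
     (\<forall>\<alpha> \<beta>. C $ \<alpha> $ \<beta> = C $ \<beta> $ \<alpha>) \<and>
     (\<forall>x :: real ^ 'n. x \<noteq> 0 \<longrightarrow> 0 < (\<Sum>\<alpha>\<in>UNIV. \<Sum>\<beta>\<in>UNIV. x $ \<alpha> * of_int (C $ \<alpha> $ \<beta>) * x $ \<beta>))"

definition indecomposable :: "'n::finite intmat \<Rightarrow> bool" where
  "indecomposable C \<longleftrightarrow>
     \<not> (\<exists>S. S \<noteq> {} \<and> S \<noteq> UNIV \<and> (\<forall>\<alpha>\<in>S. \<forall>\<beta>\<in>-S. C $ \<alpha> $ \<beta> = 0 \<and> C $ \<beta> $ \<alpha> = 0))"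

definition simple_simply_laced_cartan :: "'n::finite intmat \<Rightarrow> bool" where
  "simple_simply_laced_cartan C \<longleftrightarrow> simply_laced_finite_cartan C \<and> indecomposable C"

text \<open>
  \<open>\<lambda> = \<delta> C\<^sup>-\<^sup>1\<close> is the adjugate of \<open>C\<close>, hence integral: the floor only converts a rational number
  that is an integer to type \<open>int\<close>.
\<close>

definition lam :: "'n::finite intmat \<Rightarrow> 'n \<Rightarrow> 'n \<Rightarrow> int" where
  "lam C \<alpha> \<beta> = \<lfloor>rat_of_int (det C) * matrix_inv (\<chi> i j. rat_of_int (C $ i $ j)) $ \<alpha> $ \<beta>\<rfloor>"

section \<open>The ring \<open>\<int>[t, t\<^sup>-\<^sup>1]\<close> and the graded multiplicities\<close>

text \<open>Laurent polynomials: a finitely supported map sending an exponent of \<open>t\<close> to its coefficient.\<close>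

type_synonym zt = "int \<Rightarrow>\<^sub>0 int"

definition tpow :: "int \<Rightarrow> zt" where
  "tpow k = Poly_Mapping.single k 1"

definition qpow :: "int \<Rightarrow> int \<Rightarrow> zt" where
  "qpow \<delta> k = tpow (- \<delta> * k)"

text \<open>
  \<open>qbinom \<delta> a b\<close> is the bracket with upper entry \<open>a + b\<close> and lower entry \<open>a\<close>.  The right inverse
  of a power series takes the inverse of the constant term, here 1, as second argument.
\<close>

definition qbinom :: "int \<Rightarrow> nat \<Rightarrow> int \<Rightarrow> zt" where
  "qbinom \<delta> a b =
     fps_nth
       (if 0 \<le> b
        then (\<Prod>i\<in>{0..b}. fps_right_inverse (1 - fps_const (qpow \<delta> i) * fps_X) 1)
        else (\<Prod>i\<in>{0..-b-1}. 1 - fps_const (qpow \<delta> (i + b + 1)) * fps_X)) a"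

text \<open>\<open>Avec K v\<close> is \<open>(I \<otimes> A) v\<close>, and \<open>pvec\<close> is \<open>(I \<otimes> A) n - (C \<otimes> A) m\<close>, for the indices \<open>1, \<dots>, K\<close>.\<close>

definition Avec :: "nat \<Rightarrow> ('n \<Rightarrow> nat \<Rightarrow> nat) \<Rightarrow> 'n \<Rightarrow> nat \<Rightarrow> int" where
  "Avec K v \<alpha> i = (\<Sum>j\<in>{1..K}. int (min i j) * int (v \<alpha> j))"

definition pvec ::
  "'n::finite intmat \<Rightarrow> nat \<Rightarrow> ('n \<Rightarrow> nat \<Rightarrow> nat) \<Rightarrow> ('n \<Rightarrow> nat \<Rightarrow> nat) \<Rightarrow> 'n \<Rightarrow> nat \<Rightarrow> int" where
  "pvec C K n m \<alpha> i = Avec K n \<alpha> i - (\<Sum>\<beta>\<in>UNIV. C $ \<alpha> $ \<beta> * Avec K m \<beta> i)"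

text \<open>
  The quadratic form \<open>Q(m, n)\<close>.  The division is exact: the dividend is
  \<open>2 m\<cdot>(I \<otimes> A) n - m\<cdot>(C \<otimes> A) m\<close>, and \<open>C \<otimes> A\<close> is symmetric with even diagonal.
\<close>

definition Qform ::
  "'n::finite intmat \<Rightarrow> nat \<Rightarrow> ('n \<Rightarrow> nat \<Rightarrow> nat) \<Rightarrow> ('n \<Rightarrow> nat \<Rightarrow> nat) \<Rightarrow> int" where
  "Qform C K m n =
     - ((\<Sum>\<alpha>\<in>UNIV. \<Sum>i\<in>{1..K}. int (m \<alpha> i) * (pvec C K n m \<alpha> i + Avec K n \<alpha> i)) div 2)"

text \<open>
  The vectors \<open>m\<close> are extended by zero outside \<open>1 \<le> i \<le> K\<close>.  The set is finite:
  \<open>q\<^sub>\<alpha>\<^sub>,\<^sub>0 = 0\<close> fixes \<open>\<Sum>\<^sub>i i m\<^sub>\<beta>\<^sub>,\<^sub>i\<close> for every \<open>\<beta>\<close>, because \<open>C\<close> is invertible.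
\<close>

definition Mindex ::
  "'n::finite intmat \<Rightarrow> nat \<Rightarrow> ('n \<Rightarrow> nat) \<Rightarrow> ('n \<Rightarrow> nat \<Rightarrow> nat) \<Rightarrow> ('n \<Rightarrow> nat \<Rightarrow> nat) set" where
  "Mindex C K l n =
     {m. (\<forall>\<alpha> i. i \<notin> {1..K} \<longrightarrow> m \<alpha> i = 0) \<and>
         (\<forall>\<alpha>. int (l \<alpha>) - pvec C K n m \<alpha> K = 0) \<and>
         (\<forall>\<alpha>. \<forall>i\<in>{1..K}. 0 \<le> pvec C K n m \<alpha> i)}"

text \<open>\<open>MK C K l n\<close> and \<open>Minf C l n\<close> are the values at \<open>q\<^sup>-\<^sup>1\<close> of the multiplicities, as elements of \<open>zt\<close>.\<close>

definition MK :: "'n::finite intmat \<Rightarrow> nat \<Rightarrow> ('n \<Rightarrow> nat) \<Rightarrow> ('n \<Rightarrow> nat \<Rightarrow> nat) \<Rightarrow> zt" where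
  "MK C K l n =
     (\<Sum>m\<in>Mindex C K l n.
        qpow (det C) (Qform C K m n) *
        (\<Prod>\<alpha>\<in>UNIV. \<Prod>i\<in>{1..K}. qbinom (det C) (m \<alpha> i) (pvec C K n m \<alpha> i)))"

definition Minf :: "'n::finite intmat \<Rightarrow> ('n \<Rightarrow> nat) \<Rightarrow> ('n \<Rightarrow> nat \<Rightarrow> nat) \<Rightarrow> zt" where
  "Minf C l n = (THE c. eventually (\<lambda>K. MK C K l n = c) sequentially)"

section \<open>Ordered products and powers of units\<close>

definition oprod :: "('n::{finite, linorder} \<Rightarrow> 'a::monoid_mult) \<Rightarrow> 'a" where
  "oprod f = prod_list (map f (sorted_list_of_set UNIV))"

definition is_unit_of :: "'a::ring_1 \<Rightarrow> 'a \<Rightarrow> bool" where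
  "is_unit_of u v \<longleftrightarrow> u * v = 1 \<and> v * u = 1"

definition ring_inv :: "'a::ring_1 \<Rightarrow> 'a" where
  "ring_inv u = (THE v. is_unit_of u v)"

definition upow :: "'a::ring_1 \<Rightarrow> int \<Rightarrow> 'a" where
  "upow u k = (if 0 \<le> k then u ^ nat k else ring_inv u ^ nat (- k))"

section \<open>The quantum Q-system\<close>

definition basis_family :: "(zt \<Rightarrow> 'b::ab_group_add \<Rightarrow> 'b) \<Rightarrow> ('i \<Rightarrow> 'b) \<Rightarrow> bool" where
  "basis_family smul f \<longleftrightarrow>
     inj f \<and> \<not> module.dependent smul (range f) \<and> module.span smul (range f) = UNIV"

locale zt_algebra = module smul
  for smul :: "zt \<Rightarrow> 'a::ring_1 \<Rightarrow> 'a" +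
  assumes smul_mult_left: "smul c x * y = smul c (x * y)"
    and smul_mult_right: "x * smul c y = smul c (x * y)"

text \<open>
  The type \<open>'a\<close> carries the quantum torus: the \<open>\<int>\<^sub>t\<close>-algebra generated by the invertible
  \<open>Q \<alpha> 0\<close>, \<open>Q \<alpha> 1\<close> subject to the commutation relations, which is the algebra with these relations
  in which the ordered Laurent monomials in the generators form a \<open>\<int>\<^sub>t\<close>-basis.
\<close>

locale quantum_torus = zt_algebra smul
  for C :: "'n::{finite, linorder} intmat"
    and smul :: "zt \<Rightarrow> 'a::ring_1 \<Rightarrow> 'a"
    and Q :: "'n \<Rightarrow> int \<Rightarrow> 'a" +
  assumes Q_unit: "n \<in> {0, 1} \<Longrightarrow> \<exists>v. is_unit_of (Q \<alpha> n) v"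
    and Q_comm: "n \<in> {0, 1} \<Longrightarrow> m \<in> {0, 1} \<Longrightarrow>
       Q \<alpha> n * Q \<beta> m = smul (tpow (lam C \<alpha> \<beta> * (m - n))) (Q \<beta> m * Q \<alpha> n)"
    and Q_basis: "basis_family smul
       (\<lambda>(a :: 'n intvec, b :: 'n intvec).
          oprod (\<lambda>\<alpha>. upow (Q \<alpha> 0) (a $ \<alpha>)) * oprod (\<lambda>\<alpha>. upow (Q \<alpha> 1) (b $ \<alpha>)))"

locale quantum_Q_system = quantum_torus C smul Q
  for C :: "'n::{finite, linorder} intmat"
    and smul :: "zt \<Rightarrow> 'a::ring_1 \<Rightarrow> 'a"
    and Q :: "'n \<Rightarrow> int \<Rightarrow> 'a" +
  assumes Q_rec:
    "smul (tpow (lam C \<alpha> \<alpha>)) (Q \<alpha> (n + 1) * Q \<alpha> (n - 1)) =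
       (Q \<alpha> n)\<^sup>2 - oprod (\<lambda>\<beta>. if \<beta> = \<alpha> then 1 else Q \<beta> n ^ nat (- (C $ \<alpha> $ \<beta>)))"

text \<open>The algebra \<open>\<A>\<^sub>+\<close>, as a subset of the quantum torus.\<close>

inductive_set Aplus :: "(zt \<Rightarrow> 'a::ring_1 \<Rightarrow> 'a) \<Rightarrow> ('n \<Rightarrow> int \<Rightarrow> 'a) \<Rightarrow> 'a set"
  for smul Q where
  Q0: "Q \<alpha> 0 \<in> Aplus smul Q"
| Q0_inv: "ring_inv (Q \<alpha> 0) \<in> Aplus smul Q"
| Qm: "1 \<le> m \<Longrightarrow> Q \<alpha> m \<in> Aplus smul Q"
| one: "1 \<in> Aplus smul Q"
| smul: "x \<in> Aplus smul Q \<Longrightarrow> smul c x \<in> Aplus smul Q"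
| add: "x \<in> Aplus smul Q \<Longrightarrow> y \<in> Aplus smul Q \<Longrightarrow> x + y \<in> Aplus smul Q"
| mult: "x \<in> Aplus smul Q \<Longrightarrow> y \<in> Aplus smul Q \<Longrightarrow> x * y \<in> Aplus smul Q"

section \<open>The map \<open>\<phi>\<close>\<close>

text \<open>
  A Laurent polynomial in the commuting \<open>Q \<alpha> 0\<close> over \<open>\<int>\<^sub>t\<close> is a finitely supported map from
  exponent vectors to \<open>zt\<close>; a family \<open>(c\<^sub>m)\<close> of such is a finitely supported map to these.
\<close>

type_synonym 'n laurent = "'n intvec \<Rightarrow>\<^sub>0 zt"

definition laurent_Q0 ::
  "(zt \<Rightarrow> 'a::ring_1 \<Rightarrow> 'a) \<Rightarrow> ('n::{finite, linorder} \<Rightarrow> int \<Rightarrow> 'a) \<Rightarrow> 'n laurent \<Rightarrow> 'a" where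
  "laurent_Q0 smul Q c =
     (\<Sum>a\<in>Poly_Mapping.keys c. smul (Poly_Mapping.lookup c a) (oprod (\<lambda>\<alpha>. upow (Q \<alpha> 0) (a $ \<alpha>))))"

definition Q0_value :: "'n::finite intmat \<Rightarrow> 'n \<Rightarrow> int" where
  "Q0_value C \<alpha> = - (\<Sum>\<beta>\<in>UNIV. lam C \<alpha> \<beta>)"

text \<open>The specialization \<open>Q \<alpha> 0 = t ^ Q0_value C \<alpha>\<close>.\<close>

definition laurent_eval :: "'n::finite intmat \<Rightarrow> 'n laurent \<Rightarrow> zt" where
  "laurent_eval C c =
     (\<Sum>a\<in>Poly_Mapping.keys c. Poly_Mapping.lookup c a * (\<Prod>\<alpha>\<in>UNIV. tpow (Q0_value C \<alpha> * a $ \<alpha>)))"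

definition expansion ::
  "(zt \<Rightarrow> 'a::ring_1 \<Rightarrow> 'a) \<Rightarrow> ('n::{finite, linorder} \<Rightarrow> int \<Rightarrow> 'a)
     \<Rightarrow> ('n intvec \<Rightarrow>\<^sub>0 'n laurent) \<Rightarrow> 'a" where
  "expansion smul Q c =
     (\<Sum>m\<in>Poly_Mapping.keys c. laurent_Q0 smul Q (Poly_Mapping.lookup c m) *
        oprod (\<lambda>\<alpha>. if m $ \<alpha> < 0 then Q \<alpha> (-1) ^ nat (- (m $ \<alpha>)) else 1) *
        oprod (\<lambda>\<beta>. if 0 < m $ \<beta> then Q \<beta> 1 ^ nat (m $ \<beta>) else 1))"

definition phi ::
  "'n intmat \<Rightarrow> (zt \<Rightarrow> 'a::ring_1 \<Rightarrow> 'a) \<Rightarrow> ('n::{finite, linorder} \<Rightarrow> int \<Rightarrow> 'a) \<Rightarrow> 'a \<Rightarrow> 'a" where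
  "phi C smul Q p =
     (let c = (THE c. p = expansion smul Q c) in
      \<Sum>m\<in>{m \<in> Poly_Mapping.keys c. \<forall>\<alpha>. 0 \<le> m $ \<alpha>}.
        smul (laurent_eval C (Poly_Mapping.lookup c m)) (oprod (\<lambda>\<beta>. Q \<beta> 1 ^ nat (m $ \<beta>))))"

section \<open>The representation\<close>

definition ordered_Q_monomial ::
  "('n::{finite, linorder} \<Rightarrow> int \<Rightarrow> 'a::ring_1) \<Rightarrow> ('n \<Rightarrow> nat \<Rightarrow> nat) \<Rightarrow> 'a" where
  "ordered_Q_monomial Q n =
     prod_list (map (\<lambda>i. oprod (\<lambda>\<alpha>. Q \<alpha> (int i) ^ n \<alpha> i))
       (sorted_list_of_set {i. 1 \<le> i \<and> (\<exists>\<alpha>. n \<alpha> i \<noteq> 0)}))"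

definition unit_n :: "('n \<Rightarrow> nat) \<Rightarrow> 'n \<Rightarrow> nat \<Rightarrow> nat" where
  "unit_n m \<alpha> i = (if 1 \<le> i \<and> i = m \<alpha> then 1 else 0)"

text \<open>
  The exponent of \<open>t\<close> in the coefficient of the basis vector labelled by \<open>p\<close>, for \<open>n = unit_n m\<close>.
  The sum over \<open>i \<ge> 1\<close> is cut off at \<open>m \<alpha>\<close>, beyond which \<open>unit_n m \<alpha>\<close> vanishes.  The division by 2
  is exact whenever the multiplicity does not vanish: then \<open>p = m - C k\<close> with \<open>k\<close> integral, so the
  dividend has the parity of \<open>k\<cdot>C \<lambda> C k = \<delta> k\<cdot>C k\<close>, which is even.
\<close>

definition rep_exponent :: "'n::finite intmat \<Rightarrow> ('n \<Rightarrow> nat) \<Rightarrow> ('n \<Rightarrow> nat) \<Rightarrow> int" where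
  "rep_exponent C m p =
     - (\<Sum>\<alpha>\<in>UNIV. \<Sum>\<beta>\<in>UNIV. \<Sum>i\<in>{1..m \<alpha>}. int (unit_n m \<alpha> i) * lam C \<alpha> \<beta>)
     - ((\<Sum>\<alpha>\<in>UNIV. int (p \<alpha>) * lam C \<alpha> \<alpha>)
        + (\<Sum>\<alpha>\<in>UNIV. \<Sum>\<beta>\<in>UNIV. int (min (m \<alpha>) (m \<beta>)) * lam C \<alpha> \<beta>)) div 2"

text \<open>
  \<open>act x p\<close> is the right action of \<open>p \<in> \<A>\<^sub>+\<close> on \<open>x\<close> (nothing is assumed about \<open>act\<close> outside \<open>\<A>\<^sub>+\<close>),
  and \<open>bra p\<close> is the basis vector labelled by \<open>p\<close>.  The sum in \<open>bra_eq\<close> has finite support: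
  a non-vanishing multiplicity forces \<open>p = m - C k\<close> with \<open>k\<close> nonnegative integral, and
  \<open>C\<^sup>-\<^sup>1\<close> has positive entries.
\<close>

locale Aplus_representation = quantum_Q_system C smul Q + V: module vsmul
  for C :: "'n::{finite, linorder} intmat"
    and smul :: "zt \<Rightarrow> 'a::ring_1 \<Rightarrow> 'a"
    and Q :: "'n \<Rightarrow> int \<Rightarrow> 'a"
    and vsmul :: "zt \<Rightarrow> 'v::ab_group_add \<Rightarrow> 'v"
    and act :: "'v \<Rightarrow> 'a \<Rightarrow> 'v"
    and bra :: "('n \<Rightarrow> nat) \<Rightarrow> 'v" +
  assumes act_add_left: "p \<in> Aplus smul Q \<Longrightarrow> act (x + y) p = act x p + act y p"
    and act_smul_left: "p \<in> Aplus smul Q \<Longrightarrow> act (vsmul c x) p = vsmul c (act x p)"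
    and act_one: "act x 1 = x"
    and act_add: "p \<in> Aplus smul Q \<Longrightarrow> p' \<in> Aplus smul Q \<Longrightarrow> act x (p + p') = act x p + act x p'"
    and act_mult: "p \<in> Aplus smul Q \<Longrightarrow> p' \<in> Aplus smul Q \<Longrightarrow> act x (p * p') = act (act x p) p'"
    and act_smul: "p \<in> Aplus smul Q \<Longrightarrow> act x (smul c p) = vsmul c (act x p)"
    and cyclic: "\<exists>p\<in>Aplus smul Q. x = act (bra (\<lambda>_. 0)) p"
    and act_Q0: "act (bra (\<lambda>_. 0)) (Q \<alpha> 0) = vsmul (tpow (Q0_value C \<alpha>)) (bra (\<lambda>_. 0))"
    and bra_basis: "basis_family vsmul bra"
    and bra_eq: "act (bra (\<lambda>_. 0)) (ordered_Q_monomial Q (unit_n m)) =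
       Sum_any (\<lambda>p. vsmul (tpow (rep_exponent C m p) * Minf C p (unit_n m)) (bra p))"

end

theory Submission
  imports Defs
begin

text \<open>
  Grade the quantum torus by the exponents of the \<open>Q \<alpha> 1\<close>; conjugation by the \<open>Q \<alpha> 0\<close> separates the
  degrees up to scalars.  Two facts about the Q-system are needed.  First, the reflection
  \<open>n \<mapsto> -n\<close> is an anti-automorphism of the recursion, so every element of \<open>\<A>\<^sub>+\<close> is also a Laurent
  polynomial in the \<open>Q \<alpha> 0\<close> and \<open>Q \<alpha> (-1)\<close>; comparing both Laurent expansions and using
  that the binomials \<open>Q \<alpha> (-1) * Q \<alpha> 1\<close> are pairwise coprime for different \<open>\<alpha>\<close> gives the expansion
  that defines \<open>\<phi>\<close>.  Second, the lowest terms of the \<open>Q \<alpha> n\<close> are given by Chebyshev polynomials of the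
  adjacency matrix of the Dynkin diagram, which are positive up to the Coxeter number \<open>h\<close>, and the
  lowest term of \<open>Q \<alpha> (h + 1)\<close> is a monomial in the \<open>Q \<beta> 0\<close> times some \<open>Q \<gamma> (-1)\<close>.  Hence a multiple of every
  \<open>Q \<gamma> (-1)\<close> lies in \<open>\<A>\<^sub>+\<close>, and with these lowering operators no monomial in the \<open>Q \<alpha> 1\<close> kills the
  cyclic vector.

  The multiplicities enter only through their unitriangularity: the vectors obtained from the ordered
  monomials span the representation.  The leading degree of such a monomial has only nonnegative
  entries and its leading coefficient does not kill the cyclic vector, so an element of \<open>\<A>\<^sub>+\<close> of any other
  degree must kill the cyclic vector.
\<close>

section \<open>Twisted group algebras over the Laurent polynomials\<close>

text \<open>The scalars met when degrees are separated are differences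
  \<open>tpow a - tpow b\<close>, which are in general not invertible in \<open>zt\<close>. Hence
  the arguments run in the saturations \<open>Ahat\<close> and \<open>Jhat\<close> of the algebra
  and of the annihilator of the cyclic vector; since the representation is free over
  \<open>zt\<close>, nothing is lost in the end. The annihilator is only a right ideal.
  Multiplication from the left is available for the monomials \<open>X a\<close>, because the cyclic
  vector is their common eigenvector; this fits the expansion, whose coefficients stand on the left.
  A second obstacle is that \<open>Q \<alpha> (-1)\<close> is, up to a unit, a binomial and so has
  no inverse in the torus. The reflection therefore does not extend to the torus as a map; it is
  used as a relation in which denominators are cleared. No closed formula for
  \<open>Q \<alpha> n\<close> is used. Extremal terms are propagated through the recursion, where
  \<open>Q \<alpha> (n + 1)\<close> is known only as a quotient, so leading terms must behave well
  under division and not only under products.\<close>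

lemma tpow_0 [simp]: "tpow 0 = 1"
  by (simp add: tpow_def)

lemma tpow_add: "tpow (a + b) = tpow a * tpow b"
  by (simp add: tpow_def mult_single)

lemma tpow_nonzero [simp]: "tpow a \<noteq> 0"
  by (metis mult_zero_left tpow_0 tpow_add add.right_inverse zero_neq_one)

lemma tpow_inject: "tpow a = tpow b \<longleftrightarrow> a = b"
proof
  assume "tpow a = tpow b"
  then have "Poly_Mapping.lookup (tpow a) a = Poly_Mapping.lookup (tpow b) a" by simp
  then show "a = b" by (simp add: tpow_def lookup_single when_def split: if_splits)
qed simp

lemma tpow_sum: "tpow (sum f A) = (\<Prod>x\<in>A. tpow (f x))"
  by (induction A rule: infinite_finite_induct) (simp_all add: tpow_add)

context zt_algebra
begin

lemma smul_tpow_tpow: "smul (tpow a) (smul (tpow b) x) = smul (tpow (a + b)) x"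
  by (simp add: tpow_add)

lemma smul_mult_smul: "smul c x * smul d y = smul (c * d) (x * y)"
  by (simp add: smul_mult_left smul_mult_right mult.commute)

end

locale twisted_group_algebra = zt_algebra smul
  for smul :: "zt \<Rightarrow> 'a::ring_1 \<Rightarrow> 'a" +
  fixes E :: "'i::ab_group_add \<Rightarrow> 'a" and w :: "'i \<Rightarrow> 'i \<Rightarrow> int"
  assumes E_basis: "basis_family smul E"
    and E_mult: "E i * E j = smul (tpow (w i j)) (E (i + j))"
begin

lemma E_inj: "inj E" and E_indep: "\<not> dependent (range E)" and E_span: "span (range E) = UNIV"
  using E_basis by (auto simp: basis_family_def)

definition cf :: "'a \<Rightarrow> 'i \<Rightarrow> zt" where
  "cf x i = representation (range E) x (E i)"

definition supp :: "'a \<Rightarrow> 'i set" where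
  "supp x = {i. cf x i \<noteq> 0}"

definition lin :: "('i \<Rightarrow> 'a) \<Rightarrow> 'a \<Rightarrow> 'a" where
  "lin F x = (\<Sum>i\<in>supp x. smul (cf x i) (F i))"

lemma finite_supp [simp]: "finite (supp x)"
proof -
  have "finite (E -` {b. representation (range E) x b \<noteq> 0})"
    by (intro finite_vimageI finite_representation E_inj)
  then show ?thesis by (simp add: supp_def cf_def vimage_def)
qed

lemma in_supp: "i \<in> supp x \<longleftrightarrow> cf x i \<noteq> 0"
  by (simp add: supp_def)

lemma cf_add [simp]: "cf (x + y) i = cf x i + cf y i"
  by (simp add: cf_def representation_add E_indep E_span)

lemma cf_diff [simp]: "cf (x - y) i = cf x i - cf y i"
  by (simp add: cf_def representation_diff E_indep E_span)

lemma cf_minus [simp]: "cf (- x) i = - cf x i"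
  by (simp add: cf_def representation_neg E_indep E_span)

lemma cf_smul [simp]: "cf (smul c x) i = c * cf x i"
  by (simp add: cf_def representation_scale E_indep E_span)

lemma cf_zero [simp]: "cf 0 i = 0"
  by (simp add: cf_def representation_zero)

lemma cf_sum [simp]: "cf (sum f A) i = (\<Sum>x\<in>A. cf (f x) i)"
  by (induction A rule: infinite_finite_induct) simp_all

lemma cf_E: "cf (E j) i = (if i = j then 1 else 0)"
  using E_inj by (auto simp: cf_def representation_basis E_indep inj_def)

lemma expand: "x = (\<Sum>i\<in>supp x. smul (cf x i) (E i))"
proof -
  have "x = (\<Sum>b | representation (range E) x b \<noteq> 0. smul (representation (range E) x b) b)"
    by (rule sum_nonzero_representation_eq[symmetric]) (simp_all add: E_indep E_span)
  also have "{b. representation (range E) x b \<noteq> 0} = E ` supp x"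
    using representation_ne_zero[of "range E" x] by (auto simp: supp_def cf_def)
  also have "(\<Sum>b\<in>E ` supp x. smul (representation (range E) x b) b) =
      (\<Sum>i\<in>supp x. smul (cf x i) (E i))"
    using E_inj by (subst sum.reindex) (auto simp: cf_def inj_def inj_on_def)
  finally show ?thesis .
qed

lemma cf_ext: "(\<And>i. cf x i = cf y i) \<Longrightarrow> x = y"
  using expand[of x] expand[of y] by (simp add: supp_def)

lemma E_nonzero [simp]: "E i \<noteq> 0"
  using cf_E[of i i] by auto

lemma supp_eq_empty [simp]: "supp x = {} \<longleftrightarrow> x = 0"
  by (auto simp: supp_def intro: cf_ext)

lemma supp_nonempty: "x \<noteq> 0 \<Longrightarrow> supp x \<noteq> {}"
  by simp

lemma lin_superset:
  assumes "finite A" "supp x \<subseteq> A"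
  shows "lin F x = (\<Sum>i\<in>A. smul (cf x i) (F i))"
  unfolding lin_def using assms by (intro sum.mono_neutral_left) (auto simp: in_supp)

lemma lin_add [simp]: "lin F (x + y) = lin F x + lin F y"
proof -
  let ?A = "supp x \<union> supp y"
  have "supp (x + y) \<subseteq> ?A" by (auto simp: in_supp)
  then show ?thesis
    by (simp add: lin_superset[of ?A] sum.distrib scale_left_distrib)
qed

lemma lin_smul [simp]: "lin F (smul c x) = smul c (lin F x)"
proof -
  have "supp (smul c x) \<subseteq> supp x" by (auto simp: in_supp)
  then show ?thesis
    by (simp add: lin_superset[of "supp x"] scale_sum_right)
qed

lemma lin_zero [simp]: "lin F 0 = 0"
  by (simp add: lin_def)

lemma lin_minus [simp]: "lin F (- x) = - lin F x"
  by (metis lin_add lin_zero add_eq_0_iff)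

lemma lin_diff [simp]: "lin F (x - y) = lin F x - lin F y"
  by (metis lin_add lin_minus diff_conv_add_uminus)

lemma lin_sum [simp]: "lin F (sum f A) = (\<Sum>x\<in>A. lin F (f x))"
  by (induction A rule: infinite_finite_induct) simp_all

lemma lin_E [simp]: "lin F (E i) = F i"
proof -
  have "supp (E i) = {i}" by (auto simp: in_supp cf_E split: if_splits)
  then show ?thesis by (simp add: lin_def cf_E)
qed

lemma cf_mult_support:
  assumes "finite A" "supp x \<subseteq> A"
  shows "cf (x * y) k = (\<Sum>i\<in>A. cf x i * cf y (k - i) * tpow (w i (k - i)))"
proof -
  have "cf (x * y) k = cf ((\<Sum>i\<in>supp x. smul (cf x i) (E i)) * (\<Sum>j\<in>supp y. smul (cf y j) (E j))) k"
    using expand[of x] expand[of y] by simp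
  also have "\<dots> = (\<Sum>i\<in>supp x. \<Sum>j\<in>supp y. cf x i * cf y j * tpow (w i j) * cf (E (i + j)) k)"
    by (simp add: sum_product smul_mult_smul E_mult mult.assoc)
  also have "\<dots> = (\<Sum>i\<in>supp x. cf x i * cf y (k - i) * tpow (w i (k - i)))"
  proof (rule sum.cong[OF refl])
    fix i
    have "(\<Sum>j\<in>supp y. cf x i * cf y j * tpow (w i j) * cf (E (i + j)) k) =
        (\<Sum>j\<in>supp y. if j = k - i then cf x i * cf y (k - i) * tpow (w i (k - i)) else 0)"
      by (intro sum.cong) (auto simp: cf_E algebra_simps)
    also have "\<dots> = cf x i * cf y (k - i) * tpow (w i (k - i))"
      by (simp add: sum.delta in_supp)
    finally show "(\<Sum>j\<in>supp y. cf x i * cf y j * tpow (w i j) * cf (E (i + j)) k) =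
        cf x i * cf y (k - i) * tpow (w i (k - i))" .
  qed
  also have "\<dots> = (\<Sum>i\<in>A. cf x i * cf y (k - i) * tpow (w i (k - i)))"
    using assms by (intro sum.mono_neutral_left) (auto simp: in_supp)
  finally show ?thesis .
qed

lemmas cf_mult = cf_mult_support[OF finite_supp order_refl]

lemma supp_mult: "k \<in> supp (x * y) \<Longrightarrow> \<exists>i\<in>supp x. \<exists>j\<in>supp y. k = i + j"
proof -
  assume "k \<in> supp (x * y)"
  then have "(\<Sum>i\<in>supp x. cf x i * cf y (k - i) * tpow (w i (k - i))) \<noteq> 0"
    by (simp add: in_supp cf_mult)
  then obtain i where "i \<in> supp x" "cf x i * cf y (k - i) * tpow (w i (k - i)) \<noteq> 0"
    using sum.not_neutral_contains_not_neutral by blast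
  then show ?thesis by (intro bexI[of _ i] bexI[of _ "k - i"]) (auto simp: in_supp)
qed

text \<open>A degree reached by a single pair of monomials cannot cancel. Neither \<open>i\<close>
  nor \<open>j\<close> has to lie in the respective support: otherwise both sides vanish.\<close>

lemma cf_mult_unique:
  assumes "\<And>i' j'. i' \<in> supp x \<Longrightarrow> j' \<in> supp y \<Longrightarrow> i' + j' = i + j \<Longrightarrow> i' = i"
  shows "cf (x * y) (i + j) = cf x i * cf y j * tpow (w i j)"
proof -
  have "cf (x * y) (i + j) =
      (\<Sum>i'\<in>insert i (supp x). cf x i' * cf y (i + j - i') * tpow (w i' (i + j - i')))"
    by (rule cf_mult_support) auto
  also have "\<dots> = (\<Sum>i'\<in>insert i (supp x). if i' = i then cf x i * cf y j * tpow (w i j) else 0)"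
  proof (rule sum.cong[OF refl])
    fix i'
    have "cf x i' * cf y (i + j - i') = 0" if "i' \<noteq> i"
      using assms[of i' "i + j - i'"] that by (auto simp: in_supp)
    then show "cf x i' * cf y (i + j - i') * tpow (w i' (i + j - i')) =
        (if i' = i then cf x i * cf y j * tpow (w i j) else 0)" by auto
  qed
  finally show ?thesis by simp
qed

lemma cf_E_mult: "cf (E j * x) k = cf x (k - j) * tpow (w j (k - j))"
proof -
  have "cf (E j * x) (j + (k - j)) = cf (E j) j * cf x (k - j) * tpow (w j (k - j))"
    by (rule cf_mult_unique) (auto simp: in_supp cf_E split: if_splits)
  then show ?thesis by (simp add: cf_E)
qed

definition restr :: "('i \<Rightarrow> bool) \<Rightarrow> 'a \<Rightarrow> 'a" where
  "restr S = lin (\<lambda>i. if S i then E i else 0)"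

lemma cf_restr [simp]: "cf (restr S x) i = (if S i then cf x i else 0)"
proof -
  have "cf (restr S x) i = (\<Sum>j\<in>supp x. if j = i then (if S i then cf x i else 0) else 0)"
    unfolding restr_def lin_def cf_sum cf_smul by (intro sum.cong) (auto simp: cf_E)
  then show ?thesis by (auto simp: sum.delta in_supp)
qed

subsection \<open>Leading terms with respect to a cone\<close>

text \<open>The positive elements of a translation-invariant strict partial order:
  \<open>P (j - i)\<close> reads as \<open>i\<close> strictly below \<open>j\<close>. Totality is
  not demanded, since the heights used later do not separate all exponents.\<close>

definition cone :: "('i \<Rightarrow> bool) \<Rightarrow> bool" where
  "cone P \<longleftrightarrow> (\<forall>i j. P i \<longrightarrow> P j \<longrightarrow> P (i + j)) \<and> \<not> P 0"

text \<open>The exponent \<open>i\<close> is the least one of the support, not merely a minimal one;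
  this makes leading terms multiplicative although the order is only partial.\<close>

definition LF :: "('i \<Rightarrow> bool) \<Rightarrow> 'i \<Rightarrow> 'a \<Rightarrow> bool" where
  "LF P i x \<longleftrightarrow> cf x i \<noteq> 0 \<and> (\<forall>j\<in>supp x. j = i \<or> P (j - i))"

lemma coneD: "cone P \<Longrightarrow> P i \<Longrightarrow> P j \<Longrightarrow> P (i + j)" "cone P \<Longrightarrow> \<not> P 0"
  by (auto simp: cone_def)

lemma cone_antisym: "cone P \<Longrightarrow> P i \<Longrightarrow> \<not> P (- i)"
  using coneD(1)[of P i "- i"] coneD(2)[of P] by auto

lemma LF_nonzero: "LF P i x \<Longrightarrow> x \<noteq> 0"
  by (auto simp: LF_def)

lemma LF_E: "LF P i (E i)"
  by (auto simp: LF_def in_supp cf_E split: if_splits)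

lemma LF_mult:
  assumes P: "cone P" and x: "LF P i x" and y: "LF P j y"
  shows "LF P (i + j) (x * y)"
proof -
  have "cf (x * y) (i + j) = cf x i * cf y j * tpow (w i j)"
  proof (rule cf_mult_unique, rule ccontr)
    fix i' j' assume *: "i' \<in> supp x" "j' \<in> supp y" "i' + j' = i + j" "i' \<noteq> i"
    then have "P (i' - i)" using x by (auto simp: LF_def)
    moreover have "j' - j = - (i' - i)" using *(3) by (simp add: algebra_simps)
    then have "j' \<noteq> j" using *(4) by auto
    then have "P (- (i' - i))" using y * \<open>j' - j = - (i' - i)\<close> by (auto simp: LF_def)
    ultimately show False using cone_antisym[OF P] by blast
  qed
  then have "cf (x * y) (i + j) \<noteq> 0" using x y by (simp add: LF_def)
  moreover have "k = i + j \<or> P (k - (i + j))" if "k \<in> supp (x * y)" for k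
  proof -
    obtain i' j' where k: "i' \<in> supp x" "j' \<in> supp y" "k = i' + j'" using supp_mult[OF \<open>k \<in> _\<close>] by blast
    have "k - (i + j) = (i' - i) + (j' - j)" using k by simp
    moreover have "i' = i \<or> P (i' - i)" "j' = j \<or> P (j' - j)" using x y k by (auto simp: LF_def)
    ultimately show ?thesis using coneD(1)[OF P, of "i' - i" "j' - j"] k(3) by (elim disjE) (auto simp: algebra_simps)
  qed
  ultimately show ?thesis by (auto simp: LF_def)
qed

lemma LF_diff:
  assumes P: "cone P" and x: "LF P i x" and y: "LF P j y" and ij: "P (j - i)"
  shows "LF P i (x - y)"
proof -
  have "cf y i = 0"
  proof (rule ccontr)
    assume "cf y i \<noteq> 0"
    then have "i = j \<or> P (i - j)" using y by (auto simp: LF_def in_supp)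
    then show False using ij cone_antisym[OF P ij] coneD(2)[OF P] by auto
  qed
  moreover have "k = i \<or> P (k - i)" if "cf y k \<noteq> 0" for k
  proof -
    have "k = j \<or> P (k - j)" using y that by (auto simp: LF_def in_supp)
    then show ?thesis using ij coneD(1)[OF P, of "k - j" "j - i"] by auto
  qed
  moreover have "k = i \<or> P (k - i)" if "cf x k \<noteq> 0" for k
    using x that by (auto simp: LF_def in_supp)
  moreover have "cf x i \<noteq> 0" using x by (simp add: LF_def)
  ultimately have "k = i \<or> P (k - i)" if "cf x k - cf y k \<noteq> 0" for k
    using that by (cases "cf x k = 0") auto
  moreover have "cf x i - cf y i \<noteq> 0" using x \<open>cf y i = 0\<close> by (simp add: LF_def)
  ultimately show ?thesis unfolding LF_def Ball_def in_supp cf_diff by blast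
qed

lemma LF_uminus: "LF P i x \<Longrightarrow> LF P i (- x)"
  by (auto simp: LF_def in_supp)

lemma cone_minimal:
  assumes P: "cone P" and A: "finite A" "a \<in> A"
  shows "\<exists>m\<in>A. (a = m \<or> P (a - m)) \<and> (\<forall>x\<in>A. \<not> P (m - x))"
proof -
  let ?B = "{m\<in>A. a = m \<or> P (a - m)}"
  have tr: "P (x - z)" if "P (x - y)" "P (y - z)" for x y z
    using coneD(1)[OF P that] by simp
  have "\<exists>m\<in>?B. \<forall>x\<in>?B. x \<noteq> m \<longrightarrow> \<not> P (m - x)"
  proof (rule Finite_Set.bex_min_element)
    show "asymp_on ?B (\<lambda>x y. P (y - x))"
      using cone_antisym[OF P] by (intro asymp_onI) (metis minus_diff_eq)
    show "transp_on ?B (\<lambda>x y. P (y - x))"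
      using tr by (intro transp_onI) blast
  qed (use A in auto)
  then obtain m where m: "m \<in> ?B" "\<And>x. x \<in> ?B \<Longrightarrow> x \<noteq> m \<Longrightarrow> \<not> P (m - x)" by blast
  have "\<not> P (m - x)" if "x \<in> A" for x
  proof
    assume "P (m - x)"
    moreover from this have "x \<noteq> m" using coneD(2)[OF P] by auto
    moreover have "x \<in> ?B" using m(1) tr[of a m x] that \<open>P (m - x)\<close> by auto
    ultimately show False using m(2) by blast
  qed
  then show ?thesis using m(1) by blast
qed

text \<open>The factor \<open>x\<close> need not have a leading term a priori: all minimal elements of its support are
  shown to coincide.\<close>

lemma LF_div:
  assumes P: "cone P" and z: "LF P c (x * y)" and y: "LF P e y"
  shows "LF P (c - e) x"
proof -
  \<comment> \<open>A minimal exponent of \<open>x\<close> plus the least exponent of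
    \<open>y\<close> is reached by no other pair, so it survives in the product.\<close>
  have min: "cf (x * y) (m + e) \<noteq> 0" if "m \<in> supp x" "\<forall>i\<in>supp x. \<not> P (m - i)" for m
  proof -
    have "cf (x * y) (m + e) = cf x m * cf y e * tpow (w m e)"
    proof (rule cf_mult_unique, rule ccontr)
      fix i' j' assume *: "i' \<in> supp x" "j' \<in> supp y" "i' + j' = m + e" "i' \<noteq> m"
      then have eq: "m - i' = j' - e" by (simp add: algebra_simps)
      then have "j' \<noteq> e" using *(4) by auto
      then have "P (m - i')" using y * eq by (auto simp: LF_def)
      then show False using that * by blast
    qed
    then show ?thesis using that y by (simp add: LF_def in_supp)
  qed
  have "c \<in> supp (x * y)" using z by (simp add: LF_def in_supp)
  then obtain i'' j'' where ij: "i'' \<in> supp x" "j'' \<in> supp y" "c = i'' + j''" using supp_mult by blast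
  obtain m where m: "m \<in> supp x" "i'' = m \<or> P (i'' - m)" "\<forall>i\<in>supp x. \<not> P (m - i)"
    using cone_minimal[OF P finite_supp ij(1)] by blast
  have sum: "a + b = 0 \<or> P (a + b)" if "a = 0 \<or> P a" "b = 0 \<or> P b" for a b
    using that coneD(1)[OF P, of a b] by auto
  have all_min: "n + e = c" if n: "n \<in> supp x" "\<forall>i\<in>supp x. \<not> P (n - i)" for n
  proof -
    have "m + e = c"
    proof (rule ccontr)
      assume ne: "m + e \<noteq> c"
      then have "P (m + e - c)" using min[OF m(1,3)] z by (auto simp: LF_def in_supp)
      \<comment> \<open>Since \<open>c = i'' + j''\<close> lies above \<open>m + e\<close> in both
        summands, and the least exponent \<open>c\<close> also lies below \<open>m + e\<close>,
        antisymmetry gives equality.\<close>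
      moreover have "(i'' - m) + (j'' - e) = 0 \<or> P ((i'' - m) + (j'' - e))"
        using m(2) y ij(2) by (intro sum) (auto simp: LF_def)
      then have "P (- (m + e - c))" using ij(3) ne by (simp add: algebra_simps)
      ultimately show False using cone_antisym[OF P] by blast
    qed
    moreover have "n + e = c \<or> P (n + e - c)" using min[OF n] z by (auto simp: LF_def in_supp)
    moreover have "n + e - c = n - m" if "m + e = c" using that by (simp add: algebra_simps)
    ultimately show ?thesis using n(2) m(1) by auto
  qed
  then have mc: "m = c - e" using m by (simp add: eq_diff_eq)
  have "i = m \<or> P (i - m)" if i: "i \<in> supp x" for i
  proof -
    obtain n where n: "n \<in> supp x" "i = n \<or> P (i - n)" "\<forall>j\<in>supp x. \<not> P (n - j)"
      using cone_minimal[OF P finite_supp i] by blast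
    then have "n + e = c" using all_min[of n] by blast
    then have "n = m" unfolding mc by (simp add: eq_diff_eq)
    then show ?thesis using n by simp
  qed
  then show ?thesis using m(1) mc by (auto simp: LF_def in_supp)
qed

lemma LF_exists:
  assumes P: "cone P" and total: "\<And>i. i = 0 \<or> P i \<or> P (- i)" and x: "x \<noteq> 0"
  shows "\<exists>i. LF P i x"
proof -
  obtain a where a: "a \<in> supp x" using supp_nonempty[OF x] by blast
  obtain m where m: "m \<in> supp x" "\<forall>i\<in>supp x. \<not> P (m - i)"
    using cone_minimal[OF P finite_supp a] by blast
  have "i = m \<or> P (i - m)" if "i \<in> supp x" for i
  proof -
    have "\<not> P (m - i)" using m(2) that by blast
    moreover have "- (m - i) = i - m" by simp
    ultimately have "m - i = 0 \<or> P (i - m)" using total[of "m - i"] by metis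
    then show ?thesis unfolding right_minus_eq by (elim disjE) simp_all
  qed
  then have "LF P m x" using m(1) unfolding LF_def in_supp[symmetric] by blast
  then show ?thesis by blast
qed

lemma mult_nonzero:
  fixes x y :: 'a
  assumes P: "cone P" and total: "\<And>i. i = 0 \<or> P i \<or> P (- i)" and xy: "x \<noteq> 0" "y \<noteq> 0"
  shows "x * y \<noteq> 0"
proof -
  from LF_exists[OF P total xy(1)] obtain i where x: "LF P i x" ..
  from LF_exists[OF P total xy(2)] obtain j where y: "LF P j y" ..
  show ?thesis by (rule LF_nonzero[OF LF_mult[OF P x y]])
qed

end

section \<open>Cartan matrices\<close>

lemma det_of_int: "det (\<chi> i j. of_int (A $ i $ j)) = (of_int (det (A :: 'n::finite intmat)) :: 'b::comm_ring_1)"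
  by (simp add: det_def)

lemma sum_axis_left [simp]:
  fixes f :: "'n::finite \<Rightarrow> 'b::semiring_1"
  shows "(\<Sum>j\<in>UNIV. axis i 1 $ j * f j) = f i"
proof -
  have "(\<Sum>j\<in>UNIV. axis i 1 $ j * f j) = (\<Sum>j\<in>UNIV. if j = i then f j else 0)"
    by (intro sum.cong) (auto simp: axis_def)
  then show ?thesis by simp
qed

lemma sum_axis_right [simp]:
  fixes f :: "'n::finite \<Rightarrow> 'b::semiring_1"
  shows "(\<Sum>j\<in>UNIV. f j * axis i 1 $ j) = f i"
proof -
  have "(\<Sum>j\<in>UNIV. f j * axis i 1 $ j) = (\<Sum>j\<in>UNIV. if j = i then f j else 0)"
    by (intro sum.cong) (auto simp: axis_def)
  then show ?thesis by simp
qed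

lemma fps_prod_nth_zero: "fps_nth (\<Prod>x\<in>A. f x) 0 = (\<Prod>x\<in>A. fps_nth (f x) 0 :: 'b::comm_semiring_1)"
  by (induction A rule: infinite_finite_induct) simp_all

locale cartan =
  fixes C :: "'n::finite intmat"
  assumes cartan: "simple_simply_laced_cartan C"
begin

lemma C_diag: "C $ i $ i = 2"
  using cartan by (auto simp: simple_simply_laced_cartan_def simply_laced_finite_cartan_def)

lemma C_off: "i \<noteq> j \<Longrightarrow> C $ i $ j \<le> 0"
  using cartan unfolding simple_simply_laced_cartan_def simply_laced_finite_cartan_def
  by (metis neg_le_0_iff_le order_refl zero_le_one)

lemma C_sym: "C $ i $ j = C $ j $ i"
  using cartan by (auto simp: simple_simply_laced_cartan_def simply_laced_finite_cartan_def)

lemma C_posdef_real: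
  "(x :: real ^ 'n) \<noteq> 0 \<Longrightarrow> 0 < (\<Sum>i\<in>UNIV. \<Sum>j\<in>UNIV. x $ i * of_int (C $ i $ j) * x $ j)"
  using cartan by (auto simp: simple_simply_laced_cartan_def simply_laced_finite_cartan_def)

definition qf :: "'n intvec \<Rightarrow> int" where
  "qf x = (\<Sum>i\<in>UNIV. \<Sum>j\<in>UNIV. x $ i * C $ i $ j * x $ j)"

lemma qf_pos:
  assumes "x \<noteq> 0"
  shows "0 < qf x"
proof -
  let ?y = "\<chi> i. real_of_int (x $ i)"
  have "?y \<noteq> 0" using assms by (auto simp: vec_eq_iff)
  then have "0 < (\<Sum>i\<in>UNIV. \<Sum>j\<in>UNIV. ?y $ i * of_int (C $ i $ j) * ?y $ j)"
    by (rule C_posdef_real)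
  also have "\<dots> = real_of_int (qf x)" by (simp add: qf_def)
  finally show ?thesis by simp
qed

lemma qf_nonneg: "0 \<le> qf x"
  using qf_pos[of x] by (cases "x = 0") (auto simp: qf_def)

lemma det_nonzero: "det C \<noteq> 0"
proof
  assume "det C = 0"
  let ?A = "\<chi> i j. real_of_int (C $ i $ j)"
  have "det ?A = 0" using det_of_int[where 'b = real, of C] \<open>det C = 0\<close> by simp
  then have "\<not> invertible ?A" by (simp add: invertible_det_nz)
  then obtain x where x: "?A *v x = 0" "x \<noteq> 0"
    using matrix_left_invertible_ker[of ?A] invertible_left_inverse[of ?A] by blast
  have "(\<Sum>\<alpha>\<in>UNIV. \<Sum>\<beta>\<in>UNIV. x $ \<alpha> * of_int (C $ \<alpha> $ \<beta>) * x $ \<beta>) =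
      (\<Sum>\<alpha>\<in>UNIV. x $ \<alpha> * (?A *v x) $ \<alpha>)"
    by (simp add: matrix_vector_mult_def sum_distrib_left mult.assoc)
  then show False using C_posdef_real[OF x(2)] x(1) by simp
qed

text \<open>By Cramer's rule the entries of \<open>det C\<close> times the inverse matrix are
  determinants of integer matrices, so the floor in \<open>lam\<close> loses nothing.\<close>

lemma lam_rat:
  "rat_of_int (lam C \<alpha> \<beta>) =
     rat_of_int (det C) * matrix_inv (\<chi> i j. rat_of_int (C $ i $ j)) $ \<alpha> $ \<beta>"
  and matrix_inv_C:
    "(\<chi> i j. rat_of_int (C $ i $ j)) ** matrix_inv (\<chi> i j. rat_of_int (C $ i $ j)) = mat 1"
proof -
  let ?A = "\<chi> i j. rat_of_int (C $ i $ j)"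
  have det: "det ?A = rat_of_int (det C)" by (rule det_of_int)
  then have "invertible ?A" using det_nonzero by (simp add: invertible_det_nz)
  then show inv: "?A ** matrix_inv ?A = mat 1"
    unfolding invertible_def matrix_inv_def by (metis (mono_tags, lifting) someI_ex)
  define x where "x = matrix_inv ?A *v axis \<beta> 1"
  have xa: "x $ \<alpha> = matrix_inv ?A $ \<alpha> $ \<beta>"
    by (simp add: x_def matrix_vector_mult_def)
  have "?A *v x = axis \<beta> 1"
    by (simp add: x_def matrix_vector_mul_assoc inv)
  then have "x $ \<alpha> * det ?A = det (\<chi> i j. if j = \<alpha> then axis \<beta> 1 $ i else ?A $ i $ j)"
    using cramer_lemma[of \<alpha> ?A x, symmetric] by (simp only:)
  also have "(\<chi> i j. if j = \<alpha> then axis \<beta> 1 $ i else ?A $ i $ j) =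
      (\<chi> i j. rat_of_int ((\<chi> i j. if j = \<alpha> then axis \<beta> 1 $ i else C $ i $ j) $ i $ j))"
    by (simp add: vec_eq_iff axis_def)
  also have "det \<dots> = rat_of_int (det (\<chi> i j. if j = \<alpha> then axis \<beta> 1 $ i else C $ i $ j))"
    by (rule det_of_int)
  finally have "rat_of_int (det C) * matrix_inv ?A $ \<alpha> $ \<beta> =
      rat_of_int (det (\<chi> i j. if j = \<alpha> then axis \<beta> 1 $ i else C $ i $ j))"
    by (simp add: xa det mult.commute)
  then show "rat_of_int (lam C \<alpha> \<beta>) = rat_of_int (det C) * matrix_inv ?A $ \<alpha> $ \<beta>"
    by (simp add: lam_def)
qed

lemma C_lam: "(\<Sum>\<beta>\<in>UNIV. C $ \<alpha> $ \<beta> * lam C \<beta> \<gamma>) = (if \<alpha> = \<gamma> then det C else 0)"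
proof -
  let ?A = "\<chi> i j. rat_of_int (C $ i $ j)"
  have "rat_of_int (\<Sum>\<beta>\<in>UNIV. C $ \<alpha> $ \<beta> * lam C \<beta> \<gamma>) =
      rat_of_int (det C) * (?A ** matrix_inv ?A) $ \<alpha> $ \<gamma>"
    by (simp add: lam_rat matrix_matrix_mult_def sum_distrib_left algebra_simps)
  also have "\<dots> = rat_of_int (if \<alpha> = \<gamma> then det C else 0)"
    unfolding matrix_inv_C by (simp add: mat_def)
  finally show ?thesis by linarith
qed

text \<open>Writing L for the matrix \<open>lam\<close>, both sides times \<open>det C\<close> are
  the same entry of the product (transpose of L) C L, evaluated with \<open>C_lam\<close> on either
  side.\<close>

lemma lam_sym: "lam C i j = lam C j i"
proof -
  have "det C * lam C i j = (\<Sum>k\<in>UNIV. (if k = i then det C else 0) * lam C k j)"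
    by (simp add: if_distrib[of "\<lambda>x. x * _"] cong: if_cong)
  also have "\<dots> = (\<Sum>k\<in>UNIV. (\<Sum>m\<in>UNIV. C $ k $ m * lam C m i) * lam C k j)"
    by (simp add: C_lam)
  also have "\<dots> = (\<Sum>k\<in>UNIV. \<Sum>m\<in>UNIV. lam C m i * (C $ m $ k * lam C k j))"
    unfolding sum_distrib_right by (intro sum.cong refl, subst C_sym) simp
  also have "\<dots> = (\<Sum>m\<in>UNIV. \<Sum>k\<in>UNIV. lam C m i * (C $ m $ k * lam C k j))"
    by (rule sum.swap)
  also have "\<dots> = (\<Sum>m\<in>UNIV. lam C m i * (if m = j then det C else 0))"
    by (simp add: sum_distrib_left[symmetric] C_lam)
  also have "\<dots> = det C * lam C j i" by (simp add: if_distrib cong: if_cong)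
  finally show ?thesis using det_nonzero by simp
qed

section \<open>The bilinear form of \<open>lam\<close> and the height\<close>

definition ll :: "'n intvec \<Rightarrow> 'n intvec \<Rightarrow> int" where
  "ll a b = (\<Sum>i\<in>UNIV. \<Sum>j\<in>UNIV. a $ i * lam C i j * b $ j)"

lemma ll_add_left: "ll (a + b) c = ll a c + ll b c"
  and ll_add_right: "ll a (b + c) = ll a b + ll a c"
  by (simp_all add: ll_def algebra_simps sum.distrib)

lemma ll_diff_left: "ll (a - b) c = ll a c - ll b c"
  and ll_diff_right: "ll a (b - c) = ll a b - ll a c"
  by (simp_all add: ll_def algebra_simps sum_subtractf)

lemma ll_minus_left: "ll (- a) c = - ll a c"
  and ll_minus_right: "ll a (- c) = - ll a c"
  by (simp_all add: ll_def sum_negf)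

lemma ll_zero [simp]: "ll 0 b = 0" "ll a 0 = 0"
  by (simp_all add: ll_def)

lemma ll_sym: "ll a b = ll b a"
  unfolding ll_def by (subst sum.swap) (simp add: lam_sym[of _ "_ :: 'n"] algebra_simps)

lemma ll_axis: "ll (axis i 1) (axis j 1) = lam C i j"
  by (simp add: ll_def mult.assoc sum_distrib_left[symmetric])

lemma ll_axis_right: "ll a (axis j 1) = (\<Sum>i\<in>UNIV. a $ i * lam C i j)"
  by (simp add: ll_def mult.assoc sum_distrib_left[symmetric])

lemma ll_axis_left: "ll (axis i 1) b = (\<Sum>j\<in>UNIV. lam C i j * b $ j)"
  by (simp add: ll_def mult.assoc sum_distrib_left[symmetric])

lemma ll_row: "ll (C $ i) b = det C * b $ i"
proof -
  have "ll (C $ i) b = (\<Sum>k\<in>UNIV. (\<Sum>j\<in>UNIV. C $ i $ j * lam C j k) * b $ k)"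
    unfolding ll_def by (subst sum.swap) (simp add: sum_distrib_right)
  also have "\<dots> = det C * b $ i" by (simp add: C_lam if_distrib[of "\<lambda>x. x * _"] cong: if_cong)
  finally show ?thesis .
qed

text \<open>Pairing with the rows of \<open>C\<close> recovers the coordinates up to the factor
  \<open>det C\<close>. This later provides a variable \<open>Q \<alpha> 0\<close> that tells two
  given degrees apart.\<close>

lemma ll_nondegenerate: "(\<And>i. ll (axis i 1) b = ll (axis i 1) c) \<Longrightarrow> b = c"
proof -
  assume *: "\<And>i. ll (axis i 1) b = ll (axis i 1) c"
  have eq: "ll a b = (\<Sum>i\<in>UNIV. a $ i * ll (axis i 1) b)" for a b
    unfolding ll_axis_left by (simp add: ll_def sum_distrib_left mult.assoc)
  have "ll a b = ll a c" for a unfolding eq[of a b] eq[of a c] * ..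
  then have "det C * b $ i = det C * c $ i" for i by (metis ll_row)
  then show ?thesis using det_nonzero by (simp add: vec_eq_iff)
qed

text \<open>The height, up to a positive factor: it takes the same positive value on all simple roots.  With
  the sign, the positivity of \<open>det C\<close> is not needed.\<close>

definition ht :: "'n intvec \<Rightarrow> int" where
  "ht v = sgn (det C) * ll 1 v"

lemma ht_add: "ht (a + b) = ht a + ht b"
  and ht_diff: "ht (a - b) = ht a - ht b"
  and ht_minus: "ht (- a) = - ht a"
  and ht_zero [simp]: "ht 0 = 0"
  by (simp_all add: ht_def ll_add_right ll_diff_right ll_minus_right algebra_simps)

lemma ht_row: "ht (C $ i) = \<bar>det C\<bar>"
proof -
  have "ll 1 (C $ i) = det C"
    using ll_row[of i 1] by (simp add: ll_sym)
  then show ?thesis by (simp add: ht_def abs_sgn mult.commute)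
qed

lemma ht_expand: "ht v = (\<Sum>j\<in>UNIV. ht (axis j 1) * v $ j)"
proof -
  have "ll 1 v = (\<Sum>j\<in>UNIV. ll 1 (axis j 1) * v $ j)"
    unfolding ll_axis_right unfolding ll_def
    by (subst sum.swap) (simp add: sum_distrib_right)
  then show ?thesis by (simp add: ht_def sum_distrib_left mult.assoc)
qed

lemma row_ht: "(\<Sum>j\<in>UNIV. C $ i $ j * ht (axis j 1)) = \<bar>det C\<bar>"
  using ht_expand[of "C $ i"] ht_row[of i] by (simp add: mult.commute)

text \<open>A maximum principle for \<open>C\<close>: by \<open>row_ht\<close> these heights solve a
  linear system with a positive constant right-hand side. Pairing it with the negative part
  \<open>x\<close> of the solution gives \<open>qf x \<le> 0\<close>, because the off-diagonal
  entries of \<open>C\<close> are nonpositive; positive definiteness forces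
  \<open>x = 0\<close>.\<close>

lemma ht_axis_nonneg: "0 \<le> ht (axis j 1)"
proof -
  define c x where "c i = ht (axis i 1)" and "x = (\<chi> i. max 0 (- c i))" for i
  have "0 \<le> (\<Sum>i\<in>UNIV. x $ i * \<bar>det C\<bar>)" by (intro sum_nonneg) (simp add: x_def)
  also have "\<dots> = (\<Sum>i\<in>UNIV. \<Sum>j\<in>UNIV. x $ i * C $ i $ j * c j)"
    by (simp add: row_ht c_def sum_distrib_left[symmetric] mult.assoc)
  also have "\<dots> \<le> (\<Sum>i\<in>UNIV. \<Sum>j\<in>UNIV. - (x $ i * C $ i $ j * x $ j))"
  proof (intro sum_mono)
    fix i j
    have "x $ i * C $ i $ j * (c j + x $ j) \<le> 0"
    proof (cases "i = j")
      case True
      then show ?thesis by (simp add: x_def max_def)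
    next
      case False
      have "x $ i * (c j + x $ j) \<ge> 0" by (simp add: x_def max_def)
      then have "C $ i $ j * (x $ i * (c j + x $ j)) \<le> 0"
        using C_off[OF False] by (rule mult_nonpos_nonneg[rotated])
      then show ?thesis by (simp add: algebra_simps)
    qed
    then show "x $ i * C $ i $ j * c j \<le> - (x $ i * C $ i $ j * x $ j)"
      by (simp add: algebra_simps)
  qed
  also have "\<dots> = - qf x" by (simp add: qf_def sum_negf)
  finally have "x = 0" using qf_pos[of x] by fastforce
  then have "max 0 (- c j) = 0" by (metis x_def vec_lambda_beta zero_index)
  then show ?thesis by (simp add: c_def max_def split: if_splits)
qed

text \<open>If the height at \<open>j\<close> vanished, equation \<open>j\<close> of the system
  \<open>row_ht\<close> would have a nonpositive left-hand side.\<close>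

lemma ht_axis_pos: "0 < ht (axis j 1)"
proof (rule ccontr)
  assume "\<not> ?thesis"
  then have "ht (axis j 1) = 0" using ht_axis_nonneg[of j] by simp
  then have "C $ j $ k * ht (axis k 1) \<le> 0" for k
    using C_off[of j k] ht_axis_nonneg[of k] by (cases "k = j") (auto intro: mult_nonpos_nonneg)
  then have "\<bar>det C\<bar> \<le> 0" unfolding row_ht[of j, symmetric] by (intro sum_nonpos)
  then show False using det_nonzero by simp
qed

lemma ht_nonneg: "(\<And>j. 0 \<le> v $ j) \<Longrightarrow> 0 \<le> ht v"
  unfolding ht_expand[of v] by (intro sum_nonneg mult_nonneg_nonneg ht_axis_nonneg)

lemma ht_ge_component: "(\<And>j. 0 \<le> v $ j) \<Longrightarrow> v $ j \<le> ht v"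
proof -
  assume v: "\<And>j. 0 \<le> v $ j"
  have "v $ j \<le> ht (axis j 1) * v $ j"
    using ht_axis_pos[of j] v[of j] by (simp add: mult_le_cancel_right1)
  also have "\<dots> \<le> ht v" unfolding ht_expand[of v]
    by (rule member_le_sum) (auto intro: mult_nonneg_nonneg ht_axis_nonneg v)
  finally show ?thesis .
qed

text \<open>Row \<open>i\<close> of the adjacency matrix of the Dynkin diagram, which is also the
  exponent vector of the product in the recursion.\<close>

definition nb :: "'n \<Rightarrow> 'n intvec" where
  "nb i = axis i 2 - C $ i"

lemma nb_nth: "nb i $ j = (if j = i then 0 else - C $ i $ j)"
  by (auto simp: nb_def axis_def C_diag)

lemma nb_nonneg: "0 \<le> nb i $ j"
  using C_off[of i j] by (auto simp: nb_nth)

lemma nb_sym: "nb i $ j = nb j $ i"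
  using C_sym[of i j] by (auto simp: nb_nth)

subsection \<open>Graded multiplicities of a product of Kirillov--Reshetikhin modules\<close>

definition of_label :: "('n \<Rightarrow> nat) \<Rightarrow> 'n intvec" where
  "of_label k = (\<chi> i. int (k i))"

lemma of_label_nth [simp]: "of_label k $ i = int (k i)"
  by (simp add: of_label_def)

lemma of_label_inject: "of_label k = of_label l \<longleftrightarrow> k = l"
  by (auto simp: vec_eq_iff)

lemma finite_ht_le: "finite {p. ht (of_label p) \<le> N}"
proof (rule finite_subset)
  show "{p. ht (of_label p) \<le> N} \<subseteq> PiE UNIV (\<lambda>_. {..nat N})"
  proof safe
    fix p i assume "ht (of_label p) \<le> N"
    moreover have "int (p i) \<le> ht (of_label p)" using ht_ge_component[of "of_label p" i] by simp
    ultimately show "p i \<le> nat N" by linarith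
  qed simp
  show "finite (PiE (UNIV :: 'n set) (\<lambda>_. {..nat N}))"
    by (intro finite_PiE) auto
qed

lemma Avec_unit_n: "k i \<le> K \<Longrightarrow> Avec K (unit_n k) i K = int (k i)"
proof -
  assume k: "k i \<le> K"
  have "Avec K (unit_n k) i K = (\<Sum>j\<in>{1..K}. if j = k i then int (k i) else 0)"
    unfolding Avec_def by (intro sum.cong) (auto simp: unit_n_def)
  then show ?thesis using k by (cases "k i = 0") auto
qed

text \<open>At the last index \<open>K\<close> the entry \<open>min K j\<close> is just
  \<open>j\<close>, so the constraint on the label sees \<open>m\<close> only through this
  vector.\<close>

definition weighted_sum :: "nat \<Rightarrow> ('n \<Rightarrow> nat \<Rightarrow> nat) \<Rightarrow> 'n intvec" where
  "weighted_sum K m = (\<chi> \<beta>. \<Sum>j\<in>{1..K}. int j * int (m \<beta> j))"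

lemma weighted_sum_nonneg: "0 \<le> weighted_sum K m $ j"
  by (simp add: weighted_sum_def sum_nonneg)

lemma Mindex_label:
  assumes m: "m \<in> Mindex C K l (unit_n k)" and K: "\<And>i. k i \<le> K"
  shows "int (l i) = int (k i) - (\<Sum>j\<in>UNIV. C $ i $ j * weighted_sum K m $ j)"
proof -
  have "Avec K m j K = weighted_sum K m $ j" for j
    unfolding Avec_def weighted_sum_def by (auto intro!: sum.cong)
  then show ?thesis
    using m Avec_unit_n[of k i K, OF K] by (simp add: Mindex_def pvec_def)
qed

lemma weighted_sum_zero:
  assumes "weighted_sum K m = 0" "j \<in> {1..K}"
  shows "m \<beta> j = 0"
proof -
  have "(\<Sum>j\<in>{1..K}. int j * int (m \<beta> j)) = 0"
    using assms(1) by (metis weighted_sum_def vec_lambda_beta zero_index)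
  then have "\<forall>j\<in>{1..K}. int j * int (m \<beta> j) = 0"
    by (subst (asm) sum_nonneg_eq_0_iff) auto
  then show ?thesis using assms(2) by auto
qed

lemma Minf_eqI: "eventually (\<lambda>K. MK C K l n = c) sequentially \<Longrightarrow> Minf C l n = c"
  unfolding Minf_def
proof (rule the_equality)
  fix d assume "eventually (\<lambda>K. MK C K l n = c) sequentially" "eventually (\<lambda>K. MK C K l n = d) sequentially"
  then have "eventually (\<lambda>K :: nat. d = c) sequentially"
    by (rule eventually_elim2) simp
  then show "d = c" by simp
qed

lemma eventually_ge_labels: "eventually (\<lambda>K. \<forall>i. (k :: 'n \<Rightarrow> nat) i \<le> K) sequentially"
  by (intro eventually_all_finite eventually_ge_at_top)

text \<open>For equal labels the constraint says that \<open>C\<close> annihilates the weighted sum,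
  which is then zero; only \<open>m = 0\<close> contributes, for every \<open>K\<close> that bounds
  the entries of \<open>k\<close>.\<close>

lemma Minf_diagonal: "Minf C k (unit_n k) = 1"
proof (rule Minf_eqI, rule eventually_mono[OF eventually_ge_labels[of k]])
  fix K assume K: "\<forall>\<alpha>. k \<alpha> \<le> K"
  let ?z = "\<lambda>(_ :: 'n) (_ :: nat). 0 :: nat"
  have pz: "pvec C K (unit_n k) ?z \<alpha> i = Avec K (unit_n k) \<alpha> i" for \<alpha> i
    by (simp add: pvec_def Avec_def)
  have Anonneg: "0 \<le> Avec K (unit_n k) \<alpha> i" for \<alpha> i
    by (simp add: Avec_def sum_nonneg)
  have "Mindex C K k (unit_n k) = {?z}"
  proof safe
    fix m \<alpha> j assume m: "m \<in> Mindex C K k (unit_n k)"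
    let ?s = "weighted_sum K m"
    have "(\<Sum>\<beta>\<in>UNIV. C $ \<alpha> $ \<beta> * ?s $ \<beta>) = 0" for \<alpha>
      using Mindex_label[OF m, of \<alpha>] K by simp
    then have "qf ?s = 0"
      by (simp add: qf_def mult.assoc sum_distrib_left[symmetric])
    then have "?s = 0" using qf_pos[of ?s] by fastforce
    then show "m = ?z" using weighted_sum_zero[of K m] m
      by (auto simp: fun_eq_iff Mindex_def)
  next
    show "?z \<in> Mindex C K k (unit_n k)"
      using K by (simp add: Mindex_def pz Anonneg Avec_unit_n)
  qed
  moreover have "qbinom (det C) 0 (Avec K (unit_n k) \<alpha> i) = 1" for \<alpha> i
    using Anonneg by (simp add: qbinom_def fps_prod_nth_zero)
  ultimately show "MK C K k (unit_n k) = 1"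
    by (simp add: MK_def Qform_def pz qpow_def)
qed

text \<open>The constraint reads \<open>l = k - C s\<close> with a nonnegative weighted sum
  \<open>s\<close>, and each subtracted row of \<open>C\<close> lowers the height by
  \<open>\<bar>det C\<bar>\<close>.\<close>

lemma Minf_nonzero:
  assumes "Minf C l (unit_n k) \<noteq> 0"
  shows "l = k \<or> ht (of_label l) < ht (of_label k)"
proof (rule ccontr)
  assume neg: "\<not> ?thesis"
  have "Minf C l (unit_n k) = 0"
  proof (rule Minf_eqI, rule eventually_mono[OF eventually_ge_labels[of k]])
    fix K assume K: "\<forall>i. k i \<le> K"
    have False if m: "m \<in> Mindex C K l (unit_n k)" for m
    proof -
      let ?s = "weighted_sum K m"
      note lab = Mindex_label[OF m K[rule_format]]
      have "ht (of_label l) = ht (of_label k) -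
          (\<Sum>i\<in>UNIV. ht (axis i 1) * (\<Sum>j\<in>UNIV. C $ i $ j * ?s $ j))"
        unfolding ht_expand[of "of_label l"] ht_expand[of "of_label k"]
        by (simp add: lab right_diff_distrib sum_subtractf)
      also have "(\<Sum>i\<in>UNIV. ht (axis i 1) * (\<Sum>j\<in>UNIV. C $ i $ j * ?s $ j)) =
          (\<Sum>j\<in>UNIV. (\<Sum>i\<in>UNIV. C $ j $ i * ht (axis i 1)) * ?s $ j)"
        by (simp add: sum_distrib_left sum_distrib_right, subst sum.swap)
          (simp add: C_sym[of _ "_ :: 'n"] algebra_simps)
      also have "\<dots> = \<bar>det C\<bar> * (\<Sum>j\<in>UNIV. ?s $ j)"
        by (simp add: row_ht sum_distrib_left)
      finally have "\<bar>det C\<bar> * (\<Sum>j\<in>UNIV. ?s $ j) \<le> 0" using neg by simp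
      then have "(\<Sum>j\<in>UNIV. ?s $ j) \<le> 0" using det_nonzero by (simp add: mult_le_0_iff)
      moreover have "0 \<le> (\<Sum>j\<in>UNIV. ?s $ j)" by (simp add: sum_nonneg weighted_sum_nonneg)
      ultimately have "(\<Sum>j\<in>UNIV. ?s $ j) = 0" by simp
      then have "?s $ j = 0" for j
        using sum_nonneg_eq_0_iff[of UNIV "\<lambda>j. ?s $ j"] weighted_sum_nonneg by auto
      then have "l = k" using lab by (simp add: fun_eq_iff)
      then show False using neg by simp
    qed
    then have "Mindex C K l (unit_n k) = {}" by blast
    then show "MK C K l (unit_n k) = 0" by (simp add: MK_def)
  qed
  then show False using assms by simp
qed

subsection \<open>Chebyshev polynomials of the adjacency matrix\<close>

definition adj :: "'n intvec \<Rightarrow> 'n intvec" where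
  "adj v = (\<chi> j. \<Sum>k\<in>UNIV. v $ k * nb k $ j)"

lemma adj_nth: "adj v $ j = (\<Sum>k\<in>UNIV. v $ k * nb k $ j)"
  by (simp add: adj_def)

lemma adj_nonneg: "(\<And>j. 0 \<le> v $ j) \<Longrightarrow> 0 \<le> adj v $ j"
  by (simp add: adj_nth sum_nonneg nb_nonneg)

lemma adj_add: "adj (v + w) = adj v + adj w"
  and adj_diff: "adj (v - w) = adj v - adj w"
  by (simp_all add: vec_eq_iff adj_nth algebra_simps sum.distrib sum_subtractf)

lemma adj_zero [simp]: "adj 0 = 0"
  by (simp add: vec_eq_iff adj_nth)

lemma adj_axis: "adj (axis i 1) = nb i"
  by (simp add: vec_eq_iff adj_nth)

lemma ht_nb: "ht (nb i) = 2 * ht (axis i 1) - \<bar>det C\<bar>"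
proof -
  have "axis i 2 = axis i 1 + (axis i 1 :: 'n intvec)" by (simp add: vec_eq_iff axis_def)
  then show ?thesis unfolding nb_def ht_diff ht_row by (simp only: ht_add)
qed

text \<open>Twice the identity minus the adjacency matrix is \<open>C\<close>, whose rows all have
  height \<open>\<bar>det C\<bar>\<close>. Both the concavity of the heights of \<open>cheb\<close>
  and the comparison of terms in \<open>LF_low\<close> rest on this.\<close>

lemma ht_adj: "ht (adj v) = 2 * ht v - \<bar>det C\<bar> * (\<Sum>k\<in>UNIV. v $ k)"
proof -
  have "ht (adj v) = (\<Sum>k\<in>UNIV. v $ k * ht (nb k))"
    unfolding ht_expand[of "adj v"] ht_expand[of "nb _"] adj_nth
    by (simp add: sum_distrib_left, subst sum.swap) (simp add: algebra_simps)
  also have "\<dots> = 2 * ht v - \<bar>det C\<bar> * (\<Sum>k\<in>UNIV. v $ k)"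
    unfolding ht_nb ht_expand[of v]
    by (simp add: algebra_simps sum_subtractf sum_distrib_left)
  finally show ?thesis .
qed

definition dot :: "'n intvec \<Rightarrow> 'n intvec \<Rightarrow> int" where
  "dot v w = (\<Sum>j\<in>UNIV. v $ j * w $ j)"

lemma dot_add_left: "dot (u + v) w = dot u w + dot v w"
  and dot_add_right: "dot u (v + w) = dot u v + dot u w"
  and dot_diff_left: "dot (u - v) w = dot u w - dot v w"
  and dot_diff_right: "dot u (v - w) = dot u v - dot u w"
  by (simp_all add: dot_def algebra_simps sum.distrib sum_subtractf)

lemma dot_commute: "dot v w = dot w v"
  by (simp add: dot_def mult.commute)

lemma dot_zero [simp]: "dot 0 v = 0" "dot v 0 = 0"
  by (simp_all add: dot_def)

lemma dot_nonneg: "(\<And>j. 0 \<le> v $ j) \<Longrightarrow> (\<And>j. 0 \<le> w $ j) \<Longrightarrow> 0 \<le> dot v w"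
  by (simp add: dot_def sum_nonneg)

lemma dot_adj: "dot v (adj w) = dot (adj v) w"
proof -
  have "dot v (adj w) = (\<Sum>j\<in>UNIV. \<Sum>k\<in>UNIV. v $ j * (w $ k * nb k $ j))"
    by (simp add: dot_def adj_nth sum_distrib_left)
  also have "\<dots> = (\<Sum>k\<in>UNIV. \<Sum>j\<in>UNIV. v $ j * (w $ k * nb j $ k))"
    by (subst sum.swap) (simp add: nb_sym[of _ "_ :: 'n"] cong: sum.cong)
  also have "\<dots> = dot (adj v) w"
    by (simp add: dot_def adj_nth sum_distrib_left sum_distrib_right algebra_simps)
  finally show ?thesis .
qed

lemma qf_adj: "qf v = 2 * dot v v - dot v (adj v)"
proof -
  have "qf v = (\<Sum>i\<in>UNIV. \<Sum>j\<in>UNIV. v $ i * (axis i 2 $ j - nb i $ j) * v $ j)"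
    by (simp add: qf_def nb_def)
  also have "\<dots> = (\<Sum>i\<in>UNIV. \<Sum>j\<in>UNIV. (if j = i then v $ i * 2 * v $ i else 0) - v $ i * nb i $ j * v $ j)"
    by (intro sum.cong) (auto simp: axis_def algebra_simps)
  also have "\<dots> = 2 * dot v v - (\<Sum>i\<in>UNIV. \<Sum>j\<in>UNIV. v $ i * nb i $ j * v $ j)"
    by (simp add: sum_subtractf dot_def sum_distrib_left algebra_simps)
  also have "(\<Sum>i\<in>UNIV. \<Sum>j\<in>UNIV. v $ i * nb i $ j * v $ j) = dot v (adj v)"
    by (subst sum.swap) (simp add: dot_def adj_nth sum_distrib_left algebra_simps)
  finally show ?thesis .
qed

text \<open>The Tits form of the bipartite double cover of the Dynkin diagram.  Working in the double cover
  avoids using that the diagram itself is bipartite.\<close>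

definition tits :: "'n intvec \<Rightarrow> 'n intvec \<Rightarrow> int" where
  "tits v w = dot v v + dot w w - dot v (adj w)"

text \<open>In terms of the sum \<open>s\<close> and the difference \<open>d\<close> the form
  splits: four times it is \<open>qf s\<close> plus \<open>2 * dot d d + dot d (adj d)\<close>.
  Passing from \<open>d\<close> to its absolute values \<open>a\<close> bounds the second part below
  by \<open>qf a\<close>, so positive definiteness of \<open>C\<close> covers both parts.\<close>

lemma tits_pos:
  assumes "v \<noteq> 0 \<or> w \<noteq> 0"
  shows "0 < tits v w"
proof -
  define s d where "s = v + w" and "d = v - w"
  define a where "a = (\<chi> j. \<bar>d $ j\<bar>)"
  have "4 * tits v w = 2 * dot s s + 2 * dot d d - dot s (adj s) + dot d (adj d)"
    by (simp add: tits_def s_def d_def adj_add adj_diff dot_add_left dot_add_right dot_diff_left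
        dot_diff_right dot_commute[of w v] dot_adj[of w v] dot_commute[of "adj w" v])
  also have "\<dots> = qf s + 2 * dot d d + dot d (adj d)" by (simp add: qf_adj)
  also have "dot d d = dot a a" by (simp add: dot_def a_def abs_mult_self_eq)
  finally have 1: "4 * tits v w = qf s + 2 * dot a a + dot d (adj d)" .
  have "\<bar>adj d $ j\<bar> \<le> adj a $ j" for j
    unfolding adj_nth a_def by (rule order_trans[OF sum_abs]) (simp add: abs_mult nb_nonneg)
  then have "- (a $ j * adj a $ j) \<le> d $ j * adj d $ j" for j
  proof -
    have "\<bar>d $ j * adj d $ j\<bar> \<le> a $ j * adj a $ j"
      unfolding abs_mult using \<open>\<bar>adj d $ j\<bar> \<le> adj a $ j\<close> by (simp add: a_def mult_left_mono)
    then show ?thesis by linarith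
  qed
  then have "- dot a (adj a) \<le> dot d (adj d)"
    unfolding dot_def sum_negf[symmetric] by (intro sum_mono)
  then have 2: "qf s + qf a \<le> 4 * tits v w" using 1 by (simp add: qf_adj)
  have "s \<noteq> 0 \<or> a \<noteq> 0"
  proof (rule ccontr)
    assume "\<not> ?thesis"
    then have "v $ j + w $ j = 0 \<and> v $ j - w $ j = 0" for j
      by (auto simp: s_def d_def a_def vec_eq_iff)
    then have "v $ j = 0 \<and> w $ j = 0" for j by (smt (verit))
    then show False using assms by (simp add: vec_eq_iff)
  qed
  then have "0 < qf s + qf a" using qf_pos[of s] qf_pos[of a] qf_nonneg[of s] qf_nonneg[of a] by linarith
  then show ?thesis using 2 by linarith
qed

text \<open>Vectors of value 1 are roots of the double cover, and roots have a sign: otherwise the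
  positive and the negative part are both nonzero, each has value at least 1, and the cross terms
  only add to the total.\<close>

lemma tits_sign_coherent:
  assumes "tits v w = 1"
  shows "(\<forall>j. 0 \<le> v $ j \<and> 0 \<le> w $ j) \<or> (\<forall>j. v $ j \<le> 0 \<and> w $ j \<le> 0)"
proof (rule ccontr)
  assume neg: "\<not> ?thesis"
  define vp vm wp wm where "vp = (\<chi> j. max 0 (v $ j))" and "vm = (\<chi> j. max 0 (- v $ j))"
    and "wp = (\<chi> j. max 0 (w $ j))" and "wm = (\<chi> j. max 0 (- w $ j))"
  note defs = vp_def vm_def wp_def wm_def
  have v: "v = vp - vm" and w: "w = wp - wm" by (auto simp: vec_eq_iff defs max_def)
  have orth: "dot vp vm = 0" "dot wp wm = 0" by (auto simp: dot_def defs max_def intro!: sum.neutral)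
  have nn: "0 \<le> vp $ j" "0 \<le> vm $ j" "0 \<le> wp $ j" "0 \<le> wm $ j" for j by (auto simp: defs)
  have "tits v w = tits vp wp + tits vm wm + dot vp (adj wm) + dot vm (adj wp)"
    by (simp add: tits_def v w adj_diff dot_diff_left dot_diff_right orth dot_commute[of vm vp]
        dot_commute[of wm wp])
  moreover have "0 \<le> dot vp (adj wm)" "0 \<le> dot vm (adj wp)"
    by (intro dot_nonneg nn adj_nonneg)+
  moreover have max0: "max 0 (a :: int) = 0 \<longleftrightarrow> a \<le> 0" for a by (simp add: max_def)
  have "vp \<noteq> 0 \<or> wp \<noteq> 0" "vm \<noteq> 0 \<or> wm \<noteq> 0"
    using neg unfolding vec_eq_iff defs vec_lambda_beta zero_index max0 by auto
  then have "1 \<le> tits vp wp" "1 \<le> tits vm wm" using tits_pos[of vp wp] tits_pos[of vm wm] by linarith+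
  ultimately show False using assms by linarith
qed

text \<open>Chebyshev polynomials of the second kind, evaluated at half the adjacency matrix and
  applied to a unit vector. The index is shifted by one: \<open>cheb i n\<close> belongs to the
  polynomial of degree n - 1.\<close>

fun cheb :: "'n \<Rightarrow> nat \<Rightarrow> 'n intvec" where
  "cheb i 0 = 0"
| "cheb i (Suc 0) = axis i 1"
| "cheb i (Suc (Suc n)) = adj (cheb i (Suc n)) - cheb i n"

text \<open>One step of the recurrence is a reflection of the older vector followed by an exchange
  of the two arguments; both preserve the form.\<close>

lemma tits_cheb: "tits (cheb i n) (cheb i (Suc n)) = 1"
proof (induction n)
  case 0
  show ?case by (simp add: tits_def dot_def)
next
  case (Suc n)
  let ?u = "cheb i n" and ?v = "cheb i (Suc n)"
  have "tits ?v (adj ?v - ?u) = tits ?u ?v"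
    unfolding tits_def dot_adj[of ?v "adj ?v - ?u"] dot_diff_left dot_diff_right by simp
  then show ?case using Suc by simp
qed

text \<open>The adjacency matrix commutes with every polynomial in itself.\<close>

lemma adj_cheb: "adj (cheb i n) = (\<chi> m. \<Sum>j\<in>UNIV. nb i $ j * cheb j n $ m)"
proof (induction i n rule: cheb.induct)
  case (1 i)
  show ?case by (simp add: vec_eq_iff)
next
  case (2 i)
  have "(\<Sum>j\<in>UNIV. nb i $ j * axis j 1 $ m) = nb i $ m" for m
  proof -
    have "(\<Sum>j\<in>UNIV. nb i $ j * axis j 1 $ m) = (\<Sum>j\<in>UNIV. nb i $ j * axis m 1 $ j)"
      by (intro sum.cong) (auto simp: axis_def)
    then show ?thesis by simp
  qed
  then show ?case by (simp add: vec_eq_iff adj_axis)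
next
  case (3 i n)
  have "adj (cheb i (Suc (Suc n))) = adj (adj (cheb i (Suc n))) - adj (cheb i n)"
    by (simp add: adj_diff)
  also have "adj (adj (cheb i (Suc n))) = (\<chi> m. \<Sum>j\<in>UNIV. nb i $ j * adj (cheb j (Suc n)) $ m)"
  proof -
    have "(\<Sum>k\<in>UNIV. (\<Sum>j\<in>UNIV. nb i $ j * cheb j (Suc n) $ k) * nb k $ m) =
        (\<Sum>j\<in>UNIV. nb i $ j * (\<Sum>k\<in>UNIV. cheb j (Suc n) $ k * nb k $ m))" for m
      unfolding sum_distrib_left sum_distrib_right by (subst sum.swap) (simp add: mult.assoc)
    then show ?thesis unfolding 3(1) by (simp add: vec_eq_iff adj_nth)
  qed
  finally show ?case
    unfolding 3(2) by (simp add: vec_eq_iff right_diff_distrib sum_subtractf)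
qed

text \<open>A polynomial in a symmetric matrix is symmetric.\<close>

lemma cheb_sym: "cheb i n $ j = cheb j n $ i"
proof (induction i n arbitrary: j rule: cheb.induct)
  case (2 i)
  show ?case by (simp add: axis_def)
next
  case (3 i n)
  have "adj (cheb i (Suc n)) $ j = (\<Sum>k\<in>UNIV. cheb k (Suc n) $ i * nb k $ j)"
    by (simp add: adj_nth 3(1))
  also have "\<dots> = adj (cheb j (Suc n)) $ i"
    unfolding adj_cheb[of j] by (simp add: nb_sym[of _ j] mult.commute)
  finally show ?case by (simp add: 3(2))
qed simp

definition cheb_pos :: "'n \<Rightarrow> nat \<Rightarrow> bool" where
  "cheb_pos i n \<longleftrightarrow> cheb i n \<noteq> 0 \<and> (\<forall>j. 0 \<le> cheb i n $ j)"

lemma cheb_pos_1: "cheb_pos i (Suc 0)"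
  by (auto simp: cheb_pos_def axis_def vec_eq_iff)

text \<open>Consecutive vectors form a root of the double cover, so the second inherits the sign of
  the first.\<close>

lemma cheb_pos_step: "cheb_pos i n \<Longrightarrow> cheb i (Suc n) = 0 \<or> cheb_pos i (Suc n)"
proof -
  assume n: "cheb_pos i n"
  have "\<not> (\<forall>j. cheb i n $ j \<le> 0)" using n by (force simp: cheb_pos_def vec_eq_iff intro: antisym)
  then show ?thesis using tits_sign_coherent[OF tits_cheb[of i n]] by (auto simp: cheb_pos_def)
qed

text \<open>While the vectors \<open>cheb i n\<close> are positive, their heights form a strictly concave sequence of
  positive integers.\<close>

lemma cheb_zero_exists: "\<exists>n\<ge>1. cheb i n = 0"
proof (rule ccontr)
  assume "\<not> ?thesis"
  then have ne: "cheb i n \<noteq> 0" if "n \<ge> 1" for n using that by blast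
  have pos: "cheb_pos i (Suc n)" for n
    by (induction n) (use cheb_pos_1 cheb_pos_step ne in fastforce)+
  define d where "d n = ht (cheb i (Suc n)) - ht (cheb i n)" for n
  have "d (Suc n) \<le> d n - 1" for n
  proof -
    let ?v = "cheb i (Suc n)"
    have "0 < (\<Sum>l\<in>UNIV. ?v $ l)"
    proof -
      obtain j where "?v $ j \<noteq> 0" using pos[of n] by (auto simp: cheb_pos_def vec_eq_iff)
      then have "0 < ?v $ j" using pos[of n] unfolding cheb_pos_def by (metis order_le_less)
      also have "?v $ j \<le> (\<Sum>l\<in>UNIV. ?v $ l)"
        by (rule member_le_sum) (use pos[of n] in \<open>auto simp: cheb_pos_def\<close>)
      finally show ?thesis .
    qed
    then have "1 \<le> \<bar>det C\<bar> * (\<Sum>l\<in>UNIV. ?v $ l)"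
      using det_nonzero by (simp add: int_one_le_iff_zero_less)
    then show ?thesis by (simp add: d_def ht_diff ht_adj)
  qed
  then have dn: "d n \<le> d 0 - int n" for n
    by (induction n) (auto, smt (verit))
  \<comment> \<open>From this index on every difference \<open>d\<close> is at most
    \<open>-1\<close>, so the heights eventually become negative.\<close>
  define N where "N = nat (d 0) + 1"
  have decr: "ht (cheb i (N + k)) \<le> ht (cheb i N) - int k" for k
  proof (induction k)
    case (Suc k)
    have "d 0 < int N" by (simp add: N_def)
    then have "d (N + k) \<le> - 1" using dn[of "N + k"] unfolding of_nat_add by linarith
    then show ?case using Suc by (simp add: d_def)
  qed simp
  have "0 \<le> ht (cheb i (N + (nat (ht (cheb i N)) + 1)))"
    using pos[of "N + nat (ht (cheb i N))"] by (intro ht_nonneg) (simp add: cheb_pos_def)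
  then show False using decr[of "nat (ht (cheb i N)) + 1"] by linarith
qed

text \<open>This is the Coxeter number; it is attached to a node until \<open>hcox_const\<close>
  shows that all nodes agree.\<close>

definition hcox :: "'n \<Rightarrow> nat" where
  "hcox i = (LEAST n. 1 \<le> n \<and> cheb i n = 0)"

lemma hcox: "1 \<le> hcox i" "cheb i (hcox i) = 0"
  using LeastI_ex[of "\<lambda>n. 1 \<le> n \<and> cheb i n = 0"] cheb_zero_exists[of i] by (auto simp: hcox_def)

lemma cheb_pos_below: "1 \<le> n \<Longrightarrow> n < hcox i \<Longrightarrow> cheb_pos i n"
proof (induction n rule: dec_induct)
  case base
  show ?case using cheb_pos_1 by simp
next
  case (step n)
  have "cheb i (Suc n) \<noteq> 0" using not_less_Least[of "Suc n" "\<lambda>n. 1 \<le> n \<and> cheb i n = 0"] step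
    by (auto simp: hcox_def)
  then show ?case using cheb_pos_step[of i n] step by auto
qed

lemma hcox_ge_2: "2 \<le> hcox i"
proof -
  have "hcox i \<noteq> 1" using hcox(2)[of i] cheb_pos_1[of i] by (auto simp: cheb_pos_def)
  then show ?thesis using hcox(1)[of i] by linarith
qed

text \<open>By minimality all vectors \<open>cheb k (hcox i)\<close> are still nonnegative. Those of
  the neighbours of \<open>i\<close> add up, with positive weights, to
  \<open>adj (cheb i (hcox i)) = 0\<close>, so each of them vanishes.\<close>

lemma hcox_neighbour:
  assumes min: "\<And>j. hcox i \<le> hcox j" and nb: "C $ i $ j \<noteq> 0"
  shows "hcox j = hcox i"
proof (cases "j = i")
  case False
  have nn: "0 \<le> cheb k (hcox i) $ m" for k m
    using cheb_pos_below[OF hcox(1)[of i], of k] hcox(2)[of k] min[of k]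
    by (cases "hcox i = hcox k") (auto simp: cheb_pos_def)
  have "cheb j (hcox i) $ m = 0" for m
  proof -
    have "(\<Sum>k\<in>UNIV. nb i $ k * cheb k (hcox i) $ m) = adj (cheb i (hcox i)) $ m"
      by (simp add: adj_cheb)
    also have "\<dots> = 0" by (simp add: hcox(2))
    finally have "nb i $ j * cheb j (hcox i) $ m = 0"
      by (subst (asm) sum_nonneg_eq_0_iff) (auto simp: nn nb_nonneg)
    then show ?thesis using nb False by (simp add: nb_nth)
  qed
  then have "cheb j (hcox i) = 0" by (simp add: vec_eq_iff)
  then have "hcox j \<le> hcox i" using hcox(1)[of i] unfolding hcox_def[of j] by (intro Least_le) simp
  then show ?thesis using min[of j] by simp
qed simp

lemma hcox_const: "hcox i = hcox j"
proof -
  obtain m where mu: "\<And>k. hcox m \<le> hcox k"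
  proof -
    have "Min (range hcox) \<in> range hcox" by (rule Min_in) auto
    then obtain m where "Min (range hcox) = hcox m" by (rule rangeE)
    moreover have "Min (range hcox) \<le> hcox k" for k by (rule Min_le) auto
    ultimately show ?thesis using that by metis
  qed
  let ?S = "{k. hcox k = hcox m}"
  have zero: "C $ k $ n = 0 \<and> C $ n $ k = 0" if "k \<in> ?S" "n \<in> - ?S" for k n
  proof -
    have "hcox k = hcox m" "hcox n \<noteq> hcox m" using that by auto
    then have "C $ k $ n = 0" using hcox_neighbour[of k n] mu by metis
    then show ?thesis using C_sym[of k n] by simp
  qed
  have ind: "indecomposable C" using cartan by (simp add: simple_simply_laced_cartan_def)
  have "?S = UNIV"
  proof (rule ccontr)
    assume "?S \<noteq> UNIV"
    moreover have "m \<in> ?S" by simp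
    ultimately have "?S \<noteq> {} \<and> ?S \<noteq> UNIV \<and> (\<forall>k\<in>?S. \<forall>n\<in>- ?S. C $ k $ n = 0 \<and> C $ n $ k = 0)"
      using zero by (intro conjI ballI) blast+
    then show False using ind unfolding indecomposable_def by (metis (no_types, lifting))
  qed
  then have "i \<in> ?S" "j \<in> ?S" by blast+
  then show ?thesis by simp
qed

text \<open>The following vector is zero, so the Tits form reduces to the squared length: a
  nonnegative integer vector of squared length 1 is a unit vector.\<close>

lemma cheb_before_hcox: "\<exists>k. cheb i (hcox i - 1) = axis k 1"
proof -
  let ?v = "cheb i (hcox i - 1)"
  have pos: "cheb_pos i (hcox i - 1)"
    using hcox_ge_2[of i] by (intro cheb_pos_below) auto
  have "Suc (hcox i - 1) = hcox i" using hcox(1)[of i] by simp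
  then have "dot ?v ?v = 1"
    using tits_cheb[of i "hcox i - 1"] hcox(2)[of i] by (simp add: tits_def)
  moreover obtain k where g: "?v $ k \<noteq> 0" using pos by (auto simp: cheb_pos_def vec_eq_iff)
  ultimately have s: "?v $ k * ?v $ k + (\<Sum>j\<in>UNIV - {k}. ?v $ j * ?v $ j) = 1"
    by (simp add: dot_def sum.remove)
  moreover have "1 \<le> ?v $ k" using g pos by (simp add: cheb_pos_def int_one_le_iff_zero_less order_less_le)
  moreover from this have "?v $ k \<le> ?v $ k * ?v $ k" by simp
  moreover have "0 \<le> (\<Sum>j\<in>UNIV - {k}. ?v $ j * ?v $ j)" by (intro sum_nonneg) simp
  ultimately have 1: "?v $ k = 1" and "(\<Sum>j\<in>UNIV - {k}. ?v $ j * ?v $ j) = 0" by linarith+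
  then have "?v $ j = 0" if "j \<noteq> k" for j
    using that by (subst (asm) sum_nonneg_eq_0_iff) auto
  then have "?v = axis k 1" using 1 by (auto simp: vec_eq_iff axis_def)
  then show ?thesis ..
qed

text \<open>For the last property: the vectors \<open>cheb i (h - 1)\<close> are unit vectors and
  form a symmetric matrix, hence a permutation that is its own inverse (an involution of the
  diagram). Every node is therefore reached.\<close>

lemma coxeter:
  obtains h where "2 \<le> h" "\<And>i n. 1 \<le> n \<Longrightarrow> n < h \<Longrightarrow> cheb_pos i n" "\<And>i. cheb i h = 0"
    "\<And>k. \<exists>i. cheb i (h - 1) = axis k 1"
proof
  define h where "h = hcox undefined"
  have h: "hcox i = h" for i unfolding h_def by (rule hcox_const)
  show "2 \<le> h" using hcox_ge_2[of undefined] by (simp add: h)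
  show "cheb_pos i n" if "1 \<le> n" "n < h" for i n using cheb_pos_below that by (simp add: h)
  show "cheb i h = 0" for i using hcox(2)[of i] by (simp add: h)
  have ax: "\<exists>k. cheb i (h - 1) = axis k 1" for i using cheb_before_hcox[of i] by (simp add: h)
  show "\<exists>i. cheb i (h - 1) = axis k 1" for k
  proof -
    obtain i where 1: "cheb k (h - 1) = axis i 1" using ax by blast
    obtain k' where 2: "cheb i (h - 1) = axis k' 1" using ax by blast
    have "cheb i (h - 1) $ k = 1" unfolding cheb_sym[of i _ k] 1 by simp
    then have "k' = k" unfolding 2 by (simp add: axis_def split: if_splits)
    then show ?thesis using 2 by blast
  qed
qed

end

section \<open>Ordered products of quasi-commuting units\<close>

lemma ring_inv_eq: "is_unit_of u v \<Longrightarrow> ring_inv u = v"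
  unfolding ring_inv_def
proof (rule the_equality)
  fix v' assume u: "is_unit_of u v" "is_unit_of u v'"
  have "v' = v' * (u * v)" using u(1) by (simp add: is_unit_of_def)
  also have "\<dots> = v" using u(2) by (simp add: is_unit_of_def mult.assoc[symmetric])
  finally show "v' = v" .
qed

lemma is_unit_of_ring_inv: "\<exists>v. is_unit_of u v \<Longrightarrow> is_unit_of u (ring_inv u)"
  using ring_inv_eq by blast

lemma upow_0 [simp]: "upow u 0 = 1"
  by (simp add: upow_def)

lemma upow_1 [simp]: "upow u 1 = u"
  by (simp add: upow_def)

lemma upow_of_nat: "0 \<le> k \<Longrightarrow> upow u k = u ^ nat k"
  by (simp add: upow_def)

lemma upow_add_1:
  assumes "\<exists>v. is_unit_of u v"
  shows "upow u (k + 1) = upow u k * u"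
proof (cases "0 \<le> k")
  case True
  then show ?thesis by (simp add: upow_def nat_add_distrib power_commutes)
next
  case False
  then obtain n where n: "nat (- k) = Suc n" by (metis Suc_pred' neg_0_less_iff_less not_le zero_less_nat_eq)
  have "ring_inv u * u = 1" using is_unit_of_ring_inv[OF assms] by (simp add: is_unit_of_def)
  then have "ring_inv u ^ Suc n * u = ring_inv u ^ n"
    by (metis mult.assoc mult.right_neutral power_Suc2)
  moreover have "nat (- (k + 1)) = n" using n by linarith
  ultimately show ?thesis using False n by (cases "k = - 1") (auto simp: upow_def)
qed

lemma upow_add:
  assumes u: "\<exists>v. is_unit_of u v"
  shows "upow u (k + l) = upow u k * upow u l"
proof (induction l rule: int_induct[where k = 0])
  case (step1 l)
  then show ?case using upow_add_1[OF u, of "k + l"] upow_add_1[OF u, of l]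
    by (simp add: add.assoc mult.assoc)
next
  case (step2 l)
  have inv: "u * ring_inv u = 1" using is_unit_of_ring_inv[OF u] by (simp add: is_unit_of_def)
  have m: "upow u (j - 1) = upow u j * ring_inv u" for j
    using upow_add_1[OF u, of "j - 1"] inv by (simp add: mult.assoc)
  have "upow u (k + (l - 1)) = upow u (k + l) * ring_inv u"
    using m[of "k + l"] by (simp add: algebra_simps)
  then show ?case using step2 m[of l] by (simp add: mult.assoc)
qed simp

context zt_algebra
begin

definition qc :: "int \<Rightarrow> 'a \<Rightarrow> 'a \<Rightarrow> bool" where
  "qc k x y \<longleftrightarrow> x * y = smul (tpow k) (y * x)"

lemma qc_0: "qc 0 x y \<longleftrightarrow> x * y = y * x"
  by (simp add: qc_def)

lemma qc_one [simp]: "qc 0 x 1"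
  by (simp add: qc_def)

lemma qc_sym: "qc k x y \<Longrightarrow> qc (- k) y x"
  by (simp add: qc_def smul_tpow_tpow del: scale_scale)

lemma qc_mult_right: "qc k x y \<Longrightarrow> qc l x z \<Longrightarrow> qc (k + l) x (y * z)"
proof -
  assume y: "qc k x y" and z: "qc l x z"
  have "x * (y * z) = smul (tpow k) (y * (x * z))"
    using y by (simp add: qc_def mult.assoc[symmetric] smul_mult_left)
  also have "\<dots> = smul (tpow (k + l)) ((y * z) * x)"
    using z by (simp add: qc_def mult.assoc smul_mult_right tpow_add)
  finally show ?thesis by (simp add: qc_def)
qed

lemma qc_mult_left: "qc k x z \<Longrightarrow> qc l y z \<Longrightarrow> qc (k + l) (x * y) z"
  using qc_sym[of k x z] qc_sym[of l y z] qc_mult_right[of "- k" z x "- l" y] qc_sym[of "- k + - l" z "x * y"]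
  by (simp add: add.commute)

lemma qc_power: "qc k x y \<Longrightarrow> qc (k * int n) x (y ^ n)"
proof (induction n)
  case (Suc n)
  then show ?case using qc_mult_right[of k x y "k * int n" "y ^ n"] by (simp add: algebra_simps)
qed simp

lemma qc_inv:
  assumes "qc k x y" "is_unit_of y v"
  shows "qc (- k) x v"
proof -
  have "smul (tpow k) (x * v) = smul (tpow k) (v * (y * x) * v)"
    using assms(2) by (simp add: is_unit_of_def mult.assoc[symmetric])
  also have "\<dots> = v * (x * y) * v"
    using assms(1) by (simp add: qc_def smul_mult_left smul_mult_right)
  also have "\<dots> = v * x"
    using assms(2) by (simp add: is_unit_of_def mult.assoc)
  finally have "smul (tpow (- k)) (v * x) = x * v"
    by (metis smul_tpow_tpow add.left_inverse tpow_0 scale_one)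
  then show ?thesis by (simp add: qc_def)
qed

lemma qc_upow:
  assumes "qc k x y" "\<exists>v. is_unit_of y v"
  shows "qc (k * n) x (upow y n)"
proof (cases "0 \<le> n")
  case True
  then show ?thesis using qc_power[OF assms(1), of "nat n"] by (simp add: upow_def)
next
  case False
  then show ?thesis
    using qc_power[OF qc_inv[OF assms(1) is_unit_of_ring_inv[OF assms(2)]], of "nat (- n)"]
    by (simp add: upow_def)
qed

lemma qc_oprod:
  fixes f :: "'n::{finite, linorder} \<Rightarrow> 'a"
  assumes "\<And>\<alpha>. qc (k \<alpha>) x (f \<alpha>)"
  shows "qc (\<Sum>\<alpha>\<in>UNIV. k \<alpha>) x (oprod f)"
proof -
  have "qc (sum_list (map k xs)) x (prod_list (map f xs))" for xs
    by (induction xs) (auto intro: qc_mult_right assms)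
  from this[of "sorted_list_of_set UNIV"] show ?thesis
    by (simp add: oprod_def sum_list_distinct_conv_sum_set)
qed

end

lemma oprod_mult:
  fixes f g :: "'n::{finite, linorder} \<Rightarrow> 'a::ring_1"
  assumes "\<And>\<alpha> \<beta>. f \<alpha> * g \<beta> = g \<beta> * f \<alpha>"
  shows "oprod (\<lambda>\<alpha>. f \<alpha> * g \<alpha>) = oprod f * oprod g"
proof -
  have comm: "prod_list (map f xs) * g \<beta> = g \<beta> * prod_list (map f xs)" for xs \<beta>
  proof (induction xs)
    case (Cons a xs)
    then show ?case using assms[of a \<beta>] by (simp add: mult.assoc) (simp add: mult.assoc[symmetric])
  qed simp
  have "prod_list (map (\<lambda>\<alpha>. f \<alpha> * g \<alpha>) xs) = prod_list (map f xs) * prod_list (map g xs)" for xs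
  proof (induction xs)
    case (Cons a xs)
    then show ?case
      using comm[of xs a] by (simp add: mult.assoc) (simp add: mult.assoc[symmetric])
  qed simp
  then show ?thesis by (simp add: oprod_def)
qed

lemma oprod_single:
  fixes u :: "'a::ring_1"
  shows "oprod (\<lambda>\<beta> :: 'n::{finite, linorder}. if \<beta> = \<alpha> then u else 1) = u"
proof -
  have "prod_list (map (\<lambda>\<beta>. if \<beta> = \<alpha> then u else 1) xs) = (if \<alpha> \<in> set xs then u else 1)"
    if "distinct xs" for xs
    using that by (induction xs) auto
  then show ?thesis by (simp add: oprod_def)
qed

lemma oprod_cong: "(\<And>\<alpha>. f \<alpha> = g \<alpha>) \<Longrightarrow> oprod f = oprod g"
  by (simp add: oprod_def cong: map_cong)

section \<open>The quantum torus\<close>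

text \<open>The lexicographic order serves as a total cone: it yields the absence of zero divisors
  in the torus, and with it cancellation.\<close>

definition lexpos :: "'n::{finite, linorder} intvec \<Rightarrow> bool" where
  "lexpos v \<longleftrightarrow> (\<exists>i. 0 < v $ i \<and> (\<forall>j<i. v $ j = 0))"

lemma lexpos_add: "lexpos v \<Longrightarrow> lexpos w \<Longrightarrow> lexpos (v + w)"
proof -
  assume "lexpos v" "lexpos w"
  then obtain i j where ij: "0 < v $ i" "\<forall>k<i. v $ k = 0" "0 < w $ j" "\<forall>k<j. w $ k = 0"
    by (auto simp: lexpos_def)
  show ?thesis
    unfolding lexpos_def
  proof (intro exI[of _ "min i j"] conjI allI impI)
    show "0 < (v + w) $ min i j"
      using ij by (cases i j rule: linorder_cases) (auto simp: min_def)
  qed (use ij in auto)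
qed

lemma lexpos_0: "\<not> lexpos 0"
  by (simp add: lexpos_def)

lemma lexpos_total: "v = 0 \<or> lexpos v \<or> lexpos (- v)"
proof (cases "v = 0")
  case False
  define i where "i = Min {i. v $ i \<noteq> 0}"
  have ne: "{i. v $ i \<noteq> 0} \<noteq> {}" using False by (auto simp: vec_eq_iff)
  then have "v $ i \<noteq> 0" using Min_in[of "{i. v $ i \<noteq> 0}"] by (auto simp: i_def)
  moreover have "v $ j = 0" if "j < i" for j
  proof (rule ccontr)
    assume "v $ j \<noteq> 0"
    then have "i \<le> j" unfolding i_def by (intro Min_le) auto
    then show False using that by simp
  qed
  ultimately have "0 < v $ i \<and> (\<forall>j<i. v $ j = 0) \<or> 0 < (- v) $ i \<and> (\<forall>j<i. (- v) $ j = 0)"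
    by auto
  then show ?thesis unfolding lexpos_def by blast
qed simp

locale Q_torus = quantum_torus C smul Q + cartan C
  for C :: "'n::{finite, linorder} intmat"
    and smul :: "zt \<Rightarrow> 'a::ring_1 \<Rightarrow> 'a"
    and Q :: "'n \<Rightarrow> int \<Rightarrow> 'a"
begin

definition X :: "'n intvec \<Rightarrow> 'a" where
  "X a = oprod (\<lambda>\<alpha>. upow (Q \<alpha> 0) (a $ \<alpha>))"

definition Y :: "'n intvec \<Rightarrow> 'a" where
  "Y b = oprod (\<lambda>\<alpha>. upow (Q \<alpha> 1) (b $ \<alpha>))"

lemma units: "\<exists>v. is_unit_of (Q \<alpha> 0) v" "\<exists>v. is_unit_of (Q \<alpha> 1) v"
  by (rule Q_unit, simp)+

lemma qc_generators: "qc 0 (Q \<alpha> 0) (Q \<beta> 0)" "qc 0 (Q \<alpha> 1) (Q \<beta> 1)"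
  "qc (lam C \<alpha> \<beta>) (Q \<alpha> 0) (Q \<beta> 1)"
  using Q_comm[of 0 0 \<alpha> \<beta>] Q_comm[of 1 1 \<alpha> \<beta>] Q_comm[of 0 1 \<alpha> \<beta>] by (simp_all add: qc_def)

lemma upow_commute:
  assumes "qc 0 x y" "\<exists>v. is_unit_of x v" "\<exists>v. is_unit_of y v"
  shows "upow x k * upow y l = upow y l * upow x k"
proof -
  have "qc 0 x (upow y l)" using qc_upow[OF assms(1,3), of l] by simp
  then have "qc 0 (upow y l) x" using qc_sym by fastforce
  then have "qc 0 (upow y l) (upow x k)" using qc_upow[OF _ assms(2), of 0 _ k] by simp
  then show ?thesis by (simp add: qc_0)
qed

lemma X_add: "X (a + b) = X a * X b"
proof -
  have "X (a + b) = oprod (\<lambda>\<alpha>. upow (Q \<alpha> 0) (a $ \<alpha>) * upow (Q \<alpha> 0) (b $ \<alpha>))"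
    unfolding X_def by (simp add: upow_add[OF units(1)])
  also have "\<dots> = X a * X b"
    unfolding X_def by (rule oprod_mult) (rule upow_commute[OF qc_generators(1) units(1) units(1)])
  finally show ?thesis .
qed

lemma Y_add: "Y (a + b) = Y a * Y b"
proof -
  have "Y (a + b) = oprod (\<lambda>\<alpha>. upow (Q \<alpha> 1) (a $ \<alpha>) * upow (Q \<alpha> 1) (b $ \<alpha>))"
    unfolding Y_def by (simp add: upow_add[OF units(2)])
  also have "\<dots> = Y a * Y b"
    unfolding Y_def by (rule oprod_mult) (rule upow_commute[OF qc_generators(2) units(2) units(2)])
  finally show ?thesis .
qed

lemma X_0 [simp]: "X 0 = 1" and Y_0 [simp]: "Y 0 = 1"
  by (simp_all add: X_def Y_def oprod_def map_replicate_const)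

lemma X_axis: "X (axis \<alpha> 1) = Q \<alpha> 0" and Y_axis: "Y (axis \<alpha> 1) = Q \<alpha> 1"
proof -
  have "oprod (\<lambda>\<beta>. upow (Q \<beta> n) (axis \<alpha> 1 $ \<beta>)) = oprod (\<lambda>\<beta>. if \<beta> = \<alpha> then Q \<alpha> n else 1)" for n
    by (rule oprod_cong) (auto simp: axis_def)
  then show "X (axis \<alpha> 1) = Q \<alpha> 0" "Y (axis \<alpha> 1) = Q \<alpha> 1"
    by (simp_all add: X_def Y_def oprod_single)
qed

lemma X_minus_axis: "X (- axis \<alpha> 1) = ring_inv (Q \<alpha> 0)"
  using X_add[of "axis \<alpha> 1" "- axis \<alpha> 1"] X_add[of "- axis \<alpha> 1" "axis \<alpha> 1"]
  by (intro ring_inv_eq[symmetric]) (simp add: is_unit_of_def X_axis)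

lemma YX: "Y b * X a = smul (tpow (- ll b a)) (X a * Y b)"
proof -
  have "qc (\<Sum>\<beta>\<in>UNIV. lam C \<alpha> \<beta> * b $ \<beta>) (Q \<alpha> 0) (Y b)" for \<alpha>
    unfolding Y_def by (intro qc_oprod qc_upow qc_generators units)
  then have "qc (- (\<Sum>\<beta>\<in>UNIV. lam C \<alpha> \<beta> * b $ \<beta>)) (Y b) (Q \<alpha> 0)" for \<alpha>
    by (rule qc_sym)
  then have "qc (\<Sum>\<alpha>\<in>UNIV. - (\<Sum>\<beta>\<in>UNIV. lam C \<alpha> \<beta> * b $ \<beta>) * a $ \<alpha>) (Y b) (X a)"
    unfolding X_def by (intro qc_oprod qc_upow units)
  moreover have "(\<Sum>\<alpha>\<in>UNIV. - (\<Sum>\<beta>\<in>UNIV. lam C \<alpha> \<beta> * b $ \<beta>) * a $ \<alpha>) = - ll a b"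
    by (simp add: ll_def sum_negf sum_distrib_left sum_distrib_right algebra_simps)
  ultimately show ?thesis by (simp add: qc_def ll_sym)
qed

definition E :: "'n intvec \<times> 'n intvec \<Rightarrow> 'a" where
  "E i = X (fst i) * Y (snd i)"

definition tw :: "'n intvec \<times> 'n intvec \<Rightarrow> 'n intvec \<times> 'n intvec \<Rightarrow> int" where
  "tw i j = - ll (snd i) (fst j)"

sublocale twisted_group_algebra smul E tw
proof
  have "E = (\<lambda>(a, b). oprod (\<lambda>\<alpha>. upow (Q \<alpha> 0) (a $ \<alpha>)) * oprod (\<lambda>\<alpha>. upow (Q \<alpha> 1) (b $ \<alpha>)))"
    by (auto simp: E_def X_def Y_def)
  then show "basis_family smul E" using Q_basis by simp
  fix i j
  have "E i * E j = X (fst i) * (Y (snd i) * X (fst j)) * Y (snd j)"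
    by (simp add: E_def mult.assoc)
  also have "\<dots> = smul (tpow (tw i j)) (X (fst i) * X (fst j) * (Y (snd i) * Y (snd j)))"
    by (simp add: YX tw_def smul_mult_left smul_mult_right mult.assoc)
  finally show "E i * E j = smul (tpow (tw i j)) (E (i + j))"
    by (simp add: E_def X_add Y_add)
qed

lemma E_Pair: "E (a, b) = X a * Y b"
  by (simp add: E_def)

lemma X_eq_E: "X a = E (a, 0)" and Y_eq_E: "Y b = E (0, b)"
  by (simp_all add: E_def)

lemma mult_eq_0_iff': "x * y = 0 \<longleftrightarrow> x = 0 \<or> (y :: 'a) = 0"
proof -
  define P :: "'n intvec \<times> 'n intvec \<Rightarrow> bool"
    where "P i \<longleftrightarrow> lexpos (fst i) \<or> fst i = 0 \<and> lexpos (snd i)" for i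
  have "cone P" unfolding cone_def P_def
    by (auto simp: lexpos_0 intro: lexpos_add)
  moreover have "i = 0 \<or> P i \<or> P (- i)" for i
    using lexpos_total[of "fst i"] lexpos_total[of "snd i"]
    by (auto simp: P_def prod_eq_iff)
  ultimately have "x \<noteq> 0 \<Longrightarrow> y \<noteq> 0 \<Longrightarrow> x * y \<noteq> 0" by (rule mult_nonzero)
  then show ?thesis by auto
qed

lemma cancel_left: "z \<noteq> 0 \<Longrightarrow> z * x = z * y \<Longrightarrow> x = (y :: 'a)"
  using mult_eq_0_iff'[of z "x - y"] by (simp add: right_diff_distrib)

lemma cancel_right: "z \<noteq> 0 \<Longrightarrow> x * z = y * z \<Longrightarrow> x = (y :: 'a)"
  using mult_eq_0_iff'[of "x - y" z] by (simp add: left_diff_distrib)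

lemma smul_eq_0_iff: "smul c x = 0 \<longleftrightarrow> c = 0 \<or> x = 0"
proof
  assume *: "smul c x = 0"
  have "c * cf x i = 0" for i using arg_cong[OF *, of "\<lambda>x. cf x i"] by simp
  then show "c = 0 \<or> x = 0" by (metis cf_ext cf_zero mult_eq_0_iff)
qed auto

lemma power_nonzero: "x \<noteq> 0 \<Longrightarrow> (x :: 'a) ^ n \<noteq> 0"
  using one_neq_zero by (induction n) (auto simp: mult_eq_0_iff')

lemma oprod_nonzero: "(\<And>\<alpha>. f \<alpha> \<noteq> (0 :: 'a)) \<Longrightarrow> oprod (f :: 'n \<Rightarrow> 'a) \<noteq> 0"
proof -
  assume "\<And>\<alpha>. f \<alpha> \<noteq> 0"
  then have "prod_list (map f xs) \<noteq> 0" for xs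
    by (induction xs) (auto simp: mult_eq_0_iff')
  then show ?thesis by (simp add: oprod_def)
qed

lemma X_nonzero [simp]: "X a \<noteq> 0" and Y_nonzero [simp]: "Y b \<noteq> 0"
  by (simp_all add: X_eq_E Y_eq_E)

subsection \<open>The grading by the exponents of the second set of generators\<close>

definition hom :: "'n intvec \<Rightarrow> 'a \<Rightarrow> bool" where
  "hom b x \<longleftrightarrow> (\<forall>i\<in>supp x. snd i = b)"

definition comp :: "'n intvec \<Rightarrow> 'a \<Rightarrow> 'a" where
  "comp b = restr (\<lambda>i. snd i = b)"

lemma cf_comp [simp]: "cf (comp b x) i = (if snd i = b then cf x i else 0)"
  by (simp add: comp_def)

lemma hom_comp: "hom b (comp b x)"
  by (auto simp: hom_def in_supp split: if_splits)

lemma comp_hom: "hom b x \<Longrightarrow> comp c x = (if c = b then x else 0)"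
  by (rule cf_ext) (auto simp: hom_def in_supp)

lemma hom_E: "hom (snd i) (E i)"
  by (auto simp: hom_def in_supp cf_E split: if_splits)

lemma hom_X: "hom 0 (X a)" and hom_Y: "hom b (Y b)" and hom_1: "hom 0 1"
  using hom_E[of "(a, 0)"] hom_E[of "(0, b)"] hom_E[of "(0, 0)"] by (simp_all add: E_def)

lemma hom_iff: "hom b x \<longleftrightarrow> (\<forall>i. snd i \<noteq> b \<longrightarrow> cf x i = 0)"
  unfolding hom_def supp_def by blast

lemma hom_0 [simp]: "hom b 0"
  by (auto simp: hom_def in_supp)

lemma hom_add: "hom b x \<Longrightarrow> hom b y \<Longrightarrow> hom b (x + y)"
  and hom_diff: "hom b x \<Longrightarrow> hom b y \<Longrightarrow> hom b (x - y)"
  and hom_smul: "hom b x \<Longrightarrow> hom b (smul c x)"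
  by (auto simp: hom_iff)

lemma hom_mult: "hom b x \<Longrightarrow> hom c y \<Longrightarrow> hom (b + c) (x * y)"
  unfolding hom_def using supp_mult by fastforce

lemma comp_add [simp]: "comp b (x + y) = comp b x + comp b y"
  and comp_diff [simp]: "comp b (x - y) = comp b x - comp b y"
  and comp_smul [simp]: "comp b (smul c x) = smul c (comp b x)"
  and comp_zero [simp]: "comp b 0 = 0"
  by (rule cf_ext, simp)+

lemma comp_sum [simp]: "comp b (sum f A) = (\<Sum>x\<in>A. comp b (f x))"
  by (induction A rule: infinite_finite_induct) simp_all

lemma sum_comp:
  assumes "finite A" "snd ` supp x \<subseteq> A"
  shows "x = (\<Sum>b\<in>A. comp b x)"
proof (rule cf_ext)
  fix i
  have "cf (\<Sum>b\<in>A. comp b x) i = (\<Sum>b\<in>A. if b = snd i then cf x i else 0)"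
    unfolding cf_sum by (intro sum.cong) auto
  also have "\<dots> = cf x i"
    using assms by (auto simp: sum.delta in_supp image_subset_iff)
  finally show "cf x i = cf (\<Sum>b\<in>A. comp b x) i" ..
qed

lemma comp_mult_right:
  assumes y: "hom c y"
  shows "comp (b + c) (x * y) = comp b x * y"
proof (rule cf_ext)
  fix k
  have 1: "cf y (k - i) = 0" if "snd k \<noteq> snd i + c" for i
  proof (rule ccontr)
    assume "cf y (k - i) \<noteq> 0"
    then have "k - i \<in> supp y" by (simp add: in_supp)
    then have "snd (k - i) = c" using y unfolding hom_def by blast
    then show False using that by (simp add: algebra_simps)
  qed
  have 2: "cf (comp b x * y) k =
      (\<Sum>i\<in>supp x. (if snd i = b then cf x i else 0) * cf y (k - i) * tpow (tw i (k - i)))"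
    by (subst cf_mult_support[of "supp x"]) (auto simp: in_supp split: if_splits intro!: sum.cong)
  show "cf (comp (b + c) (x * y)) k = cf (comp b x * y) k"
  proof (cases "snd k = b + c")
    case True
    have t: "cf x i * cf y (k - i) * tpow (tw i (k - i)) =
        (if snd i = b then cf x i else 0) * cf y (k - i) * tpow (tw i (k - i))" for i
      using 1[of i] True by auto
    then show ?thesis unfolding 2 cf_comp cf_mult[of x y k] True
      by (simp only: simp_thms if_True)
  next
    case False
    have "(if snd i = b then cf x i else 0) * cf y (k - i) * tpow (tw i (k - i)) = 0" for i
      using 1[of i] False by auto
    then show ?thesis unfolding 2 cf_comp by (simp only: False if_False sum.neutral_const)
  qed
qed

lemma comp_mult_left:
  assumes y: "hom c y"
  shows "comp (c + b) (y * x) = y * comp b x"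
proof (rule cf_ext)
  fix k
  have 1: "cf y i = 0" if "snd i \<noteq> c" for i
    using y that by (auto simp: hom_def in_supp)
  show "cf (comp (c + b) (y * x)) k = cf (y * comp b x) k"
    unfolding cf_comp cf_mult using 1 by (auto simp: algebra_simps in_supp intro!: sum.cong sum.neutral)
qed

lemma hom_expand: "hom b x \<Longrightarrow> x = (\<Sum>a\<in>fst ` supp x. smul (cf x (a, b)) (X a)) * Y b"
proof -
  assume x: "hom b x"
  have inj: "inj_on fst (supp x)" using x by (auto simp: inj_on_def hom_def prod_eq_iff)
  have "x = (\<Sum>i\<in>supp x. smul (cf x i) (E i))" by (rule expand)
  also have "\<dots> = (\<Sum>i\<in>supp x. smul (cf x (fst i, b)) (X (fst i) * Y b))"
    using x by (intro sum.cong) (auto simp: hom_def E_def)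
  also have "\<dots> = (\<Sum>a\<in>fst ` supp x. smul (cf x (a, b)) (X a)) * Y b"
    by (simp add: sum.reindex[OF inj] sum_distrib_right smul_mult_left)
  finally show ?thesis .
qed

lemma hom_induct [consumes 1, case_names zero add smul]:
  assumes "hom 0 x" "P 0" "\<And>x y. P x \<Longrightarrow> P y \<Longrightarrow> P (x + y)" "\<And>c a. P (smul c (X a))"
  shows "P x"
proof -
  have "P (\<Sum>a\<in>A. smul (f a) (X a))" for A f
    by (induction A rule: infinite_finite_induct) (auto intro: assms(2-4))
  then show ?thesis by (subst hom_expand[OF assms(1)]) simp
qed

text \<open>Degree zero consists of the Laurent polynomials in the commuting variables
  \<open>Q \<alpha> 0\<close>.\<close>

lemma hom_0_commute:
  assumes "hom 0 x" "hom 0 y"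
  shows "x * y = y * x"
  using assms(1)
proof (induction rule: hom_induct)
  case (smul c a)
  show ?case using assms(2)
  proof (induction rule: hom_induct)
    case (smul d b)
    show ?case by (simp add: smul_mult_smul X_add[symmetric] add.commute mult.commute)
  qed (simp_all add: algebra_simps)
qed (simp_all add: algebra_simps)

lemma X_mult_X: "X a * X b = X (a + b)" and Y_mult_Y: "Y a * Y b = Y (a + b)"
  by (simp_all add: X_add Y_add)

lemma X_inverse [simp]: "X a * X (- a) = 1" "X (- a) * X a = 1"
  and Y_inverse [simp]: "Y a * Y (- a) = 1" "Y (- a) * Y a = 1"
  by (simp_all add: X_mult_X Y_mult_Y)

lemma Y_cancel [simp]: "Y a * (Y (- a) * x) = x" "Y (- a) * (Y a * x) = x"
  by (simp_all add: mult.assoc[symmetric])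

lemma X_cancel [simp]: "X a * (X (- a) * x) = x" "X (- a) * (X a * x) = x"
  by (simp_all add: mult.assoc[symmetric])

end

section \<open>Solutions of the quantum Q-system\<close>

locale Q_system = quantum_Q_system C smul Q + cartan C
  for C :: "'n::{finite, linorder} intmat"
    and smul :: "zt \<Rightarrow> 'a::ring_1 \<Rightarrow> 'a"
    and Q :: "'n \<Rightarrow> int \<Rightarrow> 'a"
begin

sublocale Q_torus C smul Q ..

text \<open>Negative entries of \<open>b\<close> are truncated to exponent 0, whence the
  nonnegativity assumptions below: the variables of a general index \<open>n\<close> need not be
  invertible.\<close>

definition Mn :: "int \<Rightarrow> 'n intvec \<Rightarrow> 'a" where
  "Mn n b = oprod (\<lambda>\<beta>. Q \<beta> n ^ nat (b $ \<beta>))"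

lemma rec: "smul (tpow (lam C \<alpha> \<alpha>)) (Q \<alpha> (n + 1) * Q \<alpha> (n - 1)) = (Q \<alpha> n)\<^sup>2 - Mn n (nb \<alpha>)"
proof -
  have "oprod (\<lambda>\<beta>. if \<beta> = \<alpha> then 1 else Q \<beta> n ^ nat (- (C $ \<alpha> $ \<beta>))) = Mn n (nb \<alpha>)"
    unfolding Mn_def by (rule oprod_cong) (simp add: nb_nth)
  then show ?thesis using Q_rec[of \<alpha> n] by simp
qed

lemma Mn_0: "(\<And>j. 0 \<le> b $ j) \<Longrightarrow> Mn 0 b = X b" and Mn_1: "(\<And>j. 0 \<le> b $ j) \<Longrightarrow> Mn 1 b = Y b"
  unfolding Mn_def X_def Y_def by (rule oprod_cong, simp add: upow_of_nat)+

lemma Mn_axis: "Mn n (axis \<alpha> 1) = Q \<alpha> n"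
proof -
  have "Mn n (axis \<alpha> 1) = oprod (\<lambda>\<beta>. if \<beta> = \<alpha> then Q \<alpha> n else 1)"
    unfolding Mn_def by (rule oprod_cong) (auto simp: axis_def)
  then show ?thesis by (simp add: oprod_single)
qed

lemma Mn_zero [simp]: "Mn n 0 = 1"
  by (simp add: Mn_def oprod_def map_replicate_const)

lemma qc_Mn: "(\<And>\<beta>. qc (k \<beta>) x (Q \<beta> n)) \<Longrightarrow> (\<And>j. 0 \<le> b $ j) \<Longrightarrow> qc (\<Sum>\<beta>\<in>UNIV. k \<beta> * b $ \<beta>) x (Mn n b)"
proof -
  assume k: "\<And>\<beta>. qc (k \<beta>) x (Q \<beta> n)" and b: "\<And>j. 0 \<le> b $ j"
  have "qc (k \<beta> * b $ \<beta>) x (Q \<beta> n ^ nat (b $ \<beta>))" for \<beta>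
    using qc_power[OF k[of \<beta>], of "nat (b $ \<beta>)"] b[of \<beta>] by simp
  then show ?thesis unfolding Mn_def by (rule qc_oprod)
qed

lemma powers_commute: "x * y = y * x \<Longrightarrow> x ^ m * y ^ n = y ^ n * (x :: 'a) ^ m"
  by (metis power_commuting_commutes)

lemma Mn_add:
  assumes comm: "\<And>\<alpha> \<beta>. Q \<alpha> n * Q \<beta> n = Q \<beta> n * Q \<alpha> n"
    and b: "\<And>j. 0 \<le> b $ j" and c: "\<And>j. 0 \<le> c $ j"
  shows "Mn n (b + c) = Mn n b * Mn n c"
proof -
  have "Mn n (b + c) = oprod (\<lambda>\<beta>. Q \<beta> n ^ nat (b $ \<beta>) * Q \<beta> n ^ nat (c $ \<beta>))"
    unfolding Mn_def by (rule oprod_cong) (simp add: nat_add_distrib b c power_add)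
  also have "\<dots> = Mn n b * Mn n c"
    unfolding Mn_def by (intro oprod_mult powers_commute comm)
  finally show ?thesis .
qed

subsection \<open>Leading terms\<close>

lemma LF_smul_iff: "c \<noteq> 0 \<Longrightarrow> LF P i (smul c x) \<longleftrightarrow> LF P i x"
  by (auto simp: LF_def in_supp)

lemma LF_1: "LF P 0 1"
  using LF_E[of P 0] by (simp add: E_def)

lemma LF_X: "LF P (a, 0) (X a)" and LF_Y: "LF P (0, b) (Y b)"
  by (simp_all add: X_eq_E Y_eq_E LF_E)

lemma LF_power:
  assumes P: "cone P" and x: "LF P (a, b) x"
  shows "LF P (int n *s a, int n *s b) (x ^ n)"
proof (induction n)
  case 0
  then show ?case using LF_1 by (simp add: zero_prod_def)
next
  case (Suc n)
  have "(int (Suc n) *s a, int (Suc n) *s b) = (a, b) + (int n *s a, int n *s b)"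
    by (simp add: vec_eq_iff algebra_simps)
  then show ?case using LF_mult[OF P x Suc] by simp
qed

definition mix :: "'n intvec \<Rightarrow> ('n \<Rightarrow> 'n intvec) \<Rightarrow> 'n intvec" where
  "mix m v = (\<chi> \<mu>. \<Sum>\<beta>\<in>UNIV. m $ \<beta> * v \<beta> $ \<mu>)"

lemma mix_zero [simp]: "mix m (\<lambda>\<beta>. 0) = 0"
  by (simp add: mix_def vec_eq_iff)

lemma LF_oprod:
  fixes f :: "'n \<Rightarrow> 'a"
  assumes P: "cone P" and f: "\<And>\<beta>. LF P (i \<beta>) (f \<beta>)"
  shows "LF P (\<Sum>\<beta>\<in>UNIV. i \<beta>) (oprod f)"
proof -
  have "LF P (sum_list (map i xs)) (prod_list (map f xs))" for xs
    by (induction xs) (auto intro: LF_mult[OF P] f LF_1)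
  from this[of "sorted_list_of_set UNIV"] show ?thesis
    by (simp add: oprod_def sum_list_distinct_conv_sum_set)
qed

lemma LF_Mn:
  assumes P: "cone P" and Q: "\<And>\<beta>. LF P (u \<beta>, v \<beta>) (Q \<beta> n)" and m: "\<And>j. 0 \<le> m $ j"
  shows "LF P (mix m u, mix m v) (Mn n m)"
proof -
  have "LF P (\<Sum>\<beta>\<in>UNIV. (int (nat (m $ \<beta>)) *s u \<beta>, int (nat (m $ \<beta>)) *s v \<beta>)) (Mn n m)"
    unfolding Mn_def by (intro LF_oprod LF_power P Q)
  moreover have "(\<Sum>\<beta>\<in>UNIV. (int (nat (m $ \<beta>)) *s u \<beta>, int (nat (m $ \<beta>)) *s v \<beta>)) = (mix m u, mix m v)"
    by (simp add: prod_eq_iff fst_sum snd_sum vec_eq_iff mix_def m)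
  ultimately show ?thesis by simp
qed

text \<open>The two cases say which term on the right of the recursion is the lower one; division by
  \<open>Q \<alpha> (n - 1)\<close> then determines the leading exponent of
  \<open>Q \<alpha> (n + 1)\<close>.\<close>

lemma LF_rec:
  assumes P: "cone P"
    and Q: "\<And>\<beta>. LF P (u \<beta>, v \<beta>) (Q \<beta> n)" and Q': "LF P i (Q \<alpha> (n - 1))"
  shows "P (mix (nb \<alpha>) u - 2 *s u \<alpha>, mix (nb \<alpha>) v - 2 *s v \<alpha>) \<Longrightarrow>
      LF P ((2 *s u \<alpha>, 2 *s v \<alpha>) - i) (Q \<alpha> (n + 1))"
    and "P (2 *s u \<alpha> - mix (nb \<alpha>) u, 2 *s v \<alpha> - mix (nb \<alpha>) v) \<Longrightarrow>
      LF P ((mix (nb \<alpha>) u, mix (nb \<alpha>) v) - i) (Q \<alpha> (n + 1))"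
proof -
  have sq: "LF P (2 *s u \<alpha>, 2 *s v \<alpha>) ((Q \<alpha> n)\<^sup>2)"
    using LF_power[OF P Q[of \<alpha>], of 2] by simp
  have mn: "LF P (mix (nb \<alpha>) u, mix (nb \<alpha>) v) (Mn n (nb \<alpha>))"
    by (intro LF_Mn P Q nb_nonneg)
  have div: "LF P (j - i) (Q \<alpha> (n + 1))" if "LF P j ((Q \<alpha> n)\<^sup>2 - Mn n (nb \<alpha>))" for j
    using that Q' unfolding rec[symmetric] by (intro LF_div[OF P]) (simp_all add: LF_smul_iff)
  show "LF P ((2 *s u \<alpha>, 2 *s v \<alpha>) - i) (Q \<alpha> (n + 1))"
    if "P (mix (nb \<alpha>) u - 2 *s u \<alpha>, mix (nb \<alpha>) v - 2 *s v \<alpha>)"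
    using that by (intro div LF_diff[OF P sq mn]) simp
  show "LF P ((mix (nb \<alpha>) u, mix (nb \<alpha>) v) - i) (Q \<alpha> (n + 1))"
    if "P (2 *s u \<alpha> - mix (nb \<alpha>) u, 2 *s v \<alpha> - mix (nb \<alpha>) v)"
  proof (rule div)
    have "LF P (mix (nb \<alpha>) u, mix (nb \<alpha>) v) (- (Mn n (nb \<alpha>) - (Q \<alpha> n)\<^sup>2))"
      using that by (intro LF_uminus LF_diff[OF P mn sq]) simp
    then show "LF P (mix (nb \<alpha>) u, mix (nb \<alpha>) v) ((Q \<alpha> n)\<^sup>2 - Mn n (nb \<alpha>))" by simp
  qed
qed

text \<open>The sign is reversed: the least exponent for this cone is the one of greatest
  height.\<close>

definition top_cone :: "'n intvec \<times> 'n intvec \<Rightarrow> bool" where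
  "top_cone i \<longleftrightarrow> ht (snd i) < 0"

lemma cone_top: "cone top_cone"
  by (auto simp: cone_def top_cone_def ht_add)

lemma mix_axis: "mix m (\<lambda>\<beta>. axis \<beta> k) = k *s m"
proof -
  have "(\<Sum>\<beta>\<in>UNIV. m $ \<beta> * axis \<beta> k $ \<mu>) = (\<Sum>\<beta>\<in>UNIV. if \<beta> = \<mu> then k * m $ \<mu> else 0)" for \<mu>
    by (intro sum.cong) (auto simp: axis_def)
  then show ?thesis by (simp add: mix_def vec_eq_iff)
qed

lemma ht_scale: "ht (k *s v) = k * ht v"
  unfolding ht_expand[of v] ht_expand[of "k *s v"] by (simp add: sum_distrib_left algebra_simps)

lemma scale_axis: "k *s axis \<alpha> 1 = (axis \<alpha> k :: 'n intvec)" "2 *s axis \<alpha> k = (axis \<alpha> (2 * k) :: 'n intvec)"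
  by (auto simp: vec_eq_iff axis_def)

lemma nb_eq: "nb \<alpha> = 2 *s axis \<alpha> 1 - C $ \<alpha>"
  by (simp add: nb_def scale_axis)

text \<open>At the top the square dominates: its exponent exceeds that of the product by a positive
  multiple of row \<open>\<alpha>\<close> of \<open>C\<close>. What remains of the recursion,
  dividing the square of one term by its predecessor, has linear exponents as its solution.\<close>

lemma LF_top: "LF top_cone (axis \<alpha> (1 - int n), axis \<alpha> (int n)) (Q \<alpha> (int n))"
proof -
  have "(\<forall>\<alpha>. LF top_cone (axis \<alpha> (1 - int n), axis \<alpha> (int n)) (Q \<alpha> (int n))) \<and>
      (\<forall>\<alpha>. LF top_cone (axis \<alpha> (1 - int (Suc n)), axis \<alpha> (int (Suc n))) (Q \<alpha> (int (Suc n))))"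
  proof (induction n)
    case 0
    have ax0: "axis \<alpha> 0 = (0 :: 'n intvec)" for \<alpha> by (simp add: vec_eq_iff axis_def)
    show ?case
      using LF_X[of top_cone "axis _ 1"] LF_Y[of top_cone "axis _ 1"] by (simp add: X_axis Y_axis ax0)
  next
    case (Suc n)
    have "LF top_cone (axis \<alpha> (1 - int (Suc (Suc n))), axis \<alpha> (int (Suc (Suc n)))) (Q \<alpha> (int (Suc (Suc n))))"
      for \<alpha>
    proof -
      let ?k = "int (Suc n)"
      have "ht (?k *s nb \<alpha> - 2 *s axis \<alpha> ?k) = - ?k * \<bar>det C\<bar>"
      proof -
        have "?k *s nb \<alpha> - 2 *s axis \<alpha> ?k = - (?k *s (C $ \<alpha>))"
          unfolding nb_eq by (auto simp: vec_eq_iff axis_def algebra_simps)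
        then show ?thesis by (simp only: ht_minus ht_scale ht_row mult_minus_left)
      qed
      then have neg: "ht (?k *s nb \<alpha> - 2 *s axis \<alpha> ?k) < 0"
        using det_nonzero by (simp add: mult_less_0_iff)
      have "LF top_cone ((2 *s axis \<alpha> (1 - ?k), 2 *s axis \<alpha> ?k) - (axis \<alpha> (1 - int n), axis \<alpha> (int n))) (Q \<alpha> (?k + 1))"
      proof (rule LF_rec(1)[OF cone_top])
        show "LF top_cone (axis \<beta> (1 - ?k), axis \<beta> ?k) (Q \<beta> ?k)" for \<beta> using Suc by blast
        show "LF top_cone (axis \<alpha> (1 - int n), axis \<alpha> (int n)) (Q \<alpha> (?k - 1))" using Suc by simp
        show "top_cone (mix (nb \<alpha>) (\<lambda>\<beta>. axis \<beta> (1 - ?k)) - 2 *s axis \<alpha> (1 - ?k),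
            mix (nb \<alpha>) (\<lambda>\<beta>. axis \<beta> ?k) - 2 *s axis \<alpha> ?k)"
          using neg by (simp only: top_cone_def mix_axis snd_conv)
      qed
      moreover have "(2 *s axis \<alpha> (1 - ?k), 2 *s axis \<alpha> ?k) - (axis \<alpha> (1 - int n), axis \<alpha> (int n)) =
          (axis \<alpha> (1 - int (Suc (Suc n))), axis \<alpha> (int (Suc (Suc n))) :: 'n intvec)"
        by (auto simp: vec_eq_iff axis_def)
      ultimately show ?thesis by (simp add: add.commute)
    qed
    then show ?case using Suc by blast
  qed
  then show ?thesis by blast
qed

lemma Q_nonzero: "0 \<le> n \<Longrightarrow> Q \<alpha> n \<noteq> 0"
  using LF_nonzero[OF LF_top[of \<alpha> "nat n"]] by simp

subsection \<open>Commutation relations\<close>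

lemma qc_smul: "qc k x y \<Longrightarrow> qc k x (smul c y)"
  by (simp add: qc_def smul_mult_left smul_mult_right mult.commute)

lemma qc_diff: "qc k x y \<Longrightarrow> qc k x z \<Longrightarrow> qc k x (y - z)"
  by (simp add: qc_def left_diff_distrib right_diff_distrib scale_right_diff_distrib)

lemma qc_div_right:
  assumes "qc k y (z * x)" "qc l y x" "x \<noteq> 0"
  shows "qc (k - l) y z"
proof -
  have "(y * z) * x = smul (tpow k) (z * (x * y))"
    using assms(1) by (simp add: qc_def mult.assoc)
  also have "x * y = smul (tpow (- l)) (y * x)" using qc_sym[OF assms(2)] by (simp add: qc_def)
  finally have "(y * z) * x = smul (tpow (k - l)) (z * y) * x"
    by (simp add: smul_mult_left smul_mult_right mult.assoc tpow_add[symmetric])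
  then show ?thesis unfolding qc_def by (rule cancel_right[OF assms(3)])
qed

text \<open>For \<open>\<alpha> \<noteq> \<gamma>\<close> this equals the exponent of the squared
  variable, so both terms of the recursion at \<open>\<gamma>\<close> quasi-commute in the same way
  with a variable at \<open>\<alpha>\<close> of the previous index.\<close>

lemma ll_axis_nb: "ll (axis \<alpha> 1) (nb \<gamma>) = 2 * lam C \<alpha> \<gamma> - (if \<alpha> = \<gamma> then det C else 0)"
proof -
  have "ll (axis \<alpha> 1) (C $ \<gamma>) = (if \<alpha> = \<gamma> then det C else 0)"
    using ll_row[of \<gamma> "axis \<alpha> 1"] by (auto simp: ll_sym axis_def)
  moreover have "ll (axis \<alpha> 1) (2 *s axis \<gamma> 1) = 2 * lam C \<alpha> \<gamma>"
    using ll_add_right[of "axis \<alpha> 1" "axis \<gamma> 1" "axis \<gamma> 1"]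
    by (simp add: ll_axis) (simp add: ll_axis_left sum_distrib_left algebra_simps)
  ultimately show ?thesis unfolding nb_eq ll_diff_right by simp
qed

text \<open>The recursion couples three consecutive indices, so the relations for two of them are
  carried along together. A relation for the new index is checked after multiplication by nonzero
  variables of the oldest index, which are then cancelled.\<close>

lemma qc_Q:
  "(\<forall>\<alpha> \<beta>. qc 0 (Q \<alpha> (int n)) (Q \<beta> (int n))) \<and>
   (\<forall>\<alpha> \<beta>. qc (lam C \<alpha> \<beta>) (Q \<alpha> (int n)) (Q \<beta> (int n + 1))) \<and>
   (\<forall>\<alpha> \<beta>. qc 0 (Q \<alpha> (int n + 1)) (Q \<beta> (int n + 1)))"
proof (induction n)
  case 0
  then show ?case using qc_generators by simp
next
  case (Suc n)
  define m where "m = int n + 1"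
  have xx: "qc 0 (Q \<alpha> (m - 1)) (Q \<beta> (m - 1))" and xy: "qc (lam C \<alpha> \<beta>) (Q \<alpha> (m - 1)) (Q \<beta> m)"
    and yy: "qc 0 (Q \<alpha> m) (Q \<beta> m)" for \<alpha> \<beta>
    using Suc by (auto simp: m_def)
  define p where "p \<alpha> = (Q \<alpha> m)\<^sup>2 - Mn m (nb \<alpha>)" for \<alpha>
  have nz: "Q \<alpha> (m - 1) \<noteq> 0" for \<alpha> by (rule Q_nonzero) (simp add: m_def)
  have zx: "Q \<alpha> (m + 1) * Q \<alpha> (m - 1) = smul (tpow (- lam C \<alpha> \<alpha>)) (p \<alpha>)" for \<alpha>
    unfolding rec[symmetric] p_def by (simp add: tpow_add[symmetric])
  have xp: "qc (2 * lam C \<alpha> \<gamma>) (Q \<alpha> (m - 1)) (p \<gamma>)" if "\<alpha> \<noteq> \<gamma>" for \<alpha> \<gamma>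
    unfolding p_def
  proof (rule qc_diff)
    show "qc (2 * lam C \<alpha> \<gamma>) (Q \<alpha> (m - 1)) ((Q \<gamma> m)\<^sup>2)"
      using qc_power[OF xy, of \<alpha> \<gamma> 2] by (simp add: mult.commute)
    have "qc (\<Sum>\<beta>\<in>UNIV. lam C \<alpha> \<beta> * nb \<gamma> $ \<beta>) (Q \<alpha> (m - 1)) (Mn m (nb \<gamma>))"
      by (intro qc_Mn xy nb_nonneg)
    then show "qc (2 * lam C \<alpha> \<gamma>) (Q \<alpha> (m - 1)) (Mn m (nb \<gamma>))"
      using ll_axis_nb[of \<alpha> \<gamma>] that by (simp add: ll_axis_left)
  qed
  have yp: "qc 0 (Q \<alpha> m) (p \<gamma>)" for \<alpha> \<gamma>
    unfolding p_def
  proof (rule qc_diff)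
    show "qc 0 (Q \<alpha> m) ((Q \<gamma> m)\<^sup>2)" using qc_power[OF yy[of \<alpha> \<gamma>], of 2] by simp
    show "qc 0 (Q \<alpha> m) (Mn m (nb \<gamma>))" using qc_Mn[of "\<lambda>_. 0", OF yy nb_nonneg] by simp
  qed
  have py: "qc 0 (p \<gamma>) (Q \<alpha> m)" for \<alpha> \<gamma> using qc_sym[OF yp] by simp
  have pp: "p \<gamma> * p \<alpha> = p \<alpha> * p \<gamma>" for \<alpha> \<gamma>
  proof -
    have "qc 0 (p \<gamma>) (p \<alpha>)" unfolding p_def[of \<alpha>]
    proof (rule qc_diff)
      show "qc 0 (p \<gamma>) ((Q \<alpha> m)\<^sup>2)" using qc_power[OF py[of \<gamma> \<alpha>], of 2] by simp
      show "qc 0 (p \<gamma>) (Mn m (nb \<alpha>))" using qc_Mn[of "\<lambda>_. 0", OF py nb_nonneg] by simp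
    qed
    then show ?thesis by (simp add: qc_0)
  qed
  have yz: "qc (lam C \<gamma> \<alpha>) (Q \<gamma> m) (Q \<alpha> (m + 1))" for \<alpha> \<gamma>
  proof -
    have "qc 0 (Q \<gamma> m) (Q \<alpha> (m + 1) * Q \<alpha> (m - 1))"
      unfolding zx by (rule qc_smul) (rule yp)
    from qc_div_right[OF this qc_sym[OF xy] nz] show ?thesis by (simp add: lam_sym)
  qed
  have zz: "qc 0 (Q \<alpha> (m + 1)) (Q \<gamma> (m + 1))" for \<alpha> \<gamma>
  proof (cases "\<alpha> = \<gamma>")
    case False
    \<comment> \<open>The right-hand side is symmetric in the two nodes, because
      \<open>p \<alpha>\<close> and \<open>p \<gamma>\<close> commute and \<open>lam\<close> is
      symmetric.\<close>
    have key: "Q \<alpha> (m + 1) * Q \<gamma> (m + 1) * (Q \<gamma> (m - 1) * Q \<alpha> (m - 1)) =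
        smul (tpow (- lam C \<gamma> \<gamma> - lam C \<alpha> \<alpha> - 2 * lam C \<alpha> \<gamma>)) (p \<alpha> * p \<gamma>)"
      if "\<alpha> \<noteq> \<gamma>" for \<alpha> \<gamma>
    proof -
      have "p \<gamma> * Q \<alpha> (m - 1) = smul (tpow (- (2 * lam C \<alpha> \<gamma>))) (Q \<alpha> (m - 1) * p \<gamma>)"
        using qc_sym[OF xp[OF that]] by (simp add: qc_def)
      moreover have "Q \<alpha> (m + 1) * Q \<gamma> (m + 1) * (Q \<gamma> (m - 1) * Q \<alpha> (m - 1)) =
          Q \<alpha> (m + 1) * (Q \<gamma> (m + 1) * Q \<gamma> (m - 1)) * Q \<alpha> (m - 1)"
        by (simp add: mult.assoc)
      moreover have "\<dots> = smul (tpow (- lam C \<gamma> \<gamma>)) (Q \<alpha> (m + 1) * (p \<gamma> * Q \<alpha> (m - 1)))"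
        unfolding zx by (simp add: smul_mult_left smul_mult_right mult.assoc)
      ultimately have "Q \<alpha> (m + 1) * Q \<gamma> (m + 1) * (Q \<gamma> (m - 1) * Q \<alpha> (m - 1)) =
          smul (tpow (- lam C \<gamma> \<gamma>)) (smul (tpow (- (2 * lam C \<alpha> \<gamma>))) ((Q \<alpha> (m + 1) * Q \<alpha> (m - 1)) * p \<gamma>))"
        by (simp add: smul_mult_right mult.assoc)
      also have "\<dots> = smul (tpow (- lam C \<gamma> \<gamma>)) (smul (tpow (- (2 * lam C \<alpha> \<gamma>)))
          (smul (tpow (- lam C \<alpha> \<alpha>)) (p \<alpha> * p \<gamma>)))"
        unfolding zx by (simp only: smul_mult_left)
      also have "\<dots> = smul (tpow (- lam C \<gamma> \<gamma> - lam C \<alpha> \<alpha> - 2 * lam C \<alpha> \<gamma>)) (p \<alpha> * p \<gamma>)"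
        unfolding smul_tpow_tpow by (rule arg_cong[where f = "\<lambda>k. smul (tpow k) _"]) simp
      finally show ?thesis .
    qed
    have "Q \<alpha> (m - 1) * Q \<gamma> (m - 1) = Q \<gamma> (m - 1) * Q \<alpha> (m - 1)" using xx by (simp add: qc_0)
    moreover have "smul (tpow (- lam C \<gamma> \<gamma> - lam C \<alpha> \<alpha> - 2 * lam C \<alpha> \<gamma>)) (p \<alpha> * p \<gamma>) =
        smul (tpow (- lam C \<alpha> \<alpha> - lam C \<gamma> \<gamma> - 2 * lam C \<gamma> \<alpha>)) (p \<gamma> * p \<alpha>)"
      unfolding pp[of \<alpha> \<gamma>] lam_sym[of \<alpha> \<gamma>] by (rule arg_cong[where f = "\<lambda>k. smul (tpow k) _"]) simp
    ultimately have "Q \<alpha> (m + 1) * Q \<gamma> (m + 1) * (Q \<gamma> (m - 1) * Q \<alpha> (m - 1)) =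
        Q \<gamma> (m + 1) * Q \<alpha> (m + 1) * (Q \<gamma> (m - 1) * Q \<alpha> (m - 1))"
      using key[OF False] key[of \<gamma> \<alpha>] False by metis
    then show ?thesis unfolding qc_0 by (rule cancel_right[rotated]) (simp add: mult_eq_0_iff' nz)
  qed (simp add: qc_0)
  show ?case using yy yz zz by (simp add: m_def add.commute)
qed

lemma Q_commute: "0 \<le> n \<Longrightarrow> Q \<alpha> n * Q \<beta> n = Q \<beta> n * Q \<alpha> n"
  using qc_Q[of "nat n"] by (simp add: qc_0)

subsection \<open>The variables of index minus one\<close>

text \<open>The right-hand side of the recursion at index 0; solving for
  \<open>Q \<alpha> (-1)\<close> divides it by \<open>Q \<alpha> 1\<close>.\<close>

definition P :: "'n \<Rightarrow> 'a" where
  "P \<alpha> = X (axis \<alpha> 2) - X (nb \<alpha>)"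

lemma Q_minus_1: "Q \<alpha> (- 1) = smul (tpow (- lam C \<alpha> \<alpha>)) (Y (- axis \<alpha> 1) * P \<alpha>)"
proof -
  have "Q \<alpha> 0 ^ 2 = X (axis \<alpha> 1 + axis \<alpha> 1)"
    by (simp only: X_add X_axis power2_eq_square)
  also have "axis \<alpha> 1 + axis \<alpha> 1 = (axis \<alpha> 2 :: 'n intvec)" by (simp add: vec_eq_iff axis_def)
  finally have "smul (tpow (lam C \<alpha> \<alpha>)) (Y (axis \<alpha> 1) * Q \<alpha> (- 1)) = P \<alpha>"
    using rec[of \<alpha> 0] by (simp add: Mn_0 nb_nonneg P_def Y_axis)
  then have "smul (tpow (- lam C \<alpha> \<alpha>)) (Y (- axis \<alpha> 1) * smul (tpow (lam C \<alpha> \<alpha>)) (Y (axis \<alpha> 1) * Q \<alpha> (- 1))) =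
      smul (tpow (- lam C \<alpha> \<alpha>)) (Y (- axis \<alpha> 1) * P \<alpha>)" by simp
  then show ?thesis by (simp add: smul_mult_right tpow_add[symmetric])
qed

lemma hom_P: "hom 0 (P \<alpha>)"
  by (simp add: P_def hom_diff hom_X)

lemma hom_Q_minus_1: "hom (- axis \<alpha> 1) (Q \<alpha> (- 1))"
  using hom_mult[OF hom_Y hom_P, of "- axis \<alpha> 1" \<alpha>] unfolding Q_minus_1 by (intro hom_smul) simp

lemma axis2_neq_nb: "axis \<alpha> 2 \<noteq> nb \<alpha>"
proof
  assume "axis \<alpha> 2 = nb \<alpha>"
  then have "axis \<alpha> 2 $ \<alpha> = nb \<alpha> $ \<alpha>" by simp
  then show False by (simp add: nb_nth axis_def)
qed

lemma P_nonzero: "P \<alpha> \<noteq> 0"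
proof
  assume "P \<alpha> = 0"
  then have "cf (P \<alpha>) (axis \<alpha> 2, 0) = 0" by simp
  then show False using axis2_neq_nb[of \<alpha>] by (simp add: P_def X_eq_E cf_E)
qed

lemma Q_minus_1_nonzero: "Q \<alpha> (- 1) \<noteq> 0"
  by (simp add: Q_minus_1 smul_eq_0_iff mult_eq_0_iff' P_nonzero)

text \<open>The two exponents of the binomial differ by row \<open>\<alpha>\<close> of
  \<open>C\<close>, whose pairing with \<open>b\<close> is
  \<open>det C * b $ \<alpha> = 0\<close>.\<close>

lemma qc_Y_P:
  assumes "b $ \<alpha> = 0"
  shows "qc (- 2 * ll b (axis \<alpha> 1)) (Y b) (P \<alpha>)"
  unfolding P_def
proof (rule qc_diff)
  have "axis \<alpha> 2 = axis \<alpha> 1 + (axis \<alpha> 1 :: 'n intvec)" by (simp add: vec_eq_iff axis_def)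
  then have 2: "ll b (axis \<alpha> 2) = 2 * ll b (axis \<alpha> 1)"
    by (simp only: ll_add_right mult_2)
  then show "qc (- 2 * ll b (axis \<alpha> 1)) (Y b) (X (axis \<alpha> 2))"
    unfolding qc_def YX by simp
  have "ll b (nb \<alpha>) = 2 * ll b (axis \<alpha> 1)"
    unfolding nb_def ll_diff_right 2 using ll_row[of \<alpha> b] assms by (simp add: ll_sym)
  then show "qc (- 2 * ll b (axis \<alpha> 1)) (Y b) (X (nb \<alpha>))"
    unfolding qc_def YX by simp
qed

lemma qc_Y_Q_minus_1:
  assumes "b $ \<alpha> = 0"
  shows "qc (- 2 * ll b (axis \<alpha> 1)) (Y b) (Q \<alpha> (- 1))"
proof -
  have "qc 0 (Y b) (Y (- axis \<alpha> 1))" by (simp add: qc_0 Y_mult_Y add.commute)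
  from qc_mult_right[OF this qc_Y_P[OF assms]] show ?thesis
    unfolding Q_minus_1 by (intro qc_smul) simp
qed

lemma qc_Q_minus_1: "qc 0 (Q \<alpha> (- 1)) (Q \<beta> (- 1))"
proof (cases "\<alpha> = \<beta>")
  case False
  have "qc (- 2 * ll (- axis \<beta> 1) (axis \<alpha> 1)) (Y (- axis \<beta> 1)) (P \<alpha>)"
    using False by (intro qc_Y_P) (simp add: axis_def)
  from qc_mult_right[OF qc_sym[OF this], of 0 "P \<beta>"] hom_0_commute[OF hom_P hom_P, of \<alpha> \<beta>]
  have "qc (2 * ll (- axis \<beta> 1) (axis \<alpha> 1)) (P \<alpha>) (Q \<beta> (- 1))"
    unfolding Q_minus_1 by (intro qc_smul) (simp add: qc_0)
  moreover have "qc (- 2 * ll (- axis \<alpha> 1) (axis \<beta> 1)) (Y (- axis \<alpha> 1)) (Q \<beta> (- 1))"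
    using False by (intro qc_Y_Q_minus_1) (simp add: axis_def)
  ultimately have "qc 0 (Y (- axis \<alpha> 1) * P \<alpha>) (Q \<beta> (- 1))"
    using qc_mult_left by (fastforce simp: ll_minus_left ll_axis lam_sym[of \<alpha>])
  then have "qc 0 (Q \<beta> (- 1)) (Q \<alpha> (- 1))"
    using qc_sym unfolding Q_minus_1[of \<alpha>] by (intro qc_smul) fastforce
  then show ?thesis by (simp add: qc_0)
qed (simp add: qc_0)

abbreviation Z :: "'n intvec \<Rightarrow> 'a" where
  "Z \<equiv> Mn (- 1)"

lemma Z_add: "(\<And>j. 0 \<le> b $ j) \<Longrightarrow> (\<And>j. 0 \<le> c $ j) \<Longrightarrow> Z (b + c) = Z b * Z c"
  using qc_Q_minus_1 by (intro Mn_add) (simp add: qc_0)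

lemma Z_nonzero: "Z b \<noteq> 0"
  unfolding Mn_def by (intro oprod_nonzero power_nonzero Q_minus_1_nonzero)

lemma Z_induct [consumes 1, case_names zero add]:
  fixes b :: "'n intvec"
  assumes "\<And>j. 0 \<le> b $ j" "R 0"
    "\<And>b \<alpha>. (\<And>j. 0 \<le> b $ j) \<Longrightarrow> R b \<Longrightarrow> R (b + axis \<alpha> 1)"
  shows "R b"
  using assms(1)
proof (induction "nat (\<Sum>\<beta>\<in>UNIV. b $ \<beta>)" arbitrary: b rule: less_induct)
  case less
  show ?case
  proof (cases "b = 0")
    case False
    then obtain \<alpha> where "b $ \<alpha> \<noteq> 0" by (auto simp: vec_eq_iff)
    then have pos: "1 \<le> b $ \<alpha>" using less(2)[of \<alpha>] by simp
    define c where "c = b - axis \<alpha> 1"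
    have c: "0 \<le> c $ \<beta>" for \<beta> using less(2)[of \<beta>] pos by (simp add: c_def axis_def)
    have "(\<Sum>\<beta>\<in>UNIV. c $ \<beta>) = (\<Sum>\<beta>\<in>UNIV. b $ \<beta>) - 1"
      using sum_axis_left[of \<alpha> "\<lambda>_. 1 :: int"] by (simp add: c_def sum_subtractf)
    moreover have "0 \<le> (\<Sum>\<beta>\<in>UNIV. c $ \<beta>)" by (intro sum_nonneg c)
    ultimately have "R c" using less(1)[of c] c by simp
    then have "R (c + axis \<alpha> 1)" using assms(3) c by blast
    then show ?thesis by (simp add: c_def)
  qed (simp add: assms(2))
qed

lemma axis_nonneg: "0 \<le> (axis \<alpha> 1 :: 'n intvec) $ \<beta>"
  by (simp add: axis_def)

lemma hom_Z: "(\<And>j. 0 \<le> b $ j) \<Longrightarrow> hom (- b) (Z b)"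
proof (induction rule: Z_induct)
  case zero
  show ?case by (simp add: hom_1)
next
  case (add b \<alpha>)
  then show ?case using hom_mult[OF add(2) hom_Q_minus_1, of \<alpha>]
    by (simp add: Z_add axis_nonneg Mn_axis)
qed

lemma qc_Z_X: "(\<And>j. 0 \<le> b $ j) \<Longrightarrow> qc (ll b a) (Z b) (X a)"
proof (induction rule: Z_induct)
  case zero
  show ?case by (simp add: qc_def)
next
  case (add b \<alpha>)
  have "qc 0 (X a) (P \<alpha>)" using hom_0_commute[OF hom_X hom_P] by (simp add: qc_0)
  moreover have "qc (- ll (- axis \<alpha> 1) a) (Y (- axis \<alpha> 1)) (X a)" by (simp add: qc_def YX)
  ultimately have "qc (ll (axis \<alpha> 1) a) (Y (- axis \<alpha> 1) * P \<alpha>) (X a)"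
    using qc_mult_left[of _ _ "X a" 0 "P \<alpha>"] by (fastforce simp: ll_minus_left qc_0)
  then have "qc (ll (axis \<alpha> 1) a) (Q \<alpha> (- 1)) (X a)"
    using qc_smul qc_sym unfolding Q_minus_1 by (metis minus_minus)
  from qc_mult_left[OF add(2) this] show ?case
    using add(1) by (simp add: Z_add axis_nonneg Mn_axis ll_add_left)
qed

text \<open>Disjoint supports matter: \<open>Y b\<close> with \<open>b $ \<alpha> \<noteq> 0\<close>
  acquires different powers of \<open>t\<close> from the two monomials of
  \<open>P \<alpha>\<close>.\<close>

lemma qc_Y_Z:
  assumes "\<And>j. 0 \<le> c $ j" "\<And>\<beta>. b $ \<beta> = 0 \<or> c $ \<beta> = 0"
  shows "\<exists>k. qc k (Y b) (Z c)"
  using assms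
proof (induction rule: Z_induct)
  case zero
  show ?case by (intro exI[of _ 0]) simp
next
  case (add c \<alpha>)
  have "b $ \<alpha> = 0" using add(1)[of \<alpha>] add(3)[of \<alpha>] by (auto simp: axis_def)
  moreover have "b $ \<beta> = 0 \<or> c $ \<beta> = 0" for \<beta>
    using add(1)[of \<beta>] add(3)[of \<beta>] by (auto simp: axis_def split: if_splits)
  ultimately show ?case
    using add qc_mult_right[OF _ qc_Y_Q_minus_1] by (fastforce simp: Z_add axis_nonneg Mn_axis)
qed

subsection \<open>The lowest terms up to the Coxeter number\<close>

text \<open>The lowest height comes first. Ties are broken by the pairing of the exponents of the
  \<open>Q \<beta> 0\<close> with \<open>axis \<gamma> 1\<close>, in a direction set by
  \<open>\<epsilon>\<close>; both directions are needed at the Coxeter number.\<close>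

definition low_cone :: "int \<Rightarrow> 'n \<Rightarrow> 'n intvec \<times> 'n intvec \<Rightarrow> bool" where
  "low_cone \<epsilon> \<gamma> i \<longleftrightarrow> 0 < ht (snd i) \<or> ht (snd i) = 0 \<and> 0 < \<epsilon> * ll (axis \<gamma> 1) (fst i)"

lemma cone_low: "cone (low_cone \<epsilon> \<gamma>)"
  by (auto simp: cone_def low_cone_def ht_add ll_add_right distrib_left)

text \<open>The exponents of the \<open>Q \<beta> 0\<close> in the lowest term: the Chebyshev
  vectors shifted by one more and negated. The value at 0 continues the recurrence backwards, where
  the vector of index -1 is \<open>- axis \<alpha> 1\<close>.\<close>

definition ycheb :: "'n \<Rightarrow> nat \<Rightarrow> 'n intvec" where
  "ycheb \<alpha> n = (case n of 0 \<Rightarrow> axis \<alpha> 1 | Suc k \<Rightarrow> - cheb \<alpha> k)"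

lemma mix_uminus: "mix m (\<lambda>\<beta>. - v \<beta>) = - mix m v"
  by (simp add: mix_def vec_eq_iff sum_negf)

lemma mix_cheb: "mix (nb \<alpha>) (\<lambda>\<beta>. cheb \<beta> n) = adj (cheb \<alpha> n)"
  by (simp add: mix_def adj_cheb)

lemma mix_ycheb: "mix (nb \<alpha>) (\<lambda>\<beta>. ycheb \<beta> (Suc n)) = - adj (cheb \<alpha> n)"
  by (simp add: ycheb_def mix_uminus mix_cheb)

lemma ycheb_step: "ycheb \<alpha> (Suc (Suc n)) = - adj (cheb \<alpha> n) - ycheb \<alpha> n"
  by (cases n) (simp_all add: ycheb_def)

text \<open>At the bottom the product dominates: the exponent \<open>2 *s v - adj v\<close> of the
  square relative to it has positive height as long as \<open>v = cheb \<alpha> (n - 1)\<close> is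
  positive. The exponents then follow the Chebyshev recurrence.\<close>

lemma LF_low:
  assumes h: "\<And>\<alpha> n. 1 \<le> n \<Longrightarrow> n < h \<Longrightarrow> cheb_pos \<alpha> n"
  shows "n \<le> h \<Longrightarrow> LF (low_cone \<epsilon> \<gamma>) (ycheb \<alpha> n, cheb \<alpha> n) (Q \<alpha> (int n))"
proof (induction n arbitrary: \<alpha> rule: less_induct)
  case (less n)
  consider "n = 0" | "n = 1" | k where "n = Suc (Suc k)"
    by (metis One_nat_def not0_implies_Suc)
  then show ?case
  proof cases
    case 1
    then show ?thesis using LF_X[of _ "axis \<alpha> 1"] by (simp add: ycheb_def X_axis)
  next
    case 2
    then show ?thesis using LF_Y[of _ "axis \<alpha> 1"] by (simp add: ycheb_def Y_axis)
  next
    case (3 k)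
    let ?v = "cheb \<alpha> (Suc k)"
    have "cheb_pos \<alpha> (Suc k)" using h 3 less(2) by simp
    then have nn: "\<And>\<beta>. 0 \<le> ?v $ \<beta>" and "?v \<noteq> 0" by (auto simp: cheb_pos_def)
    then obtain \<beta> where "?v $ \<beta> \<noteq> 0" by (auto simp: vec_eq_iff)
    then have "0 < ?v $ \<beta>" using nn[of \<beta>] by simp
    also have "?v $ \<beta> \<le> (\<Sum>\<gamma>\<in>UNIV. ?v $ \<gamma>)" by (rule member_le_sum) (auto simp: nn)
    finally have "0 < \<bar>det C\<bar> * (\<Sum>\<gamma>\<in>UNIV. ?v $ \<gamma>)"
      using det_nonzero by simp
    then have pos: "0 < ht (2 *s ?v - adj ?v)" by (simp add: ht_diff ht_scale ht_adj)
    have "LF (low_cone \<epsilon> \<gamma>) ((mix (nb \<alpha>) (\<lambda>\<beta>. ycheb \<beta> (Suc k)), mix (nb \<alpha>) (\<lambda>\<beta>. cheb \<beta> (Suc k))) -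
        (ycheb \<alpha> k, cheb \<alpha> k)) (Q \<alpha> (int (Suc k) + 1))"
    proof (rule LF_rec(2)[OF cone_low])
      show "LF (low_cone \<epsilon> \<gamma>) (ycheb \<beta> (Suc k), cheb \<beta> (Suc k)) (Q \<beta> (int (Suc k)))" for \<beta>
        using less(1)[of "Suc k" \<beta>] less(2) 3 by simp
      show "LF (low_cone \<epsilon> \<gamma>) (ycheb \<alpha> k, cheb \<alpha> k) (Q \<alpha> (int (Suc k) - 1))"
        using less(1)[of k \<alpha>] less(2) 3 by simp
    qed (simp add: low_cone_def mix_cheb pos)
    then show ?thesis
      by (simp add: 3 mix_cheb mix_ycheb ycheb_step add.commute)
  qed
qed

text \<open>At the Coxeter number the two monomials of the recursion have the same degree in the second set
  of generators.  The two cones single out either of them; the same holds for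
  \<open>Q \<gamma> (-1)\<close>, and comparison shows that the quotient is a monomial.\<close>

lemma lowering_operator:
  "\<exists>\<alpha> c a m. c \<noteq> 0 \<and> 1 \<le> m \<and> comp (- axis \<gamma> 1) (Q \<alpha> m) = smul c (X a * Q \<gamma> (- 1))"
  if divides: "\<And>\<alpha> m. 1 \<le> m \<Longrightarrow> \<exists>f. hom 0 f \<and> comp (- axis \<gamma> 1) (Q \<alpha> m) = f * Q \<gamma> (- 1)"
proof -
  obtain h where h: "2 \<le> h" "\<And>\<alpha> n. 1 \<le> n \<Longrightarrow> n < h \<Longrightarrow> cheb_pos \<alpha> n" "\<And>\<alpha>. cheb \<alpha> h = 0"
    "\<And>\<gamma>. \<exists>\<alpha>. cheb \<alpha> (h - 1) = axis \<gamma> 1"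
    using coxeter by blast
  obtain \<alpha> where \<alpha>: "cheb \<alpha> (h - 1) = axis \<gamma> 1" using h(4) by blast
  obtain k where k: "h = Suc k" "1 \<le> k" using h(1) by (cases h) auto
  define y where "y = ycheb \<alpha> k"
  define \<epsilon> where "\<epsilon> = sgn (det C)"
  have \<epsilon>: "\<epsilon> * det C = \<bar>det C\<bar>" "0 < \<bar>det C\<bar>"
    using det_nonzero by (simp add: \<epsilon>_def abs_sgn mult.commute) (use det_nonzero in simp)
  have row: "ll (axis \<gamma> 1) (C $ \<gamma>) = det C"
    using ll_row[of \<gamma> "axis \<gamma> 1"] by (simp add: ll_sym axis_def)
  have yh: "ycheb \<alpha> h = - axis \<gamma> 1" using k \<alpha> by (simp add: ycheb_def)
  have mixy: "mix (nb \<alpha>) (\<lambda>\<beta>. ycheb \<beta> h) = - nb \<gamma>"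
    using \<alpha> by (simp add: k mix_ycheb adj_axis)
  have mixc: "mix (nb \<alpha>) (\<lambda>\<beta>. cheb \<beta> h) = 0" by (simp add: h(3))
  have Qh: "LF (low_cone \<delta> \<gamma>) (ycheb \<beta> h, cheb \<beta> h) (Q \<beta> (int h))" for \<beta> \<delta>
    using LF_low[OF h(2)] by simp
  have Qk: "LF (low_cone \<delta> \<gamma>) (y, axis \<gamma> 1) (Q \<alpha> (int h - 1))" for \<delta>
    using LF_low[OF h(2), where n = k and \<epsilon> = \<delta> and \<gamma> = \<gamma> and \<alpha> = \<alpha>] k \<alpha> by (simp add: y_def)
  let ?x = "Q \<alpha> (int h + 1)"
  have row': "axis \<gamma> 2 - nb \<gamma> = C $ \<gamma>" "nb \<gamma> - axis \<gamma> 2 = - (C $ \<gamma>)"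
    by (simp_all add: nb_def)
  \<comment> \<open>With this tie-breaker the square is the lower term of the recursion; with the
    opposite one, in \<open>low2\<close>, the product is. Their relative exponent is row
    \<open>\<gamma>\<close> of \<open>C\<close>.\<close>
  have low1: "LF (low_cone \<epsilon> \<gamma>) (- axis \<gamma> 2 - y, - axis \<gamma> 1) ?x"
    using LF_rec(1)[OF cone_low Qh Qk, of \<epsilon>] \<epsilon>
    by (simp add: yh mixy mixc h(3) row row' low_cone_def scale_axis(1))
  have low2: "LF (low_cone (- \<epsilon>) \<gamma>) (- nb \<gamma> - y, - axis \<gamma> 1) ?x"
    using LF_rec(2)[OF cone_low Qh Qk, of "- \<epsilon>"] \<epsilon>
    by (simp add: yh mixy mixc h(3) row row' low_cone_def ll_minus_right scale_axis(1))
  have LF_comp: "LF P i (comp b x)" if "LF P i x" "snd i = b" for P i b x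
    using that by (auto simp: LF_def in_supp split: if_splits)
  obtain f where f: "hom 0 f" "comp (- axis \<gamma> 1) ?x = f * Q \<gamma> (- 1)"
    using divides[of "int h + 1" \<alpha>] by auto
  have z1: "LF (low_cone \<epsilon> \<gamma>) (nb \<gamma>, - axis \<gamma> 1) (Q \<gamma> (- 1))"
  proof -
    have "LF (low_cone \<epsilon> \<gamma>) (nb \<gamma>, 0) (- (X (nb \<gamma>) - X (axis \<gamma> 2)))"
      using \<epsilon> by (intro LF_uminus LF_diff[OF cone_low LF_X LF_X]) (simp add: low_cone_def row' row)
    from LF_mult[OF cone_low LF_Y this, of "- axis \<gamma> 1"] show ?thesis
      unfolding Q_minus_1 P_def by (simp add: LF_smul_iff)
  qed
  have z2: "LF (low_cone (- \<epsilon>) \<gamma>) (axis \<gamma> 2, - axis \<gamma> 1) (Q \<gamma> (- 1))"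
  proof -
    have "LF (low_cone (- \<epsilon>) \<gamma>) (axis \<gamma> 2, 0) (X (axis \<gamma> 2) - X (nb \<gamma>))"
      using \<epsilon> by (intro LF_diff[OF cone_low LF_X LF_X]) (simp add: low_cone_def row' row ll_minus_right)
    from LF_mult[OF cone_low LF_Y this, of "- axis \<gamma> 1"] show ?thesis
      unfolding Q_minus_1 P_def by (simp add: LF_smul_iff)
  qed
  \<comment> \<open>Dividing \<open>low1\<close> by \<open>z1\<close> and \<open>low2\<close> by
    \<open>z2\<close> produces this same exponent.\<close>
  define a where "a = - axis \<gamma> 2 - y - nb \<gamma>"
  have f1: "LF (low_cone \<epsilon> \<gamma>) (a, 0) f"
    using LF_div[OF cone_low LF_comp[OF low1, unfolded snd_conv, OF refl, unfolded f(2)] z1]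
    by (simp add: a_def)
  have f2: "LF (low_cone (- \<epsilon>) \<gamma>) (a, 0) f"
    using LF_div[OF cone_low LF_comp[OF low2, unfolded snd_conv, OF refl, unfolded f(2)] z2]
    by (simp add: a_def diff_diff_eq add.commute minus_diff_commute)
  \<comment> \<open>Any other exponent of \<open>f\<close> would lie strictly above \<open>a\<close>
    for both directions of the tie-breaker, which is impossible in degree zero.\<close>
  have "k = (a, 0)" if "k \<in> supp f" for k
  proof (rule ccontr)
    assume "k \<noteq> (a, 0)"
    then have "low_cone \<epsilon> \<gamma> (k - (a, 0))" "low_cone (- \<epsilon>) \<gamma> (k - (a, 0))"
      using f1 f2 that by (auto simp: LF_def)
    moreover have "snd k = 0" using f(1) that by (auto simp: hom_def)
    ultimately show False by (simp add: low_cone_def)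
  qed
  then have "cf f i = 0" if "i \<noteq> (a, 0)" for i using that unfolding in_supp by blast
  then have "cf f i = cf (smul (cf f (a, 0)) (X a)) i" for i
    by (cases "i = (a, 0)") (simp_all add: X_eq_E cf_E)
  then have "f = smul (cf f (a, 0)) (X a)" by (rule cf_ext)
  moreover have "cf f (a, 0) \<noteq> 0" using f1 by (simp add: LF_def)
  ultimately have "comp (- axis \<gamma> 1) ?x = smul (cf f (a, 0)) (X a * Q \<gamma> (- 1))"
    using f(2) by (metis smul_mult_left)
  then show ?thesis using \<open>cf f (a, 0) \<noteq> 0\<close> by (intro exI[of _ \<alpha>] exI[of _ "cf f (a, 0)"] exI[of _ a] exI[of _ "int h + 1"]) simp
qed

section \<open>The reflection \<open>n \<mapsto> -n\<close>\<close>

text \<open>The anti-homomorphism that fixes \<open>Q \<alpha> 0\<close> and sends \<open>Q \<alpha> 1\<close> to \<open>Q \<alpha> (-1)\<close> is multiplicative only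
  on the subalgebra \<open>inB\<close>, where the \<open>Q \<alpha> 1\<close> are not inverted.\<close>

definition sg :: "'a \<Rightarrow> 'a" where
  "sg = lin (\<lambda>i. Z (snd i) * X (fst i))"

definition inB :: "'a \<Rightarrow> bool" where
  "inB x \<longleftrightarrow> (\<forall>i\<in>supp x. \<forall>\<beta>. 0 \<le> snd i $ \<beta>)"

lemma sg_add: "sg (x + y) = sg x + sg y" and sg_smul: "sg (smul c x) = smul c (sg x)"
  and sg_sum: "sg (sum f A) = (\<Sum>x\<in>A. sg (f x))" and sg_diff: "sg (x - y) = sg x - sg y"
  by (simp_all add: sg_def)

lemma sg_E: "sg (E i) = Z (snd i) * X (fst i)"
  by (simp add: sg_def)

lemma sg_expand: "sg x = (\<Sum>i\<in>supp x. smul (cf x i) (sg (E i)))"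
  unfolding sg_E by (simp add: sg_def lin_def)

lemma X_Z: "(\<And>j. 0 \<le> b $ j) \<Longrightarrow> X a * Z b = smul (tpow (- ll b a)) (Z b * X a)"
  using qc_sym[OF qc_Z_X[of b a]] by (simp add: qc_def)

lemma sg_E_mult:
  assumes i: "\<And>j. 0 \<le> snd i $ j" and j: "\<And>\<beta>. 0 \<le> snd j $ \<beta>"
  shows "sg (E i * E j) = sg (E j) * sg (E i)"
proof -
  have "sg (E j) * sg (E i) = Z (snd j) * (X (fst j) * Z (snd i)) * X (fst i)"
    by (simp add: sg_E mult.assoc)
  also have "\<dots> = smul (tpow (tw i j)) (Z (snd j) * Z (snd i) * (X (fst j) * X (fst i)))"
    unfolding X_Z[OF i] tw_def by (simp add: smul_mult_left smul_mult_right mult.assoc)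
  also have "\<dots> = smul (tpow (tw i j)) (sg (E (i + j)))"
    by (simp add: sg_E Z_add[symmetric] i j X_mult_X add.commute)
  also have "\<dots> = sg (E i * E j)" by (simp add: E_mult sg_smul)
  finally show ?thesis ..
qed

lemma sg_mult:
  assumes x: "inB x" and y: "inB y"
  shows "sg (x * y) = sg y * sg x"
proof -
  have exp: "x * y = (\<Sum>i\<in>supp x. \<Sum>j\<in>supp y. smul (cf x i * cf y j) (E i * E j))"
  proof -
    have "x * y = (\<Sum>i\<in>supp x. smul (cf x i) (E i)) * (\<Sum>j\<in>supp y. smul (cf y j) (E j))"
      by (rule arg_cong2[OF expand expand])
    then show ?thesis by (simp only: sum_product smul_mult_smul)
  qed
  have "sg (x * y) = (\<Sum>i\<in>supp x. \<Sum>j\<in>supp y. smul (cf x i * cf y j) (sg (E j) * sg (E i)))"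
    unfolding exp sg_sum sg_smul
    using x y by (intro sum.cong refl arg_cong[where f = "smul _"] sg_E_mult) (auto simp: inB_def)
  also have "\<dots> = (\<Sum>j\<in>supp y. \<Sum>i\<in>supp x. smul (cf y j) (sg (E j)) * smul (cf x i) (sg (E i)))"
    by (subst sum.swap) (simp only: smul_mult_smul mult.commute)
  also have "\<dots> = sg y * sg x"
    unfolding sum_product[symmetric] sg_expand[symmetric] ..
  finally show ?thesis .
qed

lemma inB_mult: "inB x \<Longrightarrow> inB y \<Longrightarrow> inB (x * y)"
  unfolding inB_def using supp_mult by fastforce

lemma supp_X: "supp (X a) = {(a, 0)}" and supp_Y: "supp (Y b) = {(0, b)}"
  by (auto simp: in_supp X_eq_E Y_eq_E cf_E split: if_splits)

lemma inB_X: "inB (X a)" and inB_Y: "(\<And>j. 0 \<le> b $ j) \<Longrightarrow> inB (Y b)"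
  by (simp_all add: inB_def supp_X supp_Y)

lemma sg_X: "sg (X a) = X a" and sg_Y: "sg (Y b) = Z b"
  by (simp_all add: X_eq_E Y_eq_E sg_E) (simp add: E_def)

lemma inB_add: "inB x \<Longrightarrow> inB y \<Longrightarrow> inB (x + y)"
  and inB_diff: "inB x \<Longrightarrow> inB y \<Longrightarrow> inB (x - y)"
  and inB_smul: "inB x \<Longrightarrow> inB (smul c x)"
proof -
  have iff: "inB x \<longleftrightarrow> (\<forall>i. \<not> (\<forall>\<beta>. 0 \<le> snd i $ \<beta>) \<longrightarrow> cf x i = 0)" for x
    unfolding inB_def supp_def by blast
  show "inB x \<Longrightarrow> inB y \<Longrightarrow> inB (x + y)" "inB x \<Longrightarrow> inB y \<Longrightarrow> inB (x - y)"
    "inB x \<Longrightarrow> inB (smul c x)"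
    unfolding iff by simp_all
qed

section \<open>Clearing denominators: the reflection as a relation\<close>

lemma inB_shift: "\<exists>v. (\<forall>\<beta>. 0 \<le> v $ \<beta>) \<and> inB (x * Y v)"
proof -
  define v where "v = (\<chi> \<beta>. \<Sum>i\<in>supp x. \<bar>snd i $ \<beta>\<bar>)"
  have "inB (x * Y v)" unfolding inB_def
  proof (intro ballI allI)
    fix k \<beta> assume "k \<in> supp (x * Y v)"
    from supp_mult[OF this] obtain i where i: "i \<in> supp x" "k = i + (0, v)"
      unfolding supp_Y by blast
    have "\<bar>snd i $ \<beta>\<bar> \<le> (\<Sum>i\<in>supp x. \<bar>snd i $ \<beta>\<bar>)"
      using i(1) by (intro member_le_sum) auto
    then have "\<bar>snd i $ \<beta>\<bar> \<le> v $ \<beta>" by (simp add: v_def)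
    then show "0 \<le> snd k $ \<beta>" using i(2) by simp
  qed
  moreover have "0 \<le> v $ \<beta>" for \<beta> by (simp add: v_def sum_nonneg)
  ultimately show ?thesis by blast
qed

lemma inB_conj: "inB u \<Longrightarrow> inB (Y (- v) * u * Y v)"
proof -
  assume u: "inB u"
  show ?thesis unfolding inB_def
  proof (intro ballI allI)
    fix k \<beta> assume "k \<in> supp (Y (- v) * u * Y v)"
    then obtain j l where jl: "j \<in> supp (Y (- v) * u)" "l \<in> supp (Y v)" "k = j + l"
      using supp_mult by blast
    then obtain i' i where i: "i' \<in> supp (Y (- v))" "i \<in> supp u" "j = i' + i"
      using supp_mult[OF jl(1)] by blast
    then have "i \<in> supp u" "k = (0, - v) + i + (0, v)" using jl by (simp_all add: supp_Y)
    then show "0 \<le> snd k $ \<beta>" using u by (simp add: inB_def)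
  qed
qed

text \<open>Formally \<open>sg\<close> turns conjugation by \<open>Y v\<close> into conjugation by
  \<open>Z v\<close>; the inverse of \<open>Z v\<close> does not exist and is multiplied
  away.\<close>

lemma sg_conj:
  assumes "inB u" "\<And>j. 0 \<le> v $ j"
  shows "sg (Y (- v) * u * Y v) * Z v = Z v * sg u"
proof -
  have "sg (Y v * (Y (- v) * u * Y v)) = sg (Y (- v) * u * Y v) * Z v"
    using assms by (simp only: sg_mult inB_Y inB_conj sg_Y)
  moreover have "Y v * (Y (- v) * u * Y v) = u * Y v" by (simp add: mult.assoc)
  ultimately show ?thesis using assms by (simp add: sg_mult inB_Y sg_Y)
qed

text \<open>Formally \<open>y\<close> is the reflection of \<open>x\<close>: the denominators of
  \<open>x\<close> are collected in \<open>Y v\<close> on the right, which the anti-homomorphism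
  sends to \<open>Z v\<close> on the left. The relation asserts that the quotient by
  \<open>Z v\<close> exists in the torus.\<close>

definition refl_rel_at :: "'n intvec \<Rightarrow> 'a \<Rightarrow> 'a \<Rightarrow> bool" where
  "refl_rel_at v x y \<longleftrightarrow> (\<forall>\<beta>. 0 \<le> v $ \<beta>) \<and> inB (x * Y v) \<and> sg (x * Y v) = Z v * y"

definition refl_rel :: "'a \<Rightarrow> 'a \<Rightarrow> bool" where
  "refl_rel x y \<longleftrightarrow> (\<exists>v. refl_rel_at v x y)"

lemma refl_rel_at_mono:
  assumes "refl_rel_at v x y" "\<And>j. 0 \<le> u $ j"
  shows "refl_rel_at (v + u) x y"
proof -
  have v: "\<And>j. 0 \<le> v $ j" "inB (x * Y v)" "sg (x * Y v) = Z v * y"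
    using assms(1) by (auto simp: refl_rel_at_def)
  have eq: "x * Y (v + u) = x * Y v * Y u" by (simp add: Y_add mult.assoc)
  have "sg (x * Y v * Y u) = Z u * (Z v * y)"
    using v assms(2) by (simp add: sg_mult inB_Y sg_Y)
  moreover have "Z (v + u) = Z u * Z v"
    using Z_add[of u v] v(1) assms(2) by (simp add: add.commute)
  moreover have "inB (x * Y v * Y u)" using inB_mult[OF v(2) inB_Y[of u]] assms(2) by simp
  ultimately show ?thesis
    unfolding refl_rel_at_def eq using v assms(2) by (simp add: mult.assoc)
qed

lemma refl_rel_common:
  assumes "refl_rel x y" "refl_rel x' y'"
  shows "\<exists>v. refl_rel_at v x y \<and> refl_rel_at v x' y'"
proof -
  obtain v v' where v: "refl_rel_at v x y" "refl_rel_at v' x' y'" using assms by (auto simp: refl_rel_def)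
  then have "\<And>j. 0 \<le> v $ j" "\<And>j. 0 \<le> v' $ j" by (auto simp: refl_rel_at_def)
  then have "refl_rel_at (v + v') x y" "refl_rel_at (v' + v) x' y'"
    using v by (intro refl_rel_at_mono; simp)+
  then show ?thesis by (metis add.commute)
qed

lemma refl_rel_add: "refl_rel x y \<Longrightarrow> refl_rel x' y' \<Longrightarrow> refl_rel (x + x') (y + y')"
  using refl_rel_common[of x y x' y'] unfolding refl_rel_def refl_rel_at_def
  by (auto simp: distrib_left distrib_right sg_add inB_add)

lemma refl_rel_diff: "refl_rel x y \<Longrightarrow> refl_rel x' y' \<Longrightarrow> refl_rel (x - x') (y - y')"
  using refl_rel_common[of x y x' y'] unfolding refl_rel_def refl_rel_at_def
  by (auto simp: left_diff_distrib right_diff_distrib sg_diff inB_diff)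

lemma refl_rel_smul: "refl_rel x y \<Longrightarrow> refl_rel (smul c x) (smul c y)"
  unfolding refl_rel_def refl_rel_at_def
  by (auto simp: smul_mult_left smul_mult_right sg_smul inB_smul)

lemma refl_rel_X: "refl_rel (X a) (X a)"
  unfolding refl_rel_def refl_rel_at_def by (intro exI[of _ 0]) (simp add: inB_X sg_X)

lemma refl_rel_Y: "(\<And>j. 0 \<le> b $ j) \<Longrightarrow> refl_rel (Y b) (Z b)"
  unfolding refl_rel_def refl_rel_at_def by (intro exI[of _ 0]) (simp add: inB_Y sg_Y)

lemma refl_rel_1: "refl_rel 1 1"
  using refl_rel_X[of 0] by simp

text \<open>The denominator \<open>Y v\<close> of the left factor is moved past \<open>x2\<close> by
  conjugation. Conjugation preserves nonnegative exponents, so \<open>sg\<close> remains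
  multiplicative on the pieces.\<close>

lemma refl_mult_aux:
  assumes v2: "refl_rel_at v2 x2 y2" and v: "\<And>j. 0 \<le> v $ j" "inB (x * Y v)"
  defines "s \<equiv> sg (Y (- v) * (x2 * Y v2) * Y v)"
  shows "inB (x * x2 * Y (v2 + v))" "sg (x * x2 * Y (v2 + v)) = s * sg (x * Y v)"
    "s * Z v = Z (v2 + v) * y2"
proof -
  let ?u = "x2 * Y v2"
  have u: "inB ?u" "sg ?u = Z v2 * y2" "\<And>j. 0 \<le> v2 $ j" using v2 by (auto simp: refl_rel_at_def)
  have eq: "x * x2 * Y (v2 + v) = (x * Y v) * (Y (- v) * ?u * Y v)"
    by (simp add: Y_add mult.assoc)
  show "inB (x * x2 * Y (v2 + v))" unfolding eq by (intro inB_mult v inB_conj u)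
  show "sg (x * x2 * Y (v2 + v)) = s * sg (x * Y v)"
    unfolding eq s_def by (intro sg_mult v inB_conj u)
  show "s * Z v = Z (v2 + v) * y2"
    unfolding s_def sg_conj[OF u(1) v(1)] u(2) using Z_add[of v v2] v(1) u(3)
    by (simp add: mult.assoc add.commute)
qed

lemma refl_rel_mult:
  assumes "refl_rel x y" "refl_rel x2 y2"
  shows "refl_rel (x * x2) (y2 * y)"
proof -
  obtain v v2 where v: "refl_rel_at v x y" and v2: "refl_rel_at v2 x2 y2"
    using assms by (auto simp: refl_rel_def)
  then have v': "\<And>j. 0 \<le> v $ j" "inB (x * Y v)" "sg (x * Y v) = Z v * y" "\<And>j. 0 \<le> v2 $ j"
    by (auto simp: refl_rel_at_def)
  note aux = refl_mult_aux[OF v2 v'(1,2)]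
  have "sg (x * x2 * Y (v2 + v)) = sg (Y (- v) * (x2 * Y v2) * Y v) * Z v * y"
    unfolding aux(2) v'(3) by (simp only: mult.assoc)
  also have "\<dots> = Z (v2 + v) * (y2 * y)"
    unfolding aux(3) by (simp only: mult.assoc)
  finally show ?thesis unfolding refl_rel_def refl_rel_at_def using aux(1) v'(1,4)
    by (intro exI[of _ "v2 + v"]) simp
qed

text \<open>Required because the recursion gives the next variable only through its product with an
  earlier one.\<close>

lemma refl_rel_div:
  assumes xx: "refl_rel (x * x2) (y2 * y)" and x2: "refl_rel x2 y2" and nz: "y2 \<noteq> 0"
  shows "refl_rel x y"
proof -
  obtain w v2 where w: "refl_rel_at w (x * x2) (y2 * y)" and v2: "refl_rel_at v2 x2 y2"
    using xx x2 by (auto simp: refl_rel_def)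
  obtain v0 where v0: "\<And>j. 0 \<le> v0 $ j" "inB (x * Y v0)" using inB_shift by blast
  have nn: "\<And>j. 0 \<le> w $ j" "\<And>j. 0 \<le> v2 $ j" using w v2 by (auto simp: refl_rel_at_def)
  define v where "v = v0 + w"
  have v: "\<And>j. 0 \<le> v $ j" "inB (x * Y v)"
    using v0 nn inB_mult[OF v0(2) inB_Y[of w]] by (simp_all add: v_def Y_add mult.assoc)
  note aux = refl_mult_aux[OF v2 v]
  define s where "s = sg (Y (- v) * (x2 * Y v2) * Y v)"
  have "refl_rel_at (w + (v2 + v0)) (x * x2) (y2 * y)"
    using v0(1) nn by (intro refl_rel_at_mono[OF w]) simp
  moreover have "w + (v2 + v0) = v2 + v" by (simp add: v_def add_ac)
  ultimately have "s * sg (x * Y v) = Z (v2 + v) * y2 * y"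
    using aux(2) by (simp add: refl_rel_at_def s_def mult.assoc)
  also have "\<dots> = s * (Z v * y)" using aux(3) by (simp add: s_def mult.assoc[symmetric])
  finally have eq: "s * sg (x * Y v) = s * (Z v * y)" .
  have "s * Z v \<noteq> 0" using aux(3) nz by (simp add: s_def mult_eq_0_iff' Z_nonzero)
  then have "s \<noteq> 0" by auto
  from cancel_left[OF this eq] show ?thesis
    unfolding refl_rel_def refl_rel_at_def using v by blast
qed

lemma hom_sum: "(\<And>i. i \<in> A \<Longrightarrow> hom b (f i)) \<Longrightarrow> hom b (sum f A)"
  by (induction A rule: infinite_finite_induct) (auto intro: hom_add)

lemma sg_hom_0: "hom 0 x \<Longrightarrow> sg x = x"
  by (induction rule: hom_induct) (simp_all add: sg_add sg_smul sg_X, simp add: sg_def)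

lemma hom_0_inB: "hom 0 x \<Longrightarrow> inB x"
  by (auto simp: hom_def inB_def)

text \<open>\<open>sg\<close> negates degrees, fixes degree zero and reverses products, so the
  coefficient reappears to the right of \<open>Z b\<close>.\<close>

lemma comp_sg:
  assumes u: "inB u" and b: "\<And>j. 0 \<le> b $ j" and r: "hom 0 r" "comp b u = r * Y b"
  shows "comp (- b) (sg u) = Z b * r"
proof -
  have h: "hom (- c) (sg (comp c u))" for c
  proof -
    have "sg (comp c u) = (\<Sum>i\<in>supp (comp c u). smul (cf (comp c u) i) (Z (snd i) * X (fst i)))"
      by (simp add: sg_def lin_def)
    moreover have "hom (- c) (smul (cf (comp c u) i) (Z (snd i) * X (fst i)))" if "i \<in> supp (comp c u)" for i
    proof -
      have i: "snd i = c" "i \<in> supp u" using that by (auto simp: in_supp split: if_splits)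
      then have "0 \<le> c $ \<beta>" for \<beta> using u by (auto simp: inB_def)
      then show ?thesis using hom_mult[OF hom_Z[of c] hom_X[of "fst i"]] i by (auto intro: hom_smul)
    qed
    ultimately show ?thesis by (simp add: hom_sum)
  qed
  have "sg u = (\<Sum>c\<in>insert b (snd ` supp u). sg (comp c u))"
    unfolding sg_sum[symmetric] by (rule arg_cong[where f = sg], rule sum_comp) auto
  then have "comp (- b) (sg u) = (\<Sum>c\<in>insert b (snd ` supp u). comp (- b) (sg (comp c u)))"
    by simp
  also have "\<dots> = (\<Sum>c\<in>insert b (snd ` supp u). if c = b then sg (comp b u) else 0)"
    by (intro sum.cong refl) (use h comp_hom[OF h] in auto)
  also have "\<dots> = sg (comp b u)" by simp
  also have "\<dots> = Z b * r"
    unfolding r(2) using b by (simp add: sg_mult hom_0_inB[OF r(1)] inB_Y sg_Y sg_hom_0[OF r(1)])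
  finally show ?thesis .
qed

lemma hom_factor: "hom b x \<Longrightarrow> hom 0 (x * Y (- b)) \<and> x = x * Y (- b) * Y b"
  using hom_mult[OF _ hom_Y, of b x "- b"] by (simp add: mult.assoc)

text \<open>This gives that the variables of negative index do not vanish, as the division step in
  \<open>refl_rel_Q\<close> demands.\<close>

lemma refl_rel_zero: "refl_rel x 0 \<Longrightarrow> x = 0"
proof -
  assume "refl_rel x 0"
  then obtain v where v: "inB (x * Y v)" "sg (x * Y v) = 0"
    by (auto simp: refl_rel_def refl_rel_at_def)
  have "x * Y v = 0"
  proof (rule ccontr)
    assume "x * Y v \<noteq> 0"
    then obtain i where i: "i \<in> supp (x * Y v)" using supp_nonempty by blast
    let ?b = "snd i"
    let ?r = "comp ?b (x * Y v) * Y (- ?b)"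
    have r: "hom 0 ?r" "comp ?b (x * Y v) = ?r * Y ?b"
      using hom_factor[OF hom_comp] by blast+
    have "\<And>\<beta>. 0 \<le> ?b $ \<beta>" using i v(1) by (auto simp: inB_def)
    from comp_sg[OF v(1) this r] have "Z ?b * ?r = 0" by (simp add: v(2))
    then have "comp ?b (x * Y v) = 0" using r(2) by (simp add: mult_eq_0_iff' Z_nonzero)
    then have "cf (comp ?b (x * Y v)) i = 0" by simp
    then show False using i by (simp add: in_supp)
  qed
  then show ?thesis by (simp add: mult_eq_0_iff')
qed

lemma refl_rel_power: "refl_rel x y \<Longrightarrow> refl_rel (x ^ n) (y ^ n)"
proof (induction n)
  case (Suc n)
  then show ?case using refl_rel_mult[of x y "x ^ n" "y ^ n"] by (simp add: power_commutes)
qed (simp add: refl_rel_1)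

lemma refl_rel_Mn:
  assumes comm: "\<And>\<alpha> \<beta>. Q \<alpha> n * Q \<beta> n = Q \<beta> n * Q \<alpha> n"
    and r: "\<And>\<beta>. refl_rel (Q \<beta> n) (Q \<beta> (- n))"
  shows "refl_rel (Mn n b) (Mn (- n) b)"
proof -
  let ?f = "\<lambda>n \<beta>. Q \<beta> n ^ nat (b $ \<beta>)"
  have pow: "?f n \<alpha> * ?f n \<beta> = ?f n \<beta> * ?f n \<alpha>" for \<alpha> \<beta>
    by (intro powers_commute comm)
  have swap: "prod_list (map (?f n) xs) * ?f n \<alpha> = ?f n \<alpha> * prod_list (map (?f n) xs)" for xs \<alpha>
  proof (induction xs)
    case (Cons a xs)
    have "?f n a * prod_list (map (?f n) xs) * ?f n \<alpha> = ?f n a * ?f n \<alpha> * prod_list (map (?f n) xs)"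
      using Cons by (simp add: mult.assoc)
    then show ?case using pow[of a \<alpha>] by (simp add: mult.assoc)
  qed simp
  have "refl_rel (prod_list (map (?f n) xs)) (prod_list (map (?f (- n)) xs))" for xs
  proof (induction xs)
    case (Cons a xs)
    have "refl_rel (prod_list (map (?f n) xs) * ?f n a) (?f (- n) a * prod_list (map (?f (- n)) xs))"
      by (intro refl_rel_mult Cons refl_rel_power r)
    then show ?case by (simp add: swap)
  qed (simp add: refl_rel_1)
  then show ?thesis by (simp add: Mn_def oprod_def)
qed

text \<open>Reversing products and negating indices turns the recursion at \<open>m\<close> into the
  recursion at \<open>-m\<close>: \<open>Q \<alpha> (m + 1) * Q \<alpha> (m - 1)\<close> goes to
  \<open>Q \<alpha> (- m + 1) * Q \<alpha> (- m - 1)\<close>.\<close>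

lemma refl_rel_Q: "refl_rel (Q \<alpha> (int n)) (Q \<alpha> (- int n))"
proof -
  have nz: "y \<noteq> 0" if "refl_rel (Q \<alpha> (int n)) y" for \<alpha> n y
    using that refl_rel_zero Q_nonzero[of "int n" \<alpha>] by auto
  have "(\<forall>\<alpha>. refl_rel (Q \<alpha> (int n)) (Q \<alpha> (- int n))) \<and>
      (\<forall>\<alpha>. refl_rel (Q \<alpha> (int n + 1)) (Q \<alpha> (- int n - 1)))"
  proof (induction n)
    case 0
    show ?case
      using refl_rel_X[of "axis _ 1"] refl_rel_Y[of "axis _ 1"]
      by (simp add: X_axis Y_axis Mn_axis axis_nonneg)
  next
    case (Suc n)
    define m where "m = int n + 1"
    have 1: "refl_rel (Q \<alpha> (m - 1)) (Q \<alpha> (- m + 1))" and 2: "refl_rel (Q \<alpha> m) (Q \<alpha> (- m))" for \<alpha>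
      using Suc by (auto simp: m_def)
    have "refl_rel (Q \<alpha> (m + 1)) (Q \<alpha> (- m - 1))" for \<alpha>
    proof -
      have "refl_rel (smul (tpow (lam C \<alpha> \<alpha>)) (Q \<alpha> (m + 1) * Q \<alpha> (m - 1)))
          (smul (tpow (lam C \<alpha> \<alpha>)) (Q \<alpha> (- m + 1) * Q \<alpha> (- m - 1)))"
        unfolding rec
        by (intro refl_rel_diff refl_rel_power refl_rel_Mn 2 Q_commute) (simp add: m_def)
      from refl_rel_smul[OF this, of "tpow (- lam C \<alpha> \<alpha>)"]
      have "refl_rel (Q \<alpha> (m + 1) * Q \<alpha> (m - 1)) (Q \<alpha> (- m + 1) * Q \<alpha> (- m - 1))"
        by (simp add: tpow_add[symmetric])
      moreover have "Q \<alpha> (- m + 1) \<noteq> 0" using nz[of \<alpha> n] 1[of \<alpha>] by (simp add: m_def)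
      ultimately show ?thesis using refl_rel_div 1 by blast
    qed
    then show ?case using 2 by (simp add: m_def add.commute)
  qed
  then show ?thesis by blast
qed

text \<open>Only the \<open>Q \<alpha> 0\<close> are inverted among the generators, and these are
  fixed; an inverse of \<open>Q \<alpha> 1\<close> would call for an inverse of
  \<open>Q \<alpha> (-1)\<close>.\<close>

lemma refl_rel_Aplus: "p \<in> Aplus smul Q \<Longrightarrow> \<exists>y. refl_rel p y"
proof (induction rule: Aplus.induct)
  case (Q0 \<alpha>)
  then show ?case using refl_rel_X[of "axis \<alpha> 1"] by (auto simp: X_axis)
next
  case (Q0_inv \<alpha>)
  then show ?case using refl_rel_X[of "- axis \<alpha> 1"] by (auto simp: X_minus_axis)
next
  case (Qm m \<alpha>)
  then show ?case using refl_rel_Q[of \<alpha> "nat m"] by auto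
qed (blast intro: refl_rel_1 refl_rel_smul refl_rel_add refl_rel_mult)+

section \<open>Coprime binomials\<close>

text \<open>The model is \<open>P \<alpha>\<close>. The free parameters make the class stable under
  moving monomials \<open>Y b\<close> and \<open>Z b\<close> across, which changes the two powers of
  \<open>t\<close> independently.\<close>

definition isbin :: "'n \<Rightarrow> 'a \<Rightarrow> bool" where
  "isbin \<alpha> p \<longleftrightarrow> (\<exists>a k l. p = smul (tpow k) (X (a + C $ \<alpha>)) - smul (tpow l) (X a))"

lemma isbin_hom: "isbin \<alpha> p \<Longrightarrow> hom 0 p"
  by (auto simp: isbin_def intro!: hom_diff hom_smul hom_X)

lemma isbin_nonzero: "isbin \<alpha> p \<Longrightarrow> p \<noteq> 0"
proof
  assume "isbin \<alpha> p" "p = 0"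
  then obtain a k l where p: "smul (tpow k) (X (a + C $ \<alpha>)) - smul (tpow l) (X a) = 0"
    by (auto simp: isbin_def)
  have "a + C $ \<alpha> \<noteq> a"
  proof
    assume "a + C $ \<alpha> = a"
    then have "(a + C $ \<alpha>) $ \<alpha> = a $ \<alpha>" by simp
    then show False by (simp add: C_diag)
  qed
  moreover have "cf (smul (tpow k) (X (a + C $ \<alpha>)) - smul (tpow l) (X a)) (a, 0) = 0" unfolding p by simp
  ultimately show False by (simp add: X_eq_E cf_E)
qed

lemma restr_X_mult: "restr S (X a * x) = X a * restr (\<lambda>i. S (i + (a, 0))) x"
  by (rule cf_ext) (simp add: X_eq_E cf_E_mult)

lemma restr_smul: "restr S (smul c x) = smul c (restr S x)"
  and restr_diff: "restr S (x - y) = restr S x - restr S y"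
  by (simp_all add: restr_def)

lemma hom_restr: "hom b x \<Longrightarrow> hom b (restr S x)"
  by (simp add: hom_iff)

text \<open>Modulo the first binomial, \<open>f\<close> is fixed by the monomial \<open>T\<close>, which shifts the degree
  \<open>ll _ (axis \<beta> 1)\<close> for which the first binomial is homogeneous.\<close>

lemma isbin_coprime:
  assumes p: "isbin \<alpha> p" and q: "isbin \<beta> q" and ne: "\<alpha> \<noteq> \<beta>"
    and f: "hom 0 f" and h: "hom 0 h" and eq: "q * f = p * h"
  shows "\<exists>g. hom 0 g \<and> f = p * g"
proof -
  obtain a k l where p_def: "p = smul (tpow k) (X (a + C $ \<alpha>)) - smul (tpow l) (X a)"
    using p by (auto simp: isbin_def)
  obtain a' k' l' where q_def: "q = smul (tpow k') (X (a' + C $ \<beta>)) - smul (tpow l') (X a')"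
    using q by (auto simp: isbin_def)
  \<comment> \<open>A unit multiple of \<open>q\<close> is \<open>T - 1\<close>, so the hypothesis
    says that \<open>T * f\<close> and \<open>f\<close> agree modulo \<open>p\<close>.\<close>
  define T where "T = smul (tpow (k' - l')) (X (C $ \<beta>))"
  define u where "u = smul (tpow (- l')) (X (- a'))"
  have hT: "hom 0 T" "hom 0 u" by (simp_all add: T_def u_def hom_smul hom_X)
  have hp: "hom 0 p" by (rule isbin_hom[OF p])
  have "u * q = T - 1"
    by (simp add: u_def q_def T_def right_diff_distrib smul_mult_smul X_mult_X tpow_add[symmetric])
  then have "T * f - f = u * (q * f)" by (simp add: mult.assoc[symmetric] left_diff_distrib)
  also have "\<dots> = p * (u * h)"
    unfolding eq using hom_0_commute[OF hT(2) hp] by (simp add: mult.assoc[symmetric])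
  finally have e: "T * f - f = p * (u * h)" .
  have base: "f = T * f - p * (u * h)" unfolding e[symmetric] by simp
  have huh: "hom 0 (u * h)" using hom_mult[OF hT(2) h] by simp
  have iter: "\<exists>g. hom 0 g \<and> f = T ^ n * f - p * g" for n
  proof (induction n)
    case (Suc n)
    then obtain g where g: "hom 0 g" "f = T ^ n * f - p * g" by blast
    have "T * f = T * (T ^ n * f) - p * (T * g)"
      using arg_cong[OF g(2), of "\<lambda>x. T * x"] hom_0_commute[OF hT(1) hp]
      by (simp add: right_diff_distrib mult.assoc[symmetric])
    then have "T ^ Suc n * f = T * f + p * (T * g)" by (simp add: mult.assoc)
    then have "T ^ Suc n * f - p * (T * g + u * h) = T * f - p * (u * h)"
      by (simp only:) (simp add: distrib_left)
    then have "f = T ^ Suc n * f - p * (T * g + u * h)" using base by (simp only:)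
    moreover have "hom 0 (T * g + u * h)" using hom_mult[OF hT(1) g(1)] huh by (simp add: hom_add)
    ultimately show ?case by blast
  qed (intro exI[of _ 0], simp)
  define \<psi> where "\<psi> i = ll (fst i) (axis \<beta> 1)" for i :: "'n intvec \<times> 'n intvec"
  define S where "S = \<psi> ` supp f"
  define M where "M = (\<Sum>s\<in>S. \<bar>s\<bar>)"
  have M: "\<bar>s\<bar> \<le> M" if "s \<in> S" for s
    unfolding M_def by (rule member_le_sum) (use that in \<open>auto simp: S_def\<close>)
  \<comment> \<open>This exceeds the distance between any two elements of \<open>S\<close>, so
    \<open>T ^ n\<close> moves every \<open>\<psi>\<close>-degree of \<open>f\<close> out of
    \<open>S\<close>.\<close>
  define n where "n = nat (2 * M + 1)"
  have M0: "0 \<le> M" by (simp add: M_def sum_nonneg)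
  have Tn: "T ^ n = smul (tpow (int n * (k' - l'))) (X (int n *s C $ \<beta>))" for n
  proof (induction n)
    case (Suc n)
    have "int (Suc n) *s C $ \<beta> = C $ \<beta> + int n *s C $ \<beta>" by (simp add: vec_eq_iff algebra_simps)
    then show ?case using Suc
      by (simp add: T_def smul_mult_smul X_mult_X tpow_add[symmetric] algebra_simps)
  qed simp
  have \<psi>C: "ll (int n *s C $ \<gamma>) (axis \<beta> 1) = (if \<gamma> = \<beta> then int n * det C else 0)" for n \<gamma>
  proof -
    have "ll (int n *s C $ \<gamma>) (axis \<beta> 1) = int n * ll (C $ \<gamma>) (axis \<beta> 1)"
      by (simp add: ll_axis_right sum_distrib_left algebra_simps)
    then show ?thesis by (simp add: ll_row axis_def)
  qed
  have zero: "restr (\<lambda>i. \<psi> i \<in> S) (T ^ n * f) = 0"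
  proof (rule cf_ext)
    fix i
    have "cf (T ^ n * f) i = 0" if "\<psi> i \<in> S"
    proof (rule ccontr)
      assume "cf (T ^ n * f) i \<noteq> 0"
      then have "cf f (i - (int n *s C $ \<beta>, 0)) \<noteq> 0"
        by (auto simp: Tn smul_mult_left X_eq_E cf_E_mult)
      then have "\<psi> (i - (int n *s C $ \<beta>, 0)) \<in> S" by (auto simp: S_def in_supp)
      then have "\<psi> i - int n * det C \<in> S"
        using \<psi>C[of n \<beta>] by (simp add: \<psi>_def ll_diff_left)
      then have "\<bar>int n * det C\<bar> \<le> 2 * M" using M[of "\<psi> i"] M[of "\<psi> i - int n * det C"] that by linarith
      moreover have "int n \<le> \<bar>int n * det C\<bar>"
      proof -
        have "int n * 1 \<le> int n * \<bar>det C\<bar>"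
          using det_nonzero by (intro mult_left_mono) auto
        then show ?thesis by (simp add: abs_mult)
      qed
      ultimately show False using M0 by (simp add: n_def)
    qed
    then show "cf (restr (\<lambda>i. \<psi> i \<in> S) (T ^ n * f)) i = cf 0 i" by simp
  qed
  obtain g where g: "hom 0 g" "f = T ^ n * f - p * g" using iter by blast
  \<comment> \<open>Both monomials of \<open>p\<close> shift \<open>\<psi>\<close> by the same
    amount because \<open>\<alpha> \<noteq> \<beta>\<close>, so restriction by \<open>\<psi>\<close>
    passes through multiplication by \<open>p\<close>.\<close>
  have "restr (\<lambda>i. \<psi> i \<in> S) (p * g) = p * restr (\<lambda>i. \<psi> (i + (a, 0)) \<in> S) g"
  proof -
    have "\<psi> (i + (a + C $ \<alpha>, 0)) = \<psi> (i + (a, 0))" for i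
      using \<psi>C[of 1 \<alpha>] ne by (simp add: \<psi>_def ll_add_left)
    then show ?thesis
      by (simp add: p_def left_diff_distrib restr_diff restr_smul smul_mult_left restr_X_mult)
  qed
  moreover have "restr (\<lambda>i. \<psi> i \<in> S) f = f"
    by (rule cf_ext) (auto simp: S_def in_supp)
  moreover have "restr (\<lambda>i. \<psi> i \<in> S) f = restr (\<lambda>i. \<psi> i \<in> S) (T ^ n * f) - restr (\<lambda>i. \<psi> i \<in> S) (p * g)"
    using arg_cong[OF g(2), of "restr (\<lambda>i. \<psi> i \<in> S)"] by (simp only: restr_diff)
  ultimately have "f = p * (- restr (\<lambda>i. \<psi> (i + (a, 0)) \<in> S) g)"
    using zero by simp
  moreover have "hom 0 (- restr (\<lambda>i. \<psi> (i + (a, 0)) \<in> S) g)"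
    using hom_diff[OF hom_0 hom_restr[OF g(1)]] by simp
  ultimately show ?thesis by blast
qed

inductive binprod :: "'n set \<Rightarrow> 'a \<Rightarrow> bool" for S where
  one: "binprod S 1"
| mult: "\<alpha> \<in> S \<Longrightarrow> isbin \<alpha> p \<Longrightarrow> binprod S D \<Longrightarrow> binprod S (p * D)"

lemma binprod_hom: "binprod S D \<Longrightarrow> hom 0 D"
proof (induction rule: binprod.induct)
  case (mult \<alpha> p D)
  then show ?case using hom_mult[OF isbin_hom[OF mult(2)] mult(4)] by simp
qed (simp add: hom_1)

lemma binprod_isbin_coprime:
  assumes "binprod S D" "isbin \<alpha> p" "\<alpha> \<notin> S" "hom 0 f" "hom 0 h" "D * f = p * h"
  shows "\<exists>g. hom 0 g \<and> f = p * g"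
  using assms
proof (induction arbitrary: f h rule: binprod.induct)
  case (mult \<beta> q D)
  have "hom 0 (D * f)" using hom_mult[OF binprod_hom[OF mult(3)] mult(7)] by simp
  then obtain g where g: "hom 0 g" "D * f = p * g"
    using isbin_coprime[OF mult(5) mult(2) _ _ mult(8), of "D * f"] mult(1,6,9) by (auto simp: mult.assoc)
  then show ?case using mult(4)[OF mult(5,6,7) g] by blast
qed auto

lemma binprod_coprime:
  assumes "binprod S D" "binprod S' D'" "S \<inter> S' = {}" "hom 0 f" "hom 0 g" "D' * f = D * g"
  shows "\<exists>h. hom 0 h \<and> f = D * h"
  using assms
proof (induction arbitrary: f g rule: binprod.induct)
  case (mult \<alpha> p D)
  have hD: "hom 0 D" "hom 0 D'" "hom 0 p" using mult binprod_hom isbin_hom by blast+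
  have "hom 0 (D * g)" using hom_mult[OF hD(1) mult(8)] by simp
  then obtain f1 where f1: "hom 0 f1" "f = p * f1"
    using binprod_isbin_coprime[OF mult(5) mult(2) _ mult(7), of "D * g"] mult(1,6,9)
    by (auto simp: mult.assoc)
  have "p * (D' * f1) = p * (D * g)"
    using mult(9) hom_0_commute[OF hD(2,3)] unfolding f1 by (simp add: mult.assoc[symmetric])
  then have "D' * f1 = D * g" by (rule cancel_left[OF isbin_nonzero[OF mult(2)]])
  then obtain h where "hom 0 h" "f1 = D * h" using mult(4)[OF mult(5,6) f1(1) mult(8)] by blast
  then show ?case using f1(2) by (auto simp: mult.assoc)
qed auto

lemma isbin_Y: "isbin \<alpha> p \<Longrightarrow> \<exists>p'. isbin \<alpha> p' \<and> Y b * p = p' * Y b"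
proof -
  assume "isbin \<alpha> p"
  then obtain a k l where p: "p = smul (tpow k) (X (a + C $ \<alpha>)) - smul (tpow l) (X a)"
    by (auto simp: isbin_def)
  have "Y b * p = (smul (tpow (k - ll b (a + C $ \<alpha>))) (X (a + C $ \<alpha>)) - smul (tpow (l - ll b a)) (X a)) * Y b"
    by (simp add: p right_diff_distrib left_diff_distrib smul_mult_right smul_mult_left YX tpow_add[symmetric])
  then show ?thesis unfolding isbin_def by blast
qed

lemma isbin_Z: "isbin \<alpha> p \<Longrightarrow> (\<And>j. 0 \<le> b $ j) \<Longrightarrow> \<exists>p'. isbin \<alpha> p' \<and> Z b * p = p' * Z b"
proof -
  assume "isbin \<alpha> p" and b: "\<And>j. 0 \<le> b $ j"
  then obtain a k l where p: "p = smul (tpow k) (X (a + C $ \<alpha>)) - smul (tpow l) (X a)"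
    by (auto simp: isbin_def)
  have ZX: "Z b * X a = smul (tpow (ll b a)) (X a * Z b)" for a using qc_Z_X[OF b] by (simp add: qc_def)
  have "Z b * p = (smul (tpow (k + ll b (a + C $ \<alpha>))) (X (a + C $ \<alpha>)) - smul (tpow (l + ll b a)) (X a)) * Z b"
    by (simp add: p right_diff_distrib left_diff_distrib smul_mult_right smul_mult_left ZX tpow_add[symmetric])
  then show ?thesis unfolding isbin_def by blast
qed

lemma isbin_P: "isbin \<alpha> (P \<alpha>)"
  unfolding isbin_def P_def by (intro exI[of _ "nb \<alpha>"] exI[of _ 0]) (simp add: nb_def)

lemma isbin_smul: "isbin \<alpha> p \<Longrightarrow> isbin \<alpha> (smul (tpow k) p)"
  unfolding isbin_def by (auto simp: scale_right_diff_distrib tpow_add[symmetric]) blast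

text \<open>By the recursion at index 0, \<open>Q \<alpha> (-1) * Q \<alpha> 1\<close> is a binomial
  for \<open>\<alpha>\<close>, and it stays one when the remaining factors are moved across
  it.\<close>

lemma binprod_Z_Y:
  assumes "\<And>j. 0 \<le> b $ j"
  shows "binprod {\<beta>. b $ \<beta> \<noteq> 0} (Z b * Y b)"
proof -
  \<comment> \<open>Stated for all larger sets \<open>S\<close>, since the support of
    \<open>b\<close> grows along the induction.\<close>
  have "{\<beta>. b $ \<beta> \<noteq> 0} \<subseteq> S \<longrightarrow> binprod S (Z b * Y b)" for S
    using assms
  proof (induction rule: Z_induct)
    case zero
    then show ?case by (simp add: binprod.one)
  next
    case (add b \<alpha>)
    show ?case
    proof
      assume S: "{\<beta>. (b + axis \<alpha> 1) $ \<beta> \<noteq> 0} \<subseteq> S"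
      have "b $ \<beta> \<noteq> 0 \<Longrightarrow> (b + axis \<alpha> 1) $ \<beta> \<noteq> 0" for \<beta> using add(1)[of \<beta>] by (cases "\<beta> = \<alpha>") (auto simp: axis_def)
      then have IH: "binprod S (Z b * Y b)" using add(2) S by blast
      have "\<alpha> \<in> S" using S add(1)[of \<alpha>] by (auto simp: axis_def)
      obtain p where p: "isbin \<alpha> p" "Y (- axis \<alpha> 1) * P \<alpha> = p * Y (- axis \<alpha> 1)"
        using isbin_Y[OF isbin_P] by blast
      then have "Q \<alpha> (- 1) * Q \<alpha> 1 = smul (tpow (- lam C \<alpha> \<alpha>)) p"
        by (simp add: Q_minus_1 Y_axis[symmetric] smul_mult_left mult.assoc)
      moreover obtain p' where p': "isbin \<alpha> p'"
          "Z b * smul (tpow (- lam C \<alpha> \<alpha>)) p = p' * Z b"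
        using isbin_Z[OF isbin_smul[OF p(1)] add(1)] by blast
      moreover have "Z (b + axis \<alpha> 1) * Y (b + axis \<alpha> 1) = Z b * (Q \<alpha> (- 1) * Q \<alpha> 1) * Y b"
        by (simp add: Z_add add(1) axis_nonneg Mn_axis Y_add Y_axis[symmetric] mult.assoc)
          (simp add: Y_mult_Y add.commute)
      ultimately have "Z (b + axis \<alpha> 1) * Y (b + axis \<alpha> 1) = p' * (Z b * Y b)"
        by (simp add: mult.assoc)
      then show "binprod S (Z (b + axis \<alpha> 1) * Y (b + axis \<alpha> 1))"
        using binprod.mult[OF \<open>\<alpha> \<in> S\<close> p'(1) IH] by simp
    qed
  qed
  then show ?thesis by blast
qed

lemma hom_Z_swap: "hom 0 h \<Longrightarrow> (\<And>j. 0 \<le> b $ j) \<Longrightarrow> \<exists>h'. hom 0 h' \<and> Z b * h = h' * Z b"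
proof (induction rule: hom_induct)
  case zero
  show ?case by (intro exI[of _ 0]) simp
next
  case (add x y)
  then obtain x' y' where "hom 0 x'" "Z b * x = x' * Z b" "hom 0 y'" "Z b * y = y' * Z b" by blast
  then show ?case by (intro exI[of _ "x' + y'"]) (simp add: hom_add distrib_left distrib_right)
next
  case (smul c a)
  have "Z b * X a = smul (tpow (ll b a)) (X a * Z b)" using qc_Z_X[OF smul] by (simp add: qc_def)
  then show ?case
    by (intro exI[of _ "smul (c * tpow (ll b a)) (X a)"])
      (simp add: hom_smul hom_X smul_mult_left smul_mult_right)
qed

section \<open>The expansion\<close>

definition pos_part :: "'n intvec \<Rightarrow> 'n intvec" where
  "pos_part m = (\<chi> \<beta>. max 0 (m $ \<beta>))"

definition neg_part :: "'n intvec \<Rightarrow> 'n intvec" where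
  "neg_part m = (\<chi> \<beta>. max 0 (- m $ \<beta>))"

lemma parts_nonneg: "0 \<le> pos_part m $ \<beta>" "0 \<le> neg_part m $ \<beta>"
  by (simp_all add: pos_part_def neg_part_def)

lemma parts_diff: "pos_part m - neg_part m = m"
  by (simp add: pos_part_def neg_part_def vec_eq_iff max_def)

definition W :: "'n intvec \<Rightarrow> 'a" where
  "W m = Z (neg_part m) * Y (pos_part m)"

lemma hom_W: "hom m (W m)"
  using hom_mult[OF hom_Z[of "neg_part m"] hom_Y[of "pos_part m"]] parts_diff[of m]
  by (simp add: W_def parts_nonneg)

lemma W_nonzero: "W m \<noteq> 0"
  by (simp add: W_def mult_eq_0_iff' Z_nonzero)

text \<open>The component of degree \<open>m\<close> is \<open>r * Y m\<close>. Comparing one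
  component of the two sides of the reflection equation gives
  \<open>Z ?p * r = Z ?n * comp (- m) y\<close>. After multiplication by \<open>Y ?p\<close> this
  becomes an equation between multiples of \<open>Z ?p * Y ?p\<close> and of
  \<open>Z ?n * Y ?n\<close>, which are coprime as the supports of \<open>?p\<close> and
  \<open>?n\<close> are disjoint; so \<open>Z ?n\<close> splits off \<open>r\<close>, up to
  reordering.\<close>

lemma refl_rel_divisible:
  assumes "refl_rel x y"
  shows "\<exists>f. hom 0 f \<and> comp m x = f * W m"
proof -
  let ?p = "pos_part m" and ?n = "neg_part m"
  obtain v0 where v0: "refl_rel_at v0 x y" using assms by (auto simp: refl_rel_def)
  define v where "v = v0 + ?n"
  have v0n: "\<And>j. 0 \<le> v0 $ j" using v0 by (simp add: refl_rel_at_def)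
  have v: "inB (x * Y v)" "sg (x * Y v) = Z v * y" "\<And>j. 0 \<le> v $ j"
    using refl_rel_at_mono[OF v0, of ?n] parts_nonneg unfolding v_def refl_rel_at_def by auto
  define r where "r = comp m x * Y (- m)"
  have r: "hom 0 r" "comp m x = r * Y m" using hom_factor[OF hom_comp, of m x] by (simp_all add: r_def)
  have mv: "m + v = v0 + ?p" using parts_diff[of m] by (simp add: v_def algebra_simps)
  have "comp (m + v) (x * Y v) = r * Y (m + v)"
    unfolding comp_mult_right[OF hom_Y] r(2) by (simp add: Y_add mult.assoc)
  then have "comp (- (m + v)) (sg (x * Y v)) = Z (m + v) * r"
    using v0n parts_nonneg by (intro comp_sg v r) (simp add: mv)
  moreover have "comp (- (m + v)) (Z v * y) = Z v * comp (- m) y"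
  proof -
    have "- v + - m = - (m + v)" by simp
    from comp_mult_left[OF hom_Z[OF v(3)], of "- m" y, unfolded this] show ?thesis .
  qed
  ultimately have "Z (v0 + ?p) * r = Z (v0 + ?n) * comp (- m) y"
    unfolding v(2) mv[symmetric] v_def[symmetric] by simp
  then have "Z v0 * (Z ?p * r) = Z v0 * (Z ?n * comp (- m) y)"
    by (simp add: Z_add v0n parts_nonneg mult.assoc)
  then have main: "Z ?p * r = Z ?n * comp (- m) y" by (rule cancel_left[OF Z_nonzero])
  \<comment> \<open>The conjugation brings \<open>Y ?p\<close> next to \<open>Z ?p\<close>, so that
    both sides start with a product of binomials.\<close>
  define \<theta> where "\<theta> = Y (- ?p) * r * Y ?p"
  define g where "g = Y (- ?n) * comp (- m) y * Y ?p"
  have h\<theta>: "hom 0 \<theta>" using hom_mult[OF hom_mult[OF hom_Y r(1)] hom_Y, of "- ?p" ?p] by (simp add: \<theta>_def)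
  have "- ?n + - m + ?p = 0" using parts_diff[of m] by (simp add: algebra_simps)
  then have hg: "hom 0 g" using hom_mult[OF hom_mult[OF hom_Y[of "- ?n"] hom_comp[of "- m" y]] hom_Y[of ?p]]
    by (simp add: g_def)
  have E1: "(Z ?p * Y ?p) * \<theta> = (Z ?n * Y ?n) * g"
    using arg_cong[OF main, of "\<lambda>x. x * Y ?p"] by (simp add: \<theta>_def g_def mult.assoc)
  have D1: "{\<beta>. ?n $ \<beta> \<noteq> 0} \<inter> {\<beta>. ?p $ \<beta> \<noteq> 0} = {}"
    by (auto simp: pos_part_def neg_part_def max_def split: if_splits)
  obtain h where h: "hom 0 h" "\<theta> = (Z ?n * Y ?n) * h"
    using binprod_coprime[OF binprod_Z_Y[OF parts_nonneg(2)] binprod_Z_Y[OF parts_nonneg(1)] D1 h\<theta> hg E1]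
    by blast
  have "?p $ \<beta> = 0 \<or> ?n $ \<beta> = 0" for \<beta> by (simp add: pos_part_def neg_part_def max_def)
  from qc_Y_Z[OF parts_nonneg(2) this] obtain k where k: "qc k (Y ?p) (Z ?n)" by blast
  have m_eq: "Y m = Y ?p * Y (- ?n)" using parts_diff[of m] by (simp add: Y_mult_Y)
  have "comp m x = Y ?p * \<theta> * Y (- ?n)"
    unfolding r(2) m_eq by (simp add: \<theta>_def mult.assoc)
  also have "\<dots> = smul (tpow k) (Z ?n * (Y ?p * Y ?n * h * Y (- ?n)))"
    using k unfolding h(2) by (simp add: qc_def smul_mult_left mult.assoc[symmetric])
  also have "Y ?p * Y ?n * h * Y (- ?n) = (Y ?p * Y ?n) * h * Y (- (?p + ?n)) * Y ?p"
    by (simp add: mult.assoc Y_mult_Y)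
  also have "smul (tpow k) (Z ?n * \<dots>) = smul (tpow k) (Z ?n * ((Y ?p * Y ?n) * h * Y (- (?p + ?n)))) * Y ?p"
    by (simp add: smul_mult_left mult.assoc)
  finally have 1: "comp m x = smul (tpow k) (Z ?n * ((Y ?p * Y ?n) * h * Y (- (?p + ?n)))) * Y ?p" .
  have "hom 0 ((Y ?p * Y ?n) * h * Y (- (?p + ?n)))"
    using hom_mult[OF hom_mult[OF hom_Y h(1)] hom_Y, of "?p + ?n" "- (?p + ?n)"] by (simp add: Y_add)
  from hom_Z_swap[OF this parts_nonneg(2)[of m]]
  obtain h2 where h2: "hom 0 h2" "Z ?n * ((Y ?p * Y ?n) * h * Y (- (?p + ?n))) = h2 * Z ?n"
    by blast
  then have "comp m x = smul (tpow k) h2 * W m"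
    unfolding 1 h2(2) W_def by (simp add: smul_mult_left mult.assoc)
  then show ?thesis using hom_smul[OF h2(1)] by blast
qed

lemma Aplus_divisible: "p \<in> Aplus smul Q \<Longrightarrow> \<exists>f. hom 0 f \<and> comp m p = f * W m"
  using refl_rel_Aplus refl_rel_divisible by blast

section \<open>Existence and uniqueness of the coefficients\<close>

lemma laurent_Q0_eq: "laurent_Q0 smul Q c = (\<Sum>a\<in>Poly_Mapping.keys c. smul (Poly_Mapping.lookup c a) (X a))"
  by (simp add: laurent_Q0_def X_def)

lemma cf_laurent_Q0: "cf (laurent_Q0 smul Q c) i = (if snd i = 0 then Poly_Mapping.lookup c (fst i) else 0)"
proof -
  have "cf (laurent_Q0 smul Q c) i =
      (\<Sum>a\<in>Poly_Mapping.keys c. if a = fst i then (if snd i = 0 then Poly_Mapping.lookup c (fst i) else 0) else 0)"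
    unfolding laurent_Q0_eq cf_sum by (intro sum.cong refl) (auto simp: X_eq_E cf_E prod_eq_iff)
  then show ?thesis by (simp add: sum.delta in_keys_iff)
qed

lemma hom_laurent_Q0: "hom 0 (laurent_Q0 smul Q c)"
  by (simp add: hom_iff cf_laurent_Q0)

lemma laurent_Q0_inj: "laurent_Q0 smul Q c = laurent_Q0 smul Q c' \<Longrightarrow> c = c'"
proof (rule poly_mapping_eqI)
  fix a assume "laurent_Q0 smul Q c = laurent_Q0 smul Q c'"
  then have "cf (laurent_Q0 smul Q c) (a, 0) = cf (laurent_Q0 smul Q c') (a, 0)" by simp
  then show "Poly_Mapping.lookup c a = Poly_Mapping.lookup c' a" by (simp add: cf_laurent_Q0)
qed

lemma laurent_Q0_zero [simp]: "laurent_Q0 smul Q 0 = 0"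
  by (simp add: laurent_Q0_eq)

lemma laurent_Q0_surj:
  assumes "hom 0 f"
  shows "\<exists>c. laurent_Q0 smul Q c = f"
proof -
  have "finite {a. cf f (a, 0) \<noteq> 0}"
    by (rule finite_subset[of _ "fst ` supp f"]) (force simp: in_supp image_iff)+
  then have "Poly_Mapping.lookup (Abs_poly_mapping (\<lambda>a. cf f (a, 0))) a = cf f (a, 0)" for a
    by (simp add: lookup_Abs_poly_mapping)
  then have "laurent_Q0 smul Q (Abs_poly_mapping (\<lambda>a. cf f (a, 0))) = f"
    using assms by (intro cf_ext) (auto simp: cf_laurent_Q0 hom_iff)
  then show ?thesis by blast
qed

lemma expansion_eq:
  "expansion smul Q c = (\<Sum>m\<in>Poly_Mapping.keys c. laurent_Q0 smul Q (Poly_Mapping.lookup c m) * W m)"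
proof -
  have "oprod (\<lambda>\<alpha>. if m $ \<alpha> < 0 then Q \<alpha> (- 1) ^ nat (- (m $ \<alpha>)) else 1) = Z (neg_part m)"
    "oprod (\<lambda>\<beta>. if 0 < m $ \<beta> then Q \<beta> 1 ^ nat (m $ \<beta>) else 1) = Y (pos_part m)" for m
    unfolding Mn_def Mn_1[OF parts_nonneg(1), symmetric]
    by (rule oprod_cong, simp add: neg_part_def pos_part_def max_def)+
  then show ?thesis by (simp add: expansion_def W_def mult.assoc)
qed

lemma comp_expansion: "comp m (expansion smul Q c) = laurent_Q0 smul Q (Poly_Mapping.lookup c m) * W m"
proof -
  have h: "hom k (laurent_Q0 smul Q d * W k)" for k d
    using hom_mult[OF hom_laurent_Q0 hom_W] by simp
  have "comp m (expansion smul Q c) =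
      (\<Sum>k\<in>Poly_Mapping.keys c. if k = m then laurent_Q0 smul Q (Poly_Mapping.lookup c m) * W m else 0)"
    unfolding expansion_eq comp_sum by (intro sum.cong refl) (auto simp: comp_hom[OF h])
  also have "\<dots> = laurent_Q0 smul Q (Poly_Mapping.lookup c m) * W m"
    by (simp add: sum.delta in_keys_iff)
  finally show ?thesis .
qed

lemma expansion_unique: "expansion smul Q c = expansion smul Q c' \<Longrightarrow> c = c'"
proof (rule poly_mapping_eqI)
  fix m assume "expansion smul Q c = expansion smul Q c'"
  then have "laurent_Q0 smul Q (Poly_Mapping.lookup c m) * W m = laurent_Q0 smul Q (Poly_Mapping.lookup c' m) * W m"
    using comp_expansion by metis
  then show "Poly_Mapping.lookup c m = Poly_Mapping.lookup c' m"
    using cancel_right[OF W_nonzero] laurent_Q0_inj by blast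
qed

lemma expansion_exists:
  assumes "p \<in> Aplus smul Q"
  shows "\<exists>c. p = expansion smul Q c"
proof -
  have "\<exists>c. comp m p = laurent_Q0 smul Q c * W m" for m
    using Aplus_divisible[OF assms, of m] laurent_Q0_surj by blast
  then obtain l where l: "\<And>m. comp m p = laurent_Q0 smul Q (l m) * W m" by metis
  have "{m. l m \<noteq> 0} \<subseteq> snd ` supp p"
  proof
    fix m assume "m \<in> {m. l m \<noteq> 0}"
    then have "laurent_Q0 smul Q (l m) \<noteq> 0" using laurent_Q0_inj[of "l m" 0] by auto
    then have "comp m p \<noteq> 0" using W_nonzero by (simp add: l mult_eq_0_iff')
    then obtain i where "i \<in> supp (comp m p)" using supp_nonempty by blast
    then show "m \<in> snd ` supp p" by (auto simp: in_supp image_iff split: if_splits)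
  qed
  then have "finite {m. l m \<noteq> 0}" by (rule finite_subset) simp
  then have lookup: "Poly_Mapping.lookup (Abs_poly_mapping l) = l" by (simp add: lookup_Abs_poly_mapping)
  have "comp m p = comp m (expansion smul Q (Abs_poly_mapping l))" for m
    by (simp add: comp_expansion lookup l)
  then have "cf p i = cf (expansion smul Q (Abs_poly_mapping l)) i" for i
    by (metis cf_comp)
  then have "p = expansion smul Q (Abs_poly_mapping l)" by (rule cf_ext)
  then show ?thesis by blast
qed

end

section \<open>The cyclic representation\<close>

text \<open>The top term of \<open>Q \<alpha> i\<close> has degree \<open>i\<close> in direction
  \<open>\<alpha>\<close>, so this computes the top degree of the ordered monomial labelled by
  \<open>k\<close>.\<close>

lemma xk_weight: "(\<Sum>i\<in>{i. 1 \<le> i \<and> (\<exists>\<alpha>. unit_n k \<alpha> i \<noteq> 0)}. unit_n k \<mu> i * i) = k (\<mu> :: 'n::finite)"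
  and finite_unit_n: "finite {i. 1 \<le> i \<and> (\<exists>\<alpha> :: 'n. unit_n k \<alpha> i \<noteq> 0)}"
proof -
  let ?S = "{i. 1 \<le> i \<and> (\<exists>\<alpha> :: 'n. unit_n k \<alpha> i \<noteq> 0)}"
  have "?S \<subseteq> range k" by (auto simp: unit_n_def split: if_splits)
  then show fin: "finite ?S" by (rule finite_subset) simp
  have "(\<Sum>i\<in>?S. unit_n k \<mu> i * i) = (\<Sum>i\<in>?S. if i = k \<mu> then k \<mu> else 0)"
    by (intro sum.cong refl) (auto simp: unit_n_def)
  also have "\<dots> = k \<mu>"
  proof (cases "k \<mu> = 0")
    case False
    then have "k \<mu> \<in> ?S" by (auto simp: unit_n_def intro!: exI[of _ \<mu>])
    then show ?thesis using fin by simp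
  qed simp
  finally show "(\<Sum>i\<in>?S. unit_n k \<mu> i * i) = k \<mu>" .
qed

context Q_system
begin

section \<open>Leading terms of the ordered monomials\<close>

abbreviation xk :: "('n \<Rightarrow> nat) \<Rightarrow> 'a" where
  "xk k \<equiv> ordered_Q_monomial Q (unit_n k)"

lemma LF_supp: "LF R i x \<Longrightarrow> cf x j \<noteq> 0 \<Longrightarrow> j = i \<or> R (j - i)"
  by (simp add: LF_def in_supp)

lemma LF_xk: "\<exists>a. LF top_cone (a, of_label k) (xk k)"
proof -
  let ?n = "unit_n k"
  define wt where "wt i = (\<chi> \<mu>. int (?n \<mu> i * i))" for i
  have row: "\<exists>a. LF top_cone (a, wt i) (oprod (\<lambda>\<alpha>. Q \<alpha> (int i) ^ ?n \<alpha> i))" for i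
  proof -
    have "LF top_cone (\<Sum>\<alpha>\<in>UNIV. (int (?n \<alpha> i) *s axis \<alpha> (1 - int i), int (?n \<alpha> i) *s axis \<alpha> (int i)))
        (oprod (\<lambda>\<alpha>. Q \<alpha> (int i) ^ ?n \<alpha> i))"
      by (intro LF_oprod LF_power cone_top LF_top)
    moreover have "(\<Sum>\<alpha>\<in>UNIV. int (?n \<alpha> i) *s axis \<alpha> (int i)) = wt i"
    proof -
      have "(\<Sum>\<alpha>\<in>UNIV. int (?n \<alpha> i) * axis \<alpha> (int i) $ \<mu>) = (\<Sum>\<alpha>\<in>UNIV. if \<alpha> = \<mu> then int (?n \<mu> i * i) else 0)" for \<mu>
        by (intro sum.cong refl) (auto simp: axis_def)
      then show ?thesis by (simp add: vec_eq_iff wt_def)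
    qed
    ultimately show ?thesis by (auto simp: sum_prod)
  qed
  have main: "\<exists>a. LF top_cone (a, sum_list (map wt xs)) (prod_list (map (\<lambda>i. oprod (\<lambda>\<alpha>. Q \<alpha> (int i) ^ ?n \<alpha> i)) xs))" for xs
  proof (induction xs)
    case Nil
    then show ?case using LF_1 by (auto simp: zero_prod_def)
  next
    case (Cons i xs)
    then obtain a where a: "LF top_cone (a, sum_list (map wt xs))
        (prod_list (map (\<lambda>i. oprod (\<lambda>\<alpha>. Q \<alpha> (int i) ^ ?n \<alpha> i)) xs))" by blast
    obtain b where b: "LF top_cone (b, wt i) (oprod (\<lambda>\<alpha>. Q \<alpha> (int i) ^ ?n \<alpha> i))" using row by blast
    show ?case using LF_mult[OF cone_top b a] by auto
  qed
  have sum: "sum_list (map wt (sorted_list_of_set {i. 1 \<le> i \<and> (\<exists>\<alpha>. ?n \<alpha> i \<noteq> 0)})) = of_label k"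
  proof -
    have "sum_list (map wt (sorted_list_of_set {i. 1 \<le> i \<and> (\<exists>\<alpha>. ?n \<alpha> i \<noteq> 0)})) =
        (\<Sum>i\<in>{i. 1 \<le> i \<and> (\<exists>\<alpha>. ?n \<alpha> i \<noteq> 0)}. wt i)"
      using finite_unit_n[of k] by (simp add: sum_list_distinct_conv_sum_set)
    also have "\<dots> = of_label k"
      using xk_weight[of k] by (simp add: vec_eq_iff wt_def of_nat_sum[symmetric] del: of_nat_sum of_nat_mult)
    finally show ?thesis .
  qed
  show ?thesis
    using main[of "sorted_list_of_set {i. 1 \<le> i \<and> (\<exists>\<alpha>. ?n \<alpha> i \<noteq> 0)}"]
    unfolding sum ordered_Q_monomial_def .
qed

text \<open>Take a label \<open>k\<close> of maximal height that occurs. Apart from its top term,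
  every ordered monomial in the sum has only exponents of height strictly below that of its own
  label, so the degree \<open>of_label k\<close> is met by a single top term and nothing
  cancels.\<close>

lemma span_xk_leading:
  assumes z: "z \<in> span (range xk)" "z \<noteq> 0"
  shows "\<exists>k c a. c \<noteq> 0 \<and> comp (of_label k) z = smul c (X a * Y (of_label k))"
proof -
  obtain f where f: "finite {v. f v \<noteq> 0}" "\<And>v. f v \<noteq> 0 \<Longrightarrow> v \<in> range xk"
      "z = (\<Sum>v | f v \<noteq> 0. smul (f v) v)"
    using z(1) unfolding span_explicit' by blast
  have "{v. f v \<noteq> 0} \<subseteq> range xk" using f(2) by blast
  then obtain K where K: "inj_on xk K" "{v. f v \<noteq> 0} = xk ` K" unfolding subset_image_inj by blast
  have finK: "finite K" using f(1) K by (simp add: finite_image_iff)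
  have z_eq: "z = (\<Sum>k\<in>K. smul (f (xk k)) (xk k))"
    unfolding f(3) K(2) by (simp add: sum.reindex[OF K(1)])
  have "K \<noteq> {}" using z(2) z_eq by auto
  define M where "M = Max ((\<lambda>k. ht (of_label k)) ` K)"
  have "M \<in> (\<lambda>k. ht (of_label k)) ` K"
    unfolding M_def using finK \<open>K \<noteq> {}\<close> by (intro Max_in) auto
  then obtain k where k: "k \<in> K" "ht (of_label k) = M" by auto
  have max: "ht (of_label l) \<le> ht (of_label k)" if "l \<in> K" for l
    unfolding k(2) M_def using finK that by (intro Max_ge) auto
  obtain a where a: "LF top_cone (a, of_label k) (xk k)" using LF_xk by blast
  have other: "cf (xk l) i = 0" if l: "l \<in> K" and i: "snd i = of_label k" "i \<noteq> (a, of_label k)" for l i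
  proof (rule ccontr)
    assume nz: "cf (xk l) i \<noteq> 0"
    obtain b where "LF top_cone (b, of_label l) (xk l)" using LF_xk by blast
    from LF_supp[OF this nz] have "i = (b, of_label l) \<or> top_cone (i - (b, of_label l))" .
    then show False
    proof
      assume "i = (b, of_label l)"
      then have "l = k" using i(1) by (simp add: of_label_inject)
      then have "i = (a, of_label k) \<or> top_cone (i - (a, of_label k))" using LF_supp[OF a] nz by simp
      then show False using i by (simp add: top_cone_def)
    next
      assume "top_cone (i - (b, of_label l))"
      then show False using max[OF l] i(1) by (simp add: top_cone_def ht_diff)
    qed
  qed
  have lead: "cf (xk l) (a, of_label k) = 0" if l: "l \<in> K" "l \<noteq> k" for l
  proof (rule ccontr)
    assume nz: "cf (xk l) (a, of_label k) \<noteq> 0"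
    obtain b where "LF top_cone (b, of_label l) (xk l)" using LF_xk by blast
    from LF_supp[OF this nz]
    have "(a, of_label k) = (b, of_label l) \<or> top_cone ((a, of_label k) - (b, of_label l))" .
    then show False using max[OF l(1)] l(2) by (auto simp: top_cone_def ht_diff of_label_inject)
  qed
  define c where "c = f (xk k) * cf (xk k) (a, of_label k)"
  have "f (xk k) \<noteq> 0" using K(2) k(1) by blast
  then have "c \<noteq> 0" using a by (simp add: c_def LF_def)
  moreover have "comp (of_label k) z = smul c (X a * Y (of_label k))"
  proof (rule cf_ext)
    fix i
    have "cf z (a, of_label k) = (\<Sum>l\<in>K. if l = k then c else 0)"
      unfolding z_eq cf_sum cf_smul by (intro sum.cong refl) (auto simp: lead c_def)
    then have 1: "cf z (a, of_label k) = c" using finK k(1) by simp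
    have 2: "cf z i = 0" if "snd i = of_label k" "i \<noteq> (a, of_label k)"
      unfolding z_eq cf_sum cf_smul using other[OF _ that] by (intro sum.neutral) simp
    show "cf (comp (of_label k) z) i = cf (smul c (X a * Y (of_label k))) i"
      using 1 2 by (auto simp: E_Pair[symmetric] cf_E)
  qed
  ultimately show ?thesis by blast
qed

section \<open>Separation of the graded components\<close>

lemma X_conj:
  assumes "hom c y"
  shows "X a * y * X (- a) = smul (tpow (ll c a)) y"
proof -
  define r where "r = y * Y (- c)"
  have r: "hom 0 r" "y = r * Y c" using hom_factor[OF assms] by (simp_all add: r_def)
  have "X a * y * X (- a) = X a * r * (Y c * X (- a))" by (simp add: r(2) mult.assoc)
  also have "\<dots> = smul (tpow (ll c a)) (X a * r * X (- a) * Y c)"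
    by (simp add: YX ll_minus_right smul_mult_right mult.assoc)
  also have "X a * r * X (- a) = r"
    using hom_0_commute[OF hom_X r(1), of a] by (simp add: mult.assoc)
  finally show ?thesis by (simp add: r(2))
qed

lemma comp_X_conj: "comp c (X a * x * X (- a)) = smul (tpow (ll c a)) (comp c x)"
proof -
  have "comp c (X a * x * X (- a)) = X a * comp c x * X (- a)"
    using comp_mult_right[OF hom_X, of c "X a * x" "- a"] comp_mult_left[OF hom_X, of c a x] by simp
  then show ?thesis using X_conj[OF hom_comp] by simp
qed

text \<open>Conjugation by the \<open>Q \<alpha> 0\<close> separates the graded components.\<close>

lemma comp_closed:
  assumes diff: "\<And>x y. M x \<Longrightarrow> M y \<Longrightarrow> M (x - y)"
    and smul: "\<And>c x. M x \<Longrightarrow> M (smul c x)"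
    and saturated: "\<And>c x. c \<noteq> 0 \<Longrightarrow> M (smul c x) \<Longrightarrow> M x"
    and conj: "\<And>\<alpha> x. M x \<Longrightarrow> M (X (axis \<alpha> 1) * x * X (- axis \<alpha> 1))"
    and x: "M x"
  shows "M (comp b x)"
proof -
  have "\<forall>x. M x \<longrightarrow> snd ` supp x \<subseteq> insert b F \<longrightarrow> M (comp b x)" if "finite F" for F
    using that
  proof (induction F rule: finite_induct)
    case empty
    then show ?case using sum_comp[of "{b}"] by simp
  next
    case (insert b' F)
    show ?case
    proof (intro allI impI)
      fix x assume x: "M x" "snd ` supp x \<subseteq> insert b (insert b' F)"
      show "M (comp b x)"
      proof (cases "b' = b")
        case True
        then show ?thesis using insert.IH x by simp
      next
        case False
        then obtain \<alpha> where \<alpha>: "ll (axis \<alpha> 1) b \<noteq> ll (axis \<alpha> 1) b'" using ll_nondegenerate by blast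
        let ?e = "axis \<alpha> 1"
        \<comment> \<open>Subtracting the eigenvalue of degree \<open>b'\<close> kills that
          component and multiplies the one of degree \<open>b\<close> by a nonzero scalar, which
          saturation removes.\<close>
        define x' where "x' = X ?e * x * X (- ?e) - smul (tpow (ll b' ?e)) x"
        have M': "M x'" unfolding x'_def by (intro diff conj smul x)
        have comp': "comp c x' = smul (tpow (ll c ?e) - tpow (ll b' ?e)) (comp c x)" for c
          by (simp add: x'_def comp_X_conj scale_left_diff_distrib)
        have "snd ` supp x' \<subseteq> insert b F"
        proof
          fix c assume "c \<in> snd ` supp x'"
          then obtain i where i: "i \<in> supp x'" "snd i = c" by blast
          then have nz: "cf (comp c x') i \<noteq> 0" by (simp add: in_supp)
          then have "cf x i \<noteq> 0" "c \<noteq> b'" using i(2) by (auto simp: comp')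
          then have "c \<in> snd ` supp x" using i(2) by (auto simp: in_supp)
          then show "c \<in> insert b F" using x(2) \<open>c \<noteq> b'\<close> by blast
        qed
        then have "M (comp b x')" using insert.IH M' by blast
        moreover have "tpow (ll b ?e) - tpow (ll b' ?e) \<noteq> 0"
          using \<alpha> by (simp add: tpow_inject ll_sym)
        ultimately show ?thesis unfolding comp' using saturated by blast
      qed
    qed
  qed
  from this[OF finite_imageI[OF finite_supp]] show ?thesis using x by blast
qed

end

locale Q_representation = Aplus_representation C smul Q vsmul act bra + cartan C
  for C :: "'n::{finite, linorder} intmat"
    and smul :: "zt \<Rightarrow> 'a::ring_1 \<Rightarrow> 'a"
    and Q :: "'n \<Rightarrow> int \<Rightarrow> 'a"
    and vsmul :: "zt \<Rightarrow> 'v::ab_group_add \<Rightarrow> 'v"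
    and act :: "'v \<Rightarrow> 'a \<Rightarrow> 'v"
    and bra :: "('n \<Rightarrow> nat) \<Rightarrow> 'v"
begin

sublocale Q_system C smul Q ..

abbreviation A :: "'a set" where
  "A \<equiv> Aplus smul Q"

abbreviation vac :: 'v where
  "vac \<equiv> bra (\<lambda>_. 0)"

lemma A_zero: "0 \<in> A"
proof -
  have "smul 0 1 \<in> A" by (rule Aplus.smul[OF Aplus.one])
  then show ?thesis by simp
qed

lemma A_diff: "x \<in> A \<Longrightarrow> y \<in> A \<Longrightarrow> x - y \<in> A"
  using Aplus.add[where x = x and y = "smul (- 1) y"] Aplus.smul[where x = y and c = "- 1"] by force

lemma A_sum: "(\<And>i. i \<in> I \<Longrightarrow> f i \<in> A) \<Longrightarrow> sum f I \<in> A"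
  by (induction I rule: infinite_finite_induct) (auto intro: A_zero Aplus.add)

lemma A_power: "x \<in> A \<Longrightarrow> x ^ n \<in> A"
  by (induction n) (auto intro: Aplus.one Aplus.mult)

lemma A_prod_list: "(\<And>x. x \<in> set xs \<Longrightarrow> x \<in> A) \<Longrightarrow> prod_list xs \<in> A"
  by (induction xs) (auto intro: Aplus.one Aplus.mult)

lemma A_oprod: "(\<And>\<alpha>. f \<alpha> \<in> A) \<Longrightarrow> oprod (f :: 'n \<Rightarrow> 'a) \<in> A"
  unfolding oprod_def by (intro A_prod_list) auto

lemma A_X: "X a \<in> A"
  unfolding X_def upow_def by (intro A_oprod) (auto intro: A_power Aplus.Q0 Aplus.Q0_inv)

lemma A_Y: "(\<And>j. 0 \<le> b $ j) \<Longrightarrow> Y b \<in> A"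
  by (subst Mn_1[symmetric]) (auto simp: Mn_def intro!: A_oprod A_power Aplus.Qm)

lemma A_xk: "xk k \<in> A"
  unfolding ordered_Q_monomial_def
proof (rule A_prod_list)
  fix x assume "x \<in> set (map (\<lambda>i. oprod (\<lambda>\<alpha>. Q \<alpha> (int i) ^ unit_n k \<alpha> i))
      (sorted_list_of_set {i. 1 \<le> i \<and> (\<exists>\<alpha>. unit_n k \<alpha> i \<noteq> 0)}))"
  then obtain i where "1 \<le> i" "x = oprod (\<lambda>\<alpha>. Q \<alpha> (int i) ^ unit_n k \<alpha> i)"
    using finite_unit_n[of k] by auto
  then show "x \<in> A" by (auto intro!: A_oprod A_power Aplus.Qm)
qed

lemma act_zero: "act x 0 = 0"
  using act_smul[OF Aplus.one, of x 0] by simp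

lemma act_zero_left: "p \<in> A \<Longrightarrow> act 0 p = 0"
  using act_smul_left[of p 0 0] by simp

lemma act_diff: "p \<in> A \<Longrightarrow> p' \<in> A \<Longrightarrow> act x (p - p') = act x p - act x p'"
  using act_add[of "p - p'" p' x] by (simp add: A_diff)

lemma bra_indep: "\<not> V.dependent (range bra)" and bra_span: "V.span (range bra) = UNIV"
  using bra_basis by (auto simp: basis_family_def)

text \<open>The coordinates with respect to the basis \<open>bra\<close> lie in \<open>zt\<close>,
  which has no zero divisors.\<close>

lemma torsion_free: "vsmul c x = 0 \<Longrightarrow> c = 0 \<or> x = 0"
proof (rule ccontr)
  assume *: "vsmul c x = 0" "\<not> (c = 0 \<or> x = 0)"
  have "V.representation (range bra) (vsmul c x) = (\<lambda>b. c * V.representation (range bra) x b)"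
    by (rule V.representation_scale[OF bra_indep]) (simp add: bra_span)
  then have "c * V.representation (range bra) x b = 0" for b
    unfolding *(1) V.representation_zero by (metis (no_types))
  then have "V.representation (range bra) x b = 0" for b using *(2) mult_eq_0_iff by blast
  then have "x = 0"
    using V.sum_nonzero_representation_eq[OF bra_indep, of x] by (simp add: bra_span)
  then show False using *(2) by simp
qed

lemma vac_nonzero: "vac \<noteq> 0"
  using bra_indep V.dependent_zero by (metis rangeI)

section \<open>The annihilator of the cyclic vector and its saturation\<close>

definition J :: "'a set" where
  "J = {x \<in> A. act vac x = 0}"

lemma J_diff: "x \<in> J \<Longrightarrow> y \<in> J \<Longrightarrow> x - y \<in> J" and J_smul: "x \<in> J \<Longrightarrow> smul c x \<in> J"
  by (auto simp: J_def A_diff act_diff act_smul intro: Aplus.smul)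

definition sat :: "'a set \<Rightarrow> 'a \<Rightarrow> bool" where
  "sat M x \<longleftrightarrow> (\<exists>s. s \<noteq> 0 \<and> smul s x \<in> M)"

lemma sat_base: "x \<in> M \<Longrightarrow> sat M x"
  unfolding sat_def by (intro exI[of _ 1]) simp

lemma sat_diff:
  assumes diff: "\<And>x y. x \<in> M \<Longrightarrow> y \<in> M \<Longrightarrow> x - y \<in> M"
    and smul: "\<And>c x. x \<in> M \<Longrightarrow> smul c x \<in> M"
    and xy: "sat M x" "sat M y"
  shows "sat M (x - y)"
proof -
  obtain s u where su: "s \<noteq> 0" "smul s x \<in> M" "u \<noteq> 0" "smul u y \<in> M"
    using xy by (auto simp: sat_def)
  have "smul (s * u) (x - y) = smul u (smul s x) - smul s (smul u y)"
    by (simp add: scale_right_diff_distrib mult.commute)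
  also have "\<dots> \<in> M" by (intro diff smul su)
  finally show ?thesis unfolding sat_def using su by (intro exI[of _ "s * u"]) simp
qed

lemma sat_smul: "(\<And>x. x \<in> M \<Longrightarrow> smul c x \<in> M) \<Longrightarrow> sat M x \<Longrightarrow> sat M (smul c x)"
  unfolding sat_def by (metis scale_left_commute)

lemma sat_saturated: "c \<noteq> 0 \<Longrightarrow> sat M (smul c x) \<Longrightarrow> sat M x"
  unfolding sat_def scale_scale by (metis mult_eq_0_iff)

abbreviation Ahat :: "'a \<Rightarrow> bool" where
  "Ahat \<equiv> sat A"

abbreviation Jhat :: "'a \<Rightarrow> bool" where
  "Jhat \<equiv> sat J"

lemma Ahat_diff: "Ahat x \<Longrightarrow> Ahat y \<Longrightarrow> Ahat (x - y)"
  and Jhat_diff: "Jhat x \<Longrightarrow> Jhat y \<Longrightarrow> Jhat (x - y)"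
  by (rule sat_diff; auto intro: A_diff Aplus.smul J_diff J_smul)+

lemma Ahat_smul: "Ahat x \<Longrightarrow> Ahat (smul c x)" and Jhat_smul: "Jhat x \<Longrightarrow> Jhat (smul c x)"
  by (rule sat_smul; auto intro: Aplus.smul J_smul)+

lemma Jhat_Ahat: "Jhat x \<Longrightarrow> Ahat x"
  by (auto simp: sat_def J_def)

lemma Jhat_act: "Jhat x \<Longrightarrow> smul s x \<in> A \<Longrightarrow> act vac (smul s x) = 0"
proof -
  assume "Jhat x" and s: "smul s x \<in> A"
  then obtain u where u: "u \<noteq> 0" "smul u x \<in> A" "act vac (smul u x) = 0" by (auto simp: sat_def J_def)
  have "vsmul u (act vac (smul s x)) = act vac (smul s (smul u x))"
    using act_smul[OF s, of vac u] by (simp add: mult.commute)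
  also have "\<dots> = 0" using act_smul[OF u(2), of vac s] u(3) by simp
  finally show ?thesis using torsion_free u(1) by blast
qed

lemma Jhat_add: "Jhat x \<Longrightarrow> Jhat y \<Longrightarrow> Jhat (x + y)"
  using Jhat_diff[of x "smul (- 1) y"] Jhat_smul[of y "- 1"] by simp

lemma Ahat_mult: "Ahat x \<Longrightarrow> Ahat y \<Longrightarrow> Ahat (x * y)"
  and Jhat_mult_right: "Jhat x \<Longrightarrow> Ahat y \<Longrightarrow> Jhat (x * y)"
proof -
  have mult: "sat N (x * y)" if M: "sat M x" "Ahat y" "\<And>x y. x \<in> M \<Longrightarrow> y \<in> A \<Longrightarrow> x * y \<in> N" for M N
  proof -
    obtain s u where su: "s \<noteq> 0" "smul s x \<in> M" "u \<noteq> 0" "smul u y \<in> A"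
      using M(1,2) by (auto simp: sat_def)
    have "smul (s * u) (x * y) \<in> N"
      unfolding smul_mult_smul[symmetric] by (intro M(3) su)
    then show ?thesis unfolding sat_def using su by (intro exI[of _ "s * u"]) simp
  qed
  show "Ahat x \<Longrightarrow> Ahat y \<Longrightarrow> Ahat (x * y)" by (rule mult) (auto intro: Aplus.mult)
  show "Jhat x \<Longrightarrow> Ahat y \<Longrightarrow> Jhat (x * y)"
    by (rule mult) (auto simp: J_def act_mult act_zero_left intro: Aplus.mult)
qed

lemma Jhat_zero: "Jhat 0"
  by (rule sat_base) (simp add: J_def A_zero act_zero)

lemma Jhat_sum: "(\<And>i. i \<in> I \<Longrightarrow> Jhat (f i)) \<Longrightarrow> Jhat (sum f I)"
  by (induction I rule: infinite_finite_induct) (auto intro: Jhat_zero Jhat_add)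

section \<open>Specialization of the variables of index zero\<close>

definition eig :: "int \<Rightarrow> 'a \<Rightarrow> bool" where
  "eig k x \<longleftrightarrow> x \<in> A \<and> act vac x = vsmul (tpow k) vac"

lemma eig_one: "eig 0 1"
  by (simp add: eig_def Aplus.one act_one)

lemma eig_mult: "eig k x \<Longrightarrow> eig l y \<Longrightarrow> eig (k + l) (x * y)"
  by (auto simp: eig_def act_mult act_smul_left tpow_add Aplus.mult)

lemma eig_power: "eig k x \<Longrightarrow> eig (k * int n) (x ^ n)"
proof (induction n)
  case (Suc n)
  then show ?case using eig_mult[of k x "k * int n" "x ^ n"] by (simp add: algebra_simps)
qed (simp add: eig_one)

lemma eig_Q0: "eig (Q0_value C \<alpha>) (Q \<alpha> 0)"
  by (simp add: eig_def Aplus.Q0 act_Q0)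

lemma eig_Q0_inv: "eig (- Q0_value C \<alpha>) (ring_inv (Q \<alpha> 0))"
proof -
  let ?u = "ring_inv (Q \<alpha> 0)"
  have "Q \<alpha> 0 * ?u = 1" using is_unit_of_ring_inv[OF units(1)] by (simp add: is_unit_of_def)
  then have "vac = act (act vac (Q \<alpha> 0)) ?u"
    using act_mult[OF Aplus.Q0 Aplus.Q0_inv, of vac \<alpha> \<alpha>] by (simp add: act_one)
  also have "\<dots> = vsmul (tpow (Q0_value C \<alpha>)) (act vac ?u)"
    by (simp add: act_Q0 act_smul_left Aplus.Q0_inv)
  finally have "vsmul (tpow (- Q0_value C \<alpha>)) vac =
      vsmul (tpow (- Q0_value C \<alpha>)) (vsmul (tpow (Q0_value C \<alpha>)) (act vac ?u))" by (rule arg_cong)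
  then show ?thesis by (simp add: eig_def Aplus.Q0_inv tpow_add[symmetric])
qed

lemma sum_Q0_value: "(\<Sum>\<alpha>\<in>UNIV. Q0_value C \<alpha> * a $ \<alpha>) = - ll a 1"
  by (simp add: Q0_value_def ll_def sum_negf sum_distrib_left sum_distrib_right mult.commute)

lemma eig_X: "eig (- ll a 1) (X a)"
proof -
  have u: "eig (Q0_value C \<alpha> * a $ \<alpha>) (upow (Q \<alpha> 0) (a $ \<alpha>))" for \<alpha>
    using eig_power[OF eig_Q0, of \<alpha> "nat (a $ \<alpha>)"] eig_power[OF eig_Q0_inv, of \<alpha> "nat (- a $ \<alpha>)"]
    by (auto simp: upow_def)
  have "eig (sum_list (map (\<lambda>\<alpha>. Q0_value C \<alpha> * a $ \<alpha>) xs)) (prod_list (map (\<lambda>\<alpha>. upow (Q \<alpha> 0) (a $ \<alpha>)) xs))" for xs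
    by (induction xs) (auto intro: eig_one eig_mult u)
  from this[of "sorted_list_of_set UNIV"]
  have "eig (\<Sum>\<alpha>\<in>UNIV. Q0_value C \<alpha> * a $ \<alpha>) (X a)"
    by (simp add: X_def oprod_def sum_list_distinct_conv_sum_set)
  then show ?thesis by (simp only: sum_Q0_value)
qed

lemma X_mult_congruent: "Ahat y \<Longrightarrow> Jhat (X a * y - smul (tpow (- ll a 1)) y)"
proof -
  assume "Ahat y"
  then obtain s where s: "s \<noteq> 0" "smul s y \<in> A" by (auto simp: sat_def)
  let ?k = "tpow (- ll a 1)"
  have eq: "smul s (X a * y - smul ?k y) = X a * smul s y - smul ?k (smul s y)"
    by (simp add: scale_right_diff_distrib smul_mult_right mult.commute)
  have in_A: "X a * smul s y \<in> A" "smul ?k (smul s y) \<in> A" by (intro Aplus.mult Aplus.smul A_X s)+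
  have "act vac (X a * smul s y) = vsmul ?k (act vac (smul s y))"
    using eig_X[of a] by (simp add: eig_def act_mult s act_smul_left)
  then have "smul s (X a * y - smul ?k y) \<in> J"
    unfolding eq J_def using in_A by (simp only: A_diff act_diff act_smul[OF s(2)] mem_Collect_eq) simp
  then show ?thesis unfolding sat_def using s(1) by blast
qed

lemma Jhat_X_mult: "Jhat y \<Longrightarrow> Jhat (X a * y)"
  using Jhat_add[OF X_mult_congruent[OF Jhat_Ahat] Jhat_smul[of y "tpow (- ll a 1)"], of y a] by simp

text \<open>The coefficient stands on the left and the action is from the right, so it meets the
  cyclic vector first and acts by its eigenvalue; this is the specialization in
  \<open>phi\<close>.\<close>

lemma laurent_congruent:
  assumes "Ahat y"
  shows "Jhat (laurent_Q0 smul Q c * y - smul (laurent_eval C c) y)"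
proof -
  have "laurent_eval C c = (\<Sum>a\<in>Poly_Mapping.keys c. Poly_Mapping.lookup c a * tpow (- ll a 1))"
    unfolding laurent_eval_def
  proof (intro sum.cong refl arg_cong[where f = "\<lambda>x. _ * x"])
    show "(\<Prod>\<alpha>\<in>UNIV. tpow (Q0_value C \<alpha> * a $ \<alpha>)) = tpow (- ll a 1)" for a
      unfolding tpow_sum[symmetric] sum_Q0_value ..
  qed
  then have "laurent_Q0 smul Q c * y - smul (laurent_eval C c) y =
      (\<Sum>a\<in>Poly_Mapping.keys c. smul (Poly_Mapping.lookup c a) (X a * y - smul (tpow (- ll a 1)) y))"
    by (simp add: laurent_Q0_eq sum_distrib_right scale_sum_left sum_subtractf smul_mult_left
        scale_right_diff_distrib)
  also have "Jhat \<dots>" by (intro Jhat_sum Jhat_smul X_mult_congruent assms)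
  finally show ?thesis .
qed

lemma Ahat_comp: "Ahat x \<Longrightarrow> Ahat (comp b x)"
  by (rule comp_closed[where M = Ahat])
    (auto intro: Ahat_diff Ahat_smul sat_saturated Ahat_mult sat_base A_X)

lemma Jhat_comp: "Jhat x \<Longrightarrow> Jhat (comp b x)"
  by (rule comp_closed[where M = Jhat])
    (auto intro: Jhat_diff Jhat_smul sat_saturated Jhat_mult_right Jhat_X_mult sat_base A_X)

section \<open>Lowering operators\<close>

lemma W_neg_axis: "W (- axis \<gamma> 1) = Q \<gamma> (- 1)"
proof -
  have "neg_part (- axis \<gamma> 1) = axis \<gamma> 1" "pos_part (- axis \<gamma> 1) = 0"
    by (auto simp: neg_part_def pos_part_def vec_eq_iff axis_def)
  then show ?thesis by (simp add: W_def Mn_axis)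
qed

lemma Ahat_Q_minus_1: "Ahat (Q \<gamma> (- 1))"
proof -
  have "\<exists>f. hom 0 f \<and> comp (- axis \<gamma> 1) (Q \<alpha> m) = f * Q \<gamma> (- 1)" if "1 \<le> m" for \<alpha> m
    using Aplus_divisible[OF Aplus.Qm[OF that], of "- axis \<gamma> 1"] by (simp add: W_neg_axis)
  from lowering_operator[OF this] obtain \<alpha> c a m
    where *: "c \<noteq> 0" "1 \<le> m" "comp (- axis \<gamma> 1) (Q \<alpha> m) = smul c (X a * Q \<gamma> (- 1))" by blast
  then have "Ahat (smul c (X a * Q \<gamma> (- 1)))"
    using Ahat_comp[OF sat_base[OF Aplus.Qm]] by metis
  then have "Ahat (X a * Q \<gamma> (- 1))" using sat_saturated *(1) by blast
  then have "Ahat (X (- a) * (X a * Q \<gamma> (- 1)))" by (rule Ahat_mult[OF sat_base[OF A_X]])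
  then show ?thesis by simp
qed

text \<open>Multiplication by \<open>Q \<alpha> (-1)\<close> takes
  \<open>Y (b + axis \<alpha> 1)\<close> to a multiple of \<open>Y b\<close> modulo
  \<open>Jhat\<close>. The factor is, up to a unit, a difference of two powers of \<open>t\<close>
  whose exponents differ by \<open>det C * (b $ \<alpha> + 1)\<close>. The summand 1 comes from the
  prescribed eigenvalues of the \<open>Q \<beta> 0\<close> and keeps the factor nonzero when
  \<open>b $ \<alpha> = 0\<close>.\<close>

lemma not_Jhat_Y: "(\<And>j. 0 \<le> b $ j) \<Longrightarrow> \<not> Jhat (Y b)"
proof (induction rule: Z_induct)
  case zero
  show ?case
  proof
    assume "Jhat (Y 0)"
    then have "act vac (smul 1 1) = 0" by (intro Jhat_act) (simp_all add: Aplus.one)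
    then show False using vac_nonzero by (simp add: act_one)
  qed
next
  case (add b \<alpha>)
  show ?case
  proof
    assume "Jhat (Y (b + axis \<alpha> 1))"
    then have "Jhat (Y (b + axis \<alpha> 1) * Q \<alpha> (- 1))" by (rule Jhat_mult_right) (rule Ahat_Q_minus_1)
    moreover have "Y (b + axis \<alpha> 1) * Q \<alpha> (- 1) = smul (tpow (- lam C \<alpha> \<alpha>)) (Y b * P \<alpha>)"
      by (simp add: Q_minus_1 Y_add smul_mult_right mult.assoc)
    ultimately have J: "Jhat (Y b * P \<alpha>)" using sat_saturated[OF tpow_nonzero] by simp
    define k where "k a = - ll b a - ll a 1" for a
    have Yb: "Ahat (Y b)" using A_Y add(1) sat_base by blast
    have YX_congruent: "Jhat (Y b * X a - smul (tpow (k a)) (Y b))" for a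
    proof -
      have "Y b * X a - smul (tpow (k a)) (Y b) =
          smul (tpow (- ll b a)) (X a * Y b - smul (tpow (- ll a 1)) (Y b))"
        by (simp add: YX k_def scale_right_diff_distrib tpow_add[symmetric])
      then show ?thesis using Jhat_smul[OF X_mult_congruent[OF Yb]] by simp
    qed
    have "Jhat ((Y b * X (axis \<alpha> 2) - smul (tpow (k (axis \<alpha> 2))) (Y b)) -
        (Y b * X (nb \<alpha>) - smul (tpow (k (nb \<alpha>))) (Y b)) - Y b * P \<alpha>)"
      by (intro Jhat_diff YX_congruent J)
    also have "(Y b * X (axis \<alpha> 2) - smul (tpow (k (axis \<alpha> 2))) (Y b)) -
        (Y b * X (nb \<alpha>) - smul (tpow (k (nb \<alpha>))) (Y b)) - Y b * P \<alpha> =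
        smul (tpow (k (nb \<alpha>)) - tpow (k (axis \<alpha> 2))) (Y b)"
      by (simp add: P_def right_diff_distrib scale_left_diff_distrib)
    finally have "Jhat (smul (tpow (k (nb \<alpha>)) - tpow (k (axis \<alpha> 2))) (Y b))" .
    moreover have "tpow (k (nb \<alpha>)) - tpow (k (axis \<alpha> 2)) \<noteq> 0"
    proof -
      have "k (nb \<alpha>) - k (axis \<alpha> 2) = ll (C $ \<alpha>) (b + 1)"
        by (simp add: k_def nb_def ll_diff_left ll_diff_right ll_add_right ll_sym)
      also have "\<dots> = det C * (b $ \<alpha> + 1)" by (simp add: ll_row)
      also have "\<dots> \<noteq> 0" using det_nonzero add(1)[of \<alpha>] by simp
      finally show ?thesis by (simp add: tpow_inject)
    qed
    ultimately have "Jhat (Y b)" using sat_saturated by blast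
    then show False using add(2) by simp
  qed
qed

text \<open>The system \<open>bra_eq\<close> is solved by induction on the height: apart from the
  term of \<open>k\<close> only smaller heights occur, and the diagonal coefficient is a power of
  \<open>t\<close>, hence a unit.\<close>

lemma bra_in_span: "bra k \<in> V.span (range (\<lambda>k. act vac (xk k)))"
proof (induction "nat (ht (of_label k))" arbitrary: k rule: less_induct)
  case less
  let ?S = "V.span (range (\<lambda>k. act vac (xk k)))"
  let ?g = "\<lambda>p. vsmul (tpow (rep_exponent C k p) * Minf C p (unit_n k)) (bra p)"
  define F where "F = {p. ht (of_label p) \<le> ht (of_label k)}"
  have fin: "finite F" unfolding F_def by (rule finite_ht_le)
  have "{p. ?g p \<noteq> 0} \<subseteq> F" using Minf_nonzero[of _ k] by (force simp: F_def)
  then have "act vac (xk k) = sum ?g F"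
    unfolding bra_eq by (rule Sum_any.expand_superset[OF fin])
  also have "\<dots> = ?g k + sum ?g (F - {k})"
    by (rule sum.remove[OF fin]) (simp add: F_def)
  finally have "vsmul (tpow (rep_exponent C k k)) (bra k) = act vac (xk k) - sum ?g (F - {k})"
    by (simp add: Minf_diagonal)
  also have "\<dots> \<in> ?S"
  proof (intro V.span_diff V.span_sum)
    show "act vac (xk k) \<in> ?S" by (intro V.span_base) auto
    fix p assume p: "p \<in> F - {k}"
    show "?g p \<in> ?S"
    proof (cases "Minf C p (unit_n k) = 0")
      case False
      then have "ht (of_label p) < ht (of_label k)" using Minf_nonzero p by blast
      moreover have "0 \<le> ht (of_label p)" by (rule ht_nonneg) simp
      ultimately show ?thesis by (intro V.span_scale less) simp
    qed (simp add: V.span_zero)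
  qed
  finally have "vsmul (tpow (- rep_exponent C k k)) (vsmul (tpow (rep_exponent C k k)) (bra k)) \<in> ?S"
    by (rule V.span_scale)
  then show ?case by (simp add: tpow_add[symmetric])
qed

lemma span_xk_A: "z \<in> span (range xk) \<Longrightarrow> z \<in> A"
  by (induction rule: span_induct_alt) (auto intro: A_zero Aplus.add Aplus.smul A_xk)

lemma reduce_to_span: "\<exists>z\<in>span (range xk). v = act vac z"
proof -
  have "V.span (range bra) \<subseteq> V.span (range (\<lambda>k. act vac (xk k)))"
    by (rule V.span_minimal) (auto intro: bra_in_span V.subspace_span)
  then have "v \<in> V.span (range (\<lambda>k. act vac (xk k)))" by (auto simp: bra_span)
  then show ?thesis
  proof (induction rule: V.span_induct_alt)
    case base
    then show ?case using span_zero act_zero by metis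
  next
    case (step c x y)
    then obtain k z where kz: "x = act vac (xk k)" "z \<in> span (range xk)" "y = act vac z" by blast
    have "smul c (xk k) + z \<in> span (range xk)"
      by (intro span_add span_scale kz) (auto intro: span_base)
    moreover have "vsmul c x + y = act vac (smul c (xk k) + z)"
      unfolding kz using span_xk_A[OF kz(2)] by (simp add: act_add act_smul A_xk Aplus.smul)
    ultimately show ?case by blast
  qed
qed

lemma Jhat_negative:
  assumes x: "Ahat x" "hom m x" and m: "\<not> (\<forall>\<alpha>. 0 \<le> m $ \<alpha>)"
  shows "Jhat x"
proof -
  obtain s where s: "s \<noteq> 0" "smul s x \<in> A" using x(1) by (auto simp: sat_def)
  obtain z where z: "z \<in> span (range xk)" "act vac (smul s x) = act vac z"
    using reduce_to_span by blast
  have J: "Jhat (smul s x - z)"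
    using span_xk_A[OF z(1)] s(2) z(2) by (intro sat_base) (simp add: J_def A_diff act_diff)
  have "z = 0"
  proof (rule ccontr)
    assume "z \<noteq> 0"
    then obtain k c a where k: "c \<noteq> 0" "comp (of_label k) z = smul c (X a * Y (of_label k))"
      using span_xk_leading[OF z(1)] by blast
    \<comment> \<open>The degree \<open>m\<close> has a negative entry and a label has none, so
      \<open>x\<close> contributes nothing to this component.\<close>
    have "of_label k \<noteq> m" using m by auto
    then have "comp (of_label k) (smul s x - z) = smul (- c) (X a * Y (of_label k))"
      using comp_hom[OF x(2)] k(2) by simp
    then have "Jhat (smul (- c) (X a * Y (of_label k)))" using Jhat_comp[OF J] by metis
    then have "Jhat (X a * Y (of_label k))" using sat_saturated[of "- c"] k(1) by simp
    then have "Jhat (X (- a) * (X a * Y (of_label k)))" by (rule Jhat_X_mult)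
    then show False using not_Jhat_Y[of "of_label k"] by simp
  qed
  then show ?thesis using J sat_saturated s(1) by simp
qed

lemma W_nonneg: "(\<And>\<alpha>. 0 \<le> m $ \<alpha>) \<Longrightarrow> W m = Y m"
proof -
  assume m: "\<And>\<alpha>. 0 \<le> m $ \<alpha>"
  have "max 0 (- m $ \<alpha>) = 0" "max 0 (m $ \<alpha>) = m $ \<alpha>" for \<alpha> using m[of \<alpha>] by simp_all
  then have "neg_part m = 0" "pos_part m = m" by (simp_all add: neg_part_def pos_part_def vec_eq_iff)
  then show ?thesis by (simp add: W_def)
qed

theorem act_phi:
  assumes p: "p \<in> A"
  shows "act vac p = act vac (phi C smul Q p)"
proof -
  obtain c where c: "p = expansion smul Q c" using expansion_exists[OF p] by blast
  have the: "(THE c. p = expansion smul Q c) = c"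
    using c expansion_unique by (intro the_equality) auto
  let ?K = "Poly_Mapping.keys c" and ?l = "\<lambda>m. laurent_Q0 smul Q (Poly_Mapping.lookup c m)"
    and ?e = "\<lambda>m. laurent_eval C (Poly_Mapping.lookup c m)"
  let ?N = "{m \<in> ?K. \<forall>\<alpha>. 0 \<le> m $ \<alpha>}"
  have phi: "phi C smul Q p = (\<Sum>m\<in>?N. smul (?e m) (Y m))"
    unfolding phi_def the Let_def
    by (intro sum.cong refl arg_cong[where f = "smul _"]) (simp add: Mn_1[symmetric] Mn_def)
  have phi_A: "phi C smul Q p \<in> A" unfolding phi by (intro A_sum Aplus.smul A_Y) auto
  \<comment> \<open>Each degree is treated separately: for \<open>m \<ge> 0\<close> the coefficient
    may be specialized modulo \<open>Jhat\<close>, and otherwise the whole term lies in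
    \<open>Jhat\<close>.\<close>
  have "p - phi C smul Q p = (\<Sum>m\<in>?K. ?l m * W m - (if \<forall>\<alpha>. 0 \<le> m $ \<alpha> then smul (?e m) (Y m) else 0))"
    unfolding phi sum_subtractf by (simp add: c expansion_eq sum.inter_filter)
  also have "Jhat \<dots>"
  proof (rule Jhat_sum)
    fix m
    show "Jhat (?l m * W m - (if \<forall>\<alpha>. 0 \<le> m $ \<alpha> then smul (?e m) (Y m) else 0))"
    proof (cases "\<forall>\<alpha>. 0 \<le> m $ \<alpha>")
      case True
      then show ?thesis using laurent_congruent[OF sat_base[OF A_Y]] by (simp add: W_nonneg)
    next
      case False
      have "Jhat (?l m * W m)"
      proof (rule Jhat_negative[OF _ _ False])
        \<comment> \<open>The term is the component of degree \<open>m\<close> of \<open>p\<close>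
          itself.\<close>
        show "Ahat (?l m * W m)" using Ahat_comp[OF sat_base[OF p], of m] by (simp add: c comp_expansion)
        show "hom m (?l m * W m)" using hom_mult[OF hom_laurent_Q0 hom_W] by simp
      qed
      then show ?thesis by (simp only: False if_False diff_zero)
    qed
  qed
  finally have "act vac (smul 1 (p - phi C smul Q p)) = 0"
    by (rule Jhat_act) (simp add: A_diff p phi_A)
  then show ?thesis by (simp add: act_diff p phi_A)
qed

end

theorem lemma5p24:
  fixes C :: "'n::{finite, linorder} intmat"
    and smul :: "zt \<Rightarrow> 'a::ring_1 \<Rightarrow> 'a"
    and Q :: "'n \<Rightarrow> int \<Rightarrow> 'a"
    and vsmul :: "zt \<Rightarrow> 'v::ab_group_add \<Rightarrow> 'v"
    and act :: "'v \<Rightarrow> 'a \<Rightarrow> 'v"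
    and bra :: "('n \<Rightarrow> nat) \<Rightarrow> 'v"
    and p :: 'a
  assumes "simple_simply_laced_cartan C"
    and "quantum_Q_system C smul Q"
    and "Aplus_representation C smul Q vsmul act bra"
    and "p \<in> Aplus smul Q"
  shows "act (bra (\<lambda>_. 0)) p = act (bra (\<lambda>_. 0)) (phi C smul Q p)"
proof -
  interpret Q_representation C smul Q vsmul act bra
    by (intro Q_representation.intro cartan.intro assms)
  show ?thesis using assms(4) by (rule act_phi)
qed

end
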